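(* Let $(X,\pi_d)$ be a totally connected weighted simplicial complex of dimension $d$. Suppose $\{M_\tau\in\mathbb{R}^{X(0)\times X(0)}\}_{\tau\in X(\leq d-2)}$ is a family of symmetric matrices satisfying: (1) (Base case) for every $\tau$ of co-dimension $2$, $\Pi_\tau P_\tau-2\pi_\tau\pi_\tau^{\top}\preceq M_\tau\preceq\frac15\Pi_\tau$; (2) (Recursive condition) for every $\tau$ of co-dimension $k\geq3$, at least one of the following holds: either $$M_\tau\preceq\frac{k-1}{3k-1}\Pi_\tau\quad\text{and}\quad\mathbb{E}_{x\sim\pi_\tau}M_{\tau\cup\{x\}}\preceq M_\tau-\frac{k-1}{k-2}M_\tau\Pi_\tau^{-1}M_\tau,$$ or $(X_\tau,\pi_{\tau,k-1})$ is a product of weighted simplicial complexes $(Y_1,\mu_1),\dots,(Y_t,\mu_t)$ and for every $\eta\in X_\tau(k-1)$, $$M_\tau=\bigoplus_{1\leq i\leq t:\,d_{Y_i}\geq1}\frac{d_{Y_i}(d_{Y_i}+1)}{k(k-1)}M_{\tau\cup\eta_{-i}},$$ where $\eta_{-i}=\eta\setminus Y_i(0)$ and $d_{Y_i}$ is the dimension of $Y_i$. Then for every $\tau\in X(\leq d-2)$, $\lambda_2(P_\tau)\leq\rho(\Pi_\tau^{-1}M_\tau)$.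
   Context: Simplicial complex: downward closed family of subsets of a finite ground set; $\dim\tau=|\tau|-1$, $X(k)$ = faces of dimension $k$, $X(\leq i)=X(-1)\cup\dots\cup X(i)$. Pure of dimension $d$: all facets have dimension $d$; $\mathrm{codim}(\tau)=d-\dim\tau$. Link $X_\tau=\{\sigma\setminus\tau:\sigma\in X,\sigma\supseteq\tau\}$, $X_\tau(0)=\{x\notin\tau:\tau\cup\{x\}\in X\}$. A weighted complex $(X,\pi_d)$ has a probability distribution $\pi_d$ on facets, assumed positive on each facet. For $\tau$ of co-dimension $k$ and $-1\leq i\leq k-1$, $\pi_{\tau,i}(\eta)=\binom{k}{i+1}^{-1}\Pr_{\sigma\sim\pi_d}[\sigma\supseteq\tau\cup\eta\mid\sigma\supseteq\tau]$ for $\eta\in X_\tau(i)$; $\pi_\tau=\pi_{\tau,0}$, viewed in $\mathbb{R}^{X(0)}$ (zero off $X_\tau(0)$), $\Pi_\tau=\mathrm{diag}(\pi_\tau)$, and $\Pi_\tau^{-1}$ is its inverse on the support $X_\tau(0)$ (zero elsewhere). For $k\geq2$ the local walk $P_\tau\in\mathbb{R}^{X(0)\times X(0)}$ has $P_\tau(x,y)=\frac1{k-1}\Pr[y\in\sigma\mid\sigma\supseteq\tau\cup\{x\}]$ for distinct $x,y\in X_\tau(0)$, other entries $0$; $\lambda_2(P_\tau)$ is the second largest eigenvalue of its restriction to $X_\tau(0)\times X_\tau(0)$. Totally connected: $\lambda_2(P_\tau)<1$ for all $\tau\in X(\leq d-2)$. Product of weighted complexes with disjoint ground sets $(Y,\mu),(Y',\mu')$: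 facets are $\tau\cup\sigma$ for facets $\tau$ of $Y$, $\sigma$ of $Y'$, with weight $\mu(\tau)\mu'(\sigma)$; iterated for several factors. $\bigoplus$ denotes the block-diagonal combination over the disjoint vertex sets $Y_i(0)$. $\preceq$ Loewner order, $\rho$ spectral radius, $\mathbb{E}_{x\sim\pi_\tau}$ expectation over $x$ drawn from $\pi_\tau$.
   Formalization: In (2), "product" means at least two factors (t ≥ 2), each of dimension at least 0; the trivial product of X_τ with itself alone or with {∅} is excluded, since then the product condition reads M_τ = M_τ and the claim fails. *)

theory Defs
  imports
    "HOL-Probability.Probability"
    "Jordan_Normal_Form.Spectral_Radius"
begin

definition abstract_complex :: "'a set set \<Rightarrow> bool" where
  "abstract_complex X \<longleftrightarrow>
     (\<exists>V. finite V \<and> X \<subseteq> Pow V) \<and> (\<forall>\<sigma>\<in>X. \<forall>\<tau>. \<tau> \<subseteq> \<sigma> \<longrightarrow> \<tau> \<in> X)"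

definition face_dim :: "'a set \<Rightarrow> int" where
  "face_dim \<tau> = int (card \<tau>) - 1"

definition faces :: "'a set set \<Rightarrow> int \<Rightarrow> 'a set set" where
  "faces X i = {\<sigma> \<in> X. face_dim \<sigma> = i}"

definition faces_upto :: "'a set set \<Rightarrow> int \<Rightarrow> 'a set set" where
  "faces_upto X i = {\<sigma> \<in> X. face_dim \<sigma> \<le> i}"

text \<open>\<open>X(0)\<close>, with the singleton face \<open>{x}\<close> identified with the point \<open>x\<close>.\<close>
definition vertices :: "'a set set \<Rightarrow> 'a set" where
  "vertices X = {x. {x} \<in> X}"

definition facets :: "'a set set \<Rightarrow> 'a set set" where
  "facets X = {\<sigma> \<in> X. \<forall>\<sigma>'\<in>X. \<sigma> \<subseteq> \<sigma>' \<longrightarrow> \<sigma>' = \<sigma>}"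

definition pure_complex :: "nat \<Rightarrow> 'a set set \<Rightarrow> bool" where
  "pure_complex d X \<longleftrightarrow> (\<forall>\<sigma>\<in>facets X. face_dim \<sigma> = int d)"

definition codim :: "nat \<Rightarrow> 'a set \<Rightarrow> int" where
  "codim d \<tau> = int d - face_dim \<tau>"

definition link :: "'a set set \<Rightarrow> 'a set \<Rightarrow> 'a set set" where
  "link X \<tau> = {\<sigma> - \<tau> | \<sigma>. \<sigma> \<in> X \<and> \<tau> \<subseteq> \<sigma>}"

text \<open>The support condition says both that \<open>\<pi>\<close> lives on the facets and that it is positive
  on each of them; in particular there is at least one facet.\<close>
definition weighted_complex :: "nat \<Rightarrow> 'a set set \<Rightarrow> 'a set pmf \<Rightarrow> bool" where
  "weighted_complex d X \<pi> \<longleftrightarrow>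
     abstract_complex X \<and> pure_complex d X \<and> set_pmf \<pi> = facets X"

text \<open>\<open>\<pi>\<^bsub>\<tau>,i\<^esub>(\<eta>)\<close>, extended by zero outside \<open>X\<^sub>\<tau>(i)\<close>.\<close>
definition link_weight ::
    "nat \<Rightarrow> 'a set set \<Rightarrow> 'a set pmf \<Rightarrow> 'a set \<Rightarrow> int \<Rightarrow> 'a set \<Rightarrow> real" where
  "link_weight d X \<pi> \<tau> i \<eta> =
     (if \<eta> \<in> faces (link X \<tau>) i
      then \<P>(\<sigma> in measure_pmf \<pi>. \<tau> \<union> \<eta> \<subseteq> \<sigma> \<bar> \<tau> \<subseteq> \<sigma>)
             / real (nat (codim d \<tau>) choose nat (i + 1))
      else 0)"

definition vertex_weight ::
    "nat \<Rightarrow> 'a set set \<Rightarrow> 'a set pmf \<Rightarrow> 'a set \<Rightarrow> 'a \<Rightarrow> real" where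
  "vertex_weight d X \<pi> \<tau> x = link_weight d X \<pi> \<tau> 0 {x}"

text \<open>\<open>(Z, w)\<close> is the product of \<open>(Y\<^sub>1, \<mu>\<^sub>1), \<dots>, (Y\<^sub>t, \<mu>\<^sub>t)\<close>, where \<open>Y\<^sub>i\<close> has dimension \<open>e i\<close>.
  A product has at least two factors, and each factor has dimension at least \<open>0\<close>: every complex
  \<open>Z\<close> is trivially the product of itself, or of itself and \<open>{\<emptyset>}\<close>, and these degenerate
  decompositions are excluded. The ground set of \<open>Y\<^sub>i\<close> is taken to be \<open>\<Union>Y\<^sub>i\<close>.\<close>
definition is_product ::
    "'a set set \<Rightarrow> ('a set \<Rightarrow> real) \<Rightarrow> nat \<Rightarrow> (nat \<Rightarrow> nat) \<Rightarrow> (nat \<Rightarrow> 'a set set)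
      \<Rightarrow> (nat \<Rightarrow> 'a set pmf) \<Rightarrow> bool" where
  "is_product Z w t e Y \<mu> \<longleftrightarrow>
     2 \<le> t \<and>
     (\<forall>i\<in>{1..t}. weighted_complex (e i) (Y i) (\<mu> i)) \<and>
     disjoint_family_on (\<lambda>i. \<Union>(Y i)) {1..t} \<and>
     abstract_complex Z \<and>
     facets Z = {\<Union>i\<in>{1..t}. F i | F. \<forall>i\<in>{1..t}. F i \<in> facets (Y i)} \<and>
     (\<forall>F. (\<forall>i\<in>{1..t}. F i \<in> facets (Y i)) \<longrightarrow>
        w (\<Union>i\<in>{1..t}. F i) = (\<Prod>i\<in>{1..t}. pmf (\<mu> i) (F i)))"

text \<open>A matrix in \<open>\<real>\<^bsup>S\<times>S\<^esup>\<close> is a function \<open>'a \<Rightarrow> 'a \<Rightarrow> real\<close> of which only the entries with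
  both indices in \<open>S\<close> matter.\<close>

definition symmetric_on :: "'a set \<Rightarrow> ('a \<Rightarrow> 'a \<Rightarrow> real) \<Rightarrow> bool" where
  "symmetric_on S A \<longleftrightarrow> (\<forall>x\<in>S. \<forall>y\<in>S. A x y = A y x)"

definition mat_mult_on ::
    "'a set \<Rightarrow> ('a \<Rightarrow> 'a \<Rightarrow> real) \<Rightarrow> ('a \<Rightarrow> 'a \<Rightarrow> real) \<Rightarrow> 'a \<Rightarrow> 'a \<Rightarrow> real" where
  "mat_mult_on S A B x y = (\<Sum>z\<in>S. A x z * B z y)"

text \<open>Loewner order; only meaningful for matrices that are symmetric on \<open>S\<close>.\<close>
definition loewner_le ::
    "'a set \<Rightarrow> ('a \<Rightarrow> 'a \<Rightarrow> real) \<Rightarrow> ('a \<Rightarrow> 'a \<Rightarrow> real) \<Rightarrow> bool" where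
  "loewner_le S A B \<longleftrightarrow> (\<forall>v. 0 \<le> (\<Sum>x\<in>S. \<Sum>y\<in>S. v x * (B x y - A x y) * v y))"

text \<open>The rows and columns are numbered by an arbitrary bijection of \<open>{..<card S}\<close> with the finite set \<open>S\<close>, on which
  eigenvalues do not depend.\<close>
definition to_mat :: "'a set \<Rightarrow> ('a \<Rightarrow> 'a \<Rightarrow> real) \<Rightarrow> real Matrix.mat" where
  "to_mat S A = Matrix.mat (card S) (card S)
     (\<lambda>(i, j). A (from_nat_into S i) (from_nat_into S j))"

text \<open>Real eigenvalues are counted with algebraic multiplicity and listed in decreasing order.\<close>
definition eigenvalues_desc :: "real Matrix.mat \<Rightarrow> real list" where
  "eigenvalues_desc A = rev (sorted_list_of_multiset (proots (char_poly A)))"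

definition lambda2_on :: "'a set \<Rightarrow> ('a \<Rightarrow> 'a \<Rightarrow> real) \<Rightarrow> real" where
  "lambda2_on S A = eigenvalues_desc (to_mat S A) ! 1"

definition spectral_radius_on :: "'a set \<Rightarrow> ('a \<Rightarrow> 'a \<Rightarrow> real) \<Rightarrow> real" where
  "spectral_radius_on S A = spectral_radius (map_mat complex_of_real (to_mat S A))"

definition block_sum ::
    "'i set \<Rightarrow> ('i \<Rightarrow> 'a set) \<Rightarrow> ('i \<Rightarrow> 'a \<Rightarrow> 'a \<Rightarrow> real) \<Rightarrow> 'a \<Rightarrow> 'a \<Rightarrow> real" where
  "block_sum I V A x y = (\<Sum>i\<in>I. if x \<in> V i \<and> y \<in> V i then A i x y else 0)"

definition Pi_mat ::
    "nat \<Rightarrow> 'a set set \<Rightarrow> 'a set pmf \<Rightarrow> 'a set \<Rightarrow> 'a \<Rightarrow> 'a \<Rightarrow> real" where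
  "Pi_mat d X \<pi> \<tau> x y = (if x = y then vertex_weight d X \<pi> \<tau> x else 0)"

definition Pi_inv ::
    "nat \<Rightarrow> 'a set set \<Rightarrow> 'a set pmf \<Rightarrow> 'a set \<Rightarrow> 'a \<Rightarrow> 'a \<Rightarrow> real" where
  "Pi_inv d X \<pi> \<tau> x y =
     (if x = y \<and> x \<in> vertices (link X \<tau>) then 1 / vertex_weight d X \<pi> \<tau> x else 0)"

definition local_walk ::
    "nat \<Rightarrow> 'a set set \<Rightarrow> 'a set pmf \<Rightarrow> 'a set \<Rightarrow> 'a \<Rightarrow> 'a \<Rightarrow> real" where
  "local_walk d X \<pi> \<tau> x y =
     (if x \<in> vertices (link X \<tau>) \<and> y \<in> vertices (link X \<tau>) \<and> x \<noteq> y
      then \<P>(\<sigma> in measure_pmf \<pi>. y \<in> \<sigma> \<bar> \<tau> \<union> {x} \<subseteq> \<sigma>) / real_of_int (codim d \<tau> - 1)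
      else 0)"

text \<open>\<open>\<lambda>\<^sub>2(P\<^sub>\<tau>)\<close> refers to the restriction of \<open>P\<^sub>\<tau>\<close> to \<open>X\<^sub>\<tau>(0) \<times> X\<^sub>\<tau>(0)\<close>.\<close>
definition lambda2_walk :: "nat \<Rightarrow> 'a set set \<Rightarrow> 'a set pmf \<Rightarrow> 'a set \<Rightarrow> real" where
  "lambda2_walk d X \<pi> \<tau> = lambda2_on (vertices (link X \<tau>)) (local_walk d X \<pi> \<tau>)"

definition totally_connected :: "nat \<Rightarrow> 'a set set \<Rightarrow> 'a set pmf \<Rightarrow> bool" where
  "totally_connected d X \<pi> \<longleftrightarrow>
     (\<forall>\<tau>\<in>faces_upto X (int d - 2). lambda2_walk d X \<pi> \<tau> < 1)"

text \<open>\<open>\<bbbE>\<^bsub>x\<sim>\<pi>\<^sub>\<tau>\<^esub> F x\<close>, taken entrywise.\<close>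
definition link_expectation ::
    "nat \<Rightarrow> 'a set set \<Rightarrow> 'a set pmf \<Rightarrow> 'a set \<Rightarrow> ('a \<Rightarrow> 'a \<Rightarrow> 'a \<Rightarrow> real)
      \<Rightarrow> 'a \<Rightarrow> 'a \<Rightarrow> real" where
  "link_expectation d X \<pi> \<tau> F y z =
     (\<Sum>x\<in>vertices (link X \<tau>). vertex_weight d X \<pi> \<tau> x * F x y z)"

end

theory Submission
  imports Defs
begin

text \<open>
By induction on the codimension \<open>k\<close> of \<open>\<tau>\<close> one shows
\<open>\<Pi>\<^sub>\<tau> P\<^sub>\<tau> - k/(k-1) \<pi>\<^sub>\<tau> \<pi>\<^sub>\<tau>\<^sup>T \<preceq> M\<^sub>\<tau> \<preceq> (k-1)/(3k-1) \<Pi>\<^sub>\<tau>\<close>.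
Write \<open>A = P\<^sub>\<tau> - k/(k-1) 1 \<pi>\<^sub>\<tau>\<^sup>T\<close>, \<open>B = \<Pi>\<^sub>\<tau>\<^sup>-\<^sup>1 M\<^sub>\<tau>\<close> (both self-adjoint with respect to
\<open>\<pi>\<^sub>\<tau>\<close>) and \<open>c = (k-1)/(k-2)\<close>. Averaging the lower bounds over the links of the vertices turns the
recursive condition into \<open>A - c A\<^sup>2 \<preceq> B - c B\<^sup>2\<close>, that is
\<open>(1/(2c) - B)\<^sup>2 \<preceq> (1/(2c) - A)\<^sup>2\<close>. The upper bounds in the links and the classical trickle-down
argument give \<open>A \<preceq> 1/(2c)\<close>, the upper bound on \<open>M\<^sub>\<tau>\<close> gives \<open>B \<preceq> 1/(2c)\<close>, and monotonicity of the
square root yields \<open>A \<preceq> B\<close>. If the link is a product, then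
\<open>\<Pi>\<^sub>\<tau> P\<^sub>\<tau> - k/(k-1) \<pi>\<^sub>\<tau> \<pi>\<^sub>\<tau>\<^sup>T\<close> is block diagonal, because vertices of different factors are independent,
and each block is a multiple of the corresponding matrix of a factor. Spectral facts are only needed for
extremal eigenvectors, which are obtained as maximisers of Rayleigh quotients.
\<close>

subsection \<open>Eigenvalues of matrices indexed by a finite set\<close>


text \<open>Operators are kept as symmetric forms: \<open>joint\<close> is \<open>\<Pi> P\<close>,
  and the square of an operator with form Q appears as the sum of \<open>(Q v)^2 / w\<close>. The
  constants are tied together. The rank-one terms of the vertex links average to the form of P^2, so
  the deflation constant (k-1)/(k-2) at codimension k-1 becomes c. The value k/(k-1) = 2 - 1/c is
  the nonzero solution of c (2 x - x^2) = x, which makes A - c A^2 equal to P - c P^2. The upper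
  constant at codimension k-1, mu = (k-2)/(3k-4), solves mu/(1-mu) = 1/(2c), so trickling down ends
  exactly where t - c t^2 stops increasing. The base case contains the values 2 and 1/5 at k = 2. A
  and B need not commute, so A \<le> B cannot be read off eigenvalue by eigenvalue from the
  inequality between A - c A^2 and B - c B^2; hence the square root. Total connectedness excludes
  the branch m \<ge> 1 of the quadratic inequality in trickle-down. Averaging over links wants all
  matrices on the common index set \<open>V\<close>, whereas division by the weights and
  eigenfunctions want the vertices of one link; the proof moves between the two by extending
  functions by zero.\<close>

unbundle no vec_syntax


text \<open>Replacing the rows \<open>i\<close>, \<open>j\<close> of the identity by \<open>v\<close>, \<open>w\<close> gives an invertible matrix \<open>U\<close> for which
  the rows \<open>i\<close>, \<open>j\<close> of \<open>U (x I - A)\<^sup>T\<close> are \<open>(x - a) v\<close> and \<open>(x - b) w\<close>. Allowing \<open>a = b\<close> takes care of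
  multiplicities.\<close>
lemma char_poly_two_eigenvectors:
  fixes A :: "'a::field mat"
  assumes A: "A \<in> carrier_mat n n"
    and v: "v \<in> carrier_vec n" "A *\<^sub>v v = a \<cdot>\<^sub>v v"
    and w: "w \<in> carrier_vec n" "A *\<^sub>v w = b \<cdot>\<^sub>v w"
    and ij: "i < n" "j < n" "v $ i * w $ j \<noteq> v $ j * w $ i"
  shows "[:- a, 1:] * [:- b, 1:] dvd char_poly A"
proof -
  have [simp]: "i \<noteq> j" "dim_row A = n" "dim_col A = n" "dim_vec v = n" "dim_vec w = n"
    using A v w ij by auto
  define U where "U = Matrix.mat n n
    (\<lambda>(k, l). if k = i then v $ l else if k = j then w $ l else if k = l then 1 else 0)"
  have U: "U \<in> carrier_mat n n" by (simp add: U_def)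
  \<comment> \<open>A kernel vector of \<open>U\<close> vanishes outside i and j because the other
    rows are unit rows; what remains is a 2x2 system whose determinant is nonzero by
    hypothesis.\<close>
  have "Determinant.det U \<noteq> 0"
  proof
    assume "Determinant.det U = 0"
    then obtain u where u: "u \<in> carrier_vec n" "u \<noteq> 0\<^sub>v n" "U *\<^sub>v u = 0\<^sub>v n"
      using det_0_iff_vec_prod_zero_field[OF U] by auto
    have U_row: "(\<Sum>l\<in>{0..<n}. U $$ (k, l) * u $ l) = 0" if "k < n" for k
    proof -
      have "(U *\<^sub>v u) $ k = 0" using u that by simp
      then show ?thesis
        using u(1) U that by (simp add: scalar_prod_def)
    qed
    have u0: "u $ k = 0" if "k < n" "k \<noteq> i" "k \<noteq> j" for k
    proof -
      have "(\<Sum>l\<in>{0..<n}. U $$ (k, l) * u $ l) = (\<Sum>l\<in>{0..<n}. if k = l then u $ l else 0)"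
        using that by (intro sum.cong) (auto simp: U_def)
      then show ?thesis using U_row[OF that(1)] that by simp
    qed
    have two: "(\<Sum>l\<in>{0..<n}. z $ l * u $ l) = z $ i * u $ i + z $ j * u $ j" for z
    proof -
      have "(\<Sum>l\<in>{0..<n}. z $ l * u $ l) = (\<Sum>l\<in>{i, j}. z $ l * u $ l)"
        using ij u0 by (intro sum.mono_neutral_right) auto
      then show ?thesis by simp
    qed
    have "(\<Sum>l\<in>{0..<n}. v $ l * u $ l) = (\<Sum>l\<in>{0..<n}. U $$ (i, l) * u $ l)"
      using ij by (intro sum.cong) (auto simp: U_def)
    then have 1: "v $ i * u $ i + v $ j * u $ j = 0" using two U_row[OF ij(1)] by simp
    have "(\<Sum>l\<in>{0..<n}. w $ l * u $ l) = (\<Sum>l\<in>{0..<n}. U $$ (j, l) * u $ l)"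
      using ij by (intro sum.cong) (auto simp: U_def)
    then have 2: "w $ i * u $ i + w $ j * u $ j = 0" using two U_row[OF ij(2)] by simp
    have "(v $ i * w $ j - v $ j * w $ i) * u $ i
        = w $ j * (v $ i * u $ i + v $ j * u $ j) - v $ j * (w $ i * u $ i + w $ j * u $ j)"
      "(v $ i * w $ j - v $ j * w $ i) * u $ j
        = v $ i * (w $ i * u $ i + w $ j * u $ j) - w $ i * (v $ i * u $ i + v $ j * u $ j)"
      by (simp_all add: algebra_simps)
    then have "u $ i = 0" "u $ j = 0" using 1 2 ij(3) by auto
    then have "u $ k = 0" if "k < n" for k using u0 that by metis
    then have "u = 0\<^sub>v n" using u(1) by (intro eq_vecI) auto
    then show False using u(2) by simp
  qed
  let ?C = "char_poly_matrix A"
  define V where "V = map_mat (\<lambda>x. [:x:]) U"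
  define T where "T = V * transpose_mat ?C"
  \<comment> \<open>\<open>W\<close> is \<open>T\<close> with the linear factors divided out of rows
    i and j, so the determinant of \<open>T\<close> is their product times that of
    \<open>W\<close>.\<close>
  define W where "W = Matrix.mat n n (\<lambda>(k, l). if k = i then [:v $ l:] else
      if k = j then [:w $ l:] else T $$ (k, l))"
  have C: "?C \<in> carrier_mat n n" using A by simp
  have V: "V \<in> carrier_mat n n" using U by (simp add: V_def)
  have T: "T \<in> carrier_mat n n" using C V by (simp add: T_def)
  have W: "W \<in> carrier_mat n n" by (simp add: W_def)
  have C_entry: "?C $$ (l, m) = (if l = m then [:0, 1:] else 0) + [:- A $$ (l, m):]"
    if "l < n" "m < n" for l m
    using that by (simp add: char_poly_matrix_def)
  have eig: "(\<Sum>m\<in>{0..<n}. [:z $ m:] * ?C $$ (l, m)) = [:- e, 1:] * [:z $ l:]"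
    if "l < n" "z \<in> carrier_vec n" "A *\<^sub>v z = e \<cdot>\<^sub>v z" for z e l
  proof -
    have "(A *\<^sub>v z) $ l = e * z $ l" using that by simp
    then have Az: "(\<Sum>m\<in>{0..<n}. A $$ (l, m) * z $ m) = e * z $ l"
      using that(1,2) by (simp add: scalar_prod_def)
    have "(\<Sum>m\<in>{0..<n}. [:z $ m:] * ?C $$ (l, m))
        = (\<Sum>m\<in>{0..<n}. (if l = m then [:0, z $ m:] else 0) + [:- (A $$ (l, m) * z $ m):])"
      using that by (intro sum.cong) (auto simp: C_entry)
    also have "\<dots> = [:0, z $ l:] + [:- (\<Sum>m\<in>{0..<n}. A $$ (l, m) * z $ m):]"
    proof -
      have "(\<Sum>m\<in>I. [:- (A $$ (l, m) * z $ m):]) = [:- (\<Sum>m\<in>I. A $$ (l, m) * z $ m):]"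
        if "finite I" for I
        using that by (induction I) auto
      then show ?thesis using \<open>l < n\<close> by (simp add: sum.distrib)
    qed
    finally show ?thesis by (simp add: Az)
  qed
  have T_entry: "T $$ (k, l) = (\<Sum>m\<in>{0..<n}. [:U $$ (k, m):] * ?C $$ (l, m))"
    if "k < n" "l < n" for k l
    using that U C V by (auto simp: T_def V_def scalar_prod_def intro!: sum.cong)
  have U_rows: "U $$ (i, m) = v $ m" "U $$ (j, m) = w $ m" if "m < n" for m
    using that ij by (auto simp: U_def)
  have "T $$ (i, l) = [:- a, 1:] * [:v $ l:]" if "l < n" for l
    unfolding T_entry[OF ij(1) that] eig[OF that v, symmetric]
    by (intro sum.cong) (auto simp: U_rows)
  moreover have "T $$ (j, l) = [:- b, 1:] * [:w $ l:]" if "l < n" for l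
    unfolding T_entry[OF ij(2) that] eig[OF that w, symmetric]
    by (intro sum.cong) (auto simp: U_rows)
  ultimately have "T = multrow i [:- a, 1:] (multrow j [:- b, 1:] W)"
    using T W by (intro eq_matI) (auto simp: W_def)
  then have "Determinant.det T = [:- a, 1:] * ([:- b, 1:] * Determinant.det W)"
    using W ij by (simp add: det_multrow[of _ n])
  moreover have "Determinant.det T = Determinant.det V * char_poly A"
    using C V unfolding T_def char_poly_def
    by (subst det_mult[of _ n]) (auto simp: det_transpose[of _ n])
  moreover have "Determinant.det V = [:Determinant.det U:]"
  proof -
    interpret h: comm_ring_hom "\<lambda>x::'a. [:x:]"
      by unfold_locales auto
    show ?thesis unfolding V_def by (simp add: h.hom_det)
  qed
  \<comment> \<open>The determinant of \<open>V\<close> is a nonzero constant polynomial, hence a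
    unit that can be cancelled from the divisibility.\<close>
  ultimately have "Polynomial.smult (Determinant.det U) (char_poly A)
      = [:- a, 1:] * [:- b, 1:] * Determinant.det W"
    by (simp only: mult.assoc) simp
  then have "[:- a, 1:] * [:- b, 1:] dvd Polynomial.smult (Determinant.det U) (char_poly A)"
    by (metis dvd_triv_left)
  then show ?thesis
    using \<open>Determinant.det U \<noteq> 0\<close> by (rule dvd_smult_cancel)
qed

section \<open>Functions on a finite set as vectors\<close>

lemma sum_from_nat_into:
  assumes "finite S"
  shows "(\<Sum>i\<in>{0..<card S}. g (from_nat_into S i)) = (\<Sum>x\<in>S. g x)"
  using sum.reindex_bij_betw[OF bij_betw_from_nat_into_finite[OF assms], of g]
  by (simp add: atLeast0LessThan)

lemma from_nat_into_surj_on: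
  assumes "finite S" "x \<in> S"
  obtains i where "i < card S" "from_nat_into S i = x"
  using bij_betw_from_nat_into_finite[OF assms(1)] assms(2)
  unfolding bij_betw_def by (metis imageE lessThan_iff)

definition eigenfunction_on :: "'a set \<Rightarrow> ('a \<Rightarrow> 'a \<Rightarrow> real) \<Rightarrow> real \<Rightarrow> ('a \<Rightarrow> real) \<Rightarrow> bool" where
  "eigenfunction_on S A a f \<longleftrightarrow> (\<forall>x\<in>S. (\<Sum>y\<in>S. A x y * f y) = a * f x)"

definition to_vec :: "'a set \<Rightarrow> ('a \<Rightarrow> real) \<Rightarrow> real Matrix.vec" where
  "to_vec S f = Matrix.vec (card S) (\<lambda>i. f (from_nat_into S i))"

lemma to_mat_carrier: "to_mat S A \<in> carrier_mat (card S) (card S)"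
  by (simp add: to_mat_def)

lemma to_vec_carrier: "to_vec S f \<in> carrier_vec (card S)"
  by (simp add: to_vec_def)

lemma to_mat_mult_to_vec:
  assumes "finite S" "i < card S"
  shows "(to_mat S A *\<^sub>v to_vec S f) $ i = (\<Sum>y\<in>S. A (from_nat_into S i) y * f y)"
  using assms sum_from_nat_into[OF assms(1), of "\<lambda>y. A (from_nat_into S i) y * f y"]
  by (simp add: to_mat_def to_vec_def scalar_prod_def)

lemma from_nat_into_mem: "i < card S \<Longrightarrow> from_nat_into S i \<in> S"
  by (metis card.empty from_nat_into not_less_zero)

lemma to_mat_eigenfunction:
  assumes "finite S" "eigenfunction_on S A a f"
  shows "to_mat S A *\<^sub>v to_vec S f = a \<cdot>\<^sub>v to_vec S f"
proof (rule eq_vecI)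
  fix i assume "i < dim_vec (a \<cdot>\<^sub>v to_vec S f)"
  then have i: "i < card S" by (simp add: to_vec_def)
  then show "(to_mat S A *\<^sub>v to_vec S f) $ i = (a \<cdot>\<^sub>v to_vec S f) $ i"
    using assms(2) from_nat_into_mem[OF i] to_mat_mult_to_vec[OF assms(1) i, of A f]
    by (simp add: eigenfunction_on_def to_vec_def)
qed (simp add: to_mat_def to_vec_def)

lemma to_mat_eigenvector:
  assumes "finite S" "eigenfunction_on S A a f" "x \<in> S" "f x \<noteq> 0"
  shows "eigenvector (to_mat S A) (to_vec S f) a"
proof -
  obtain i where i: "i < card S" "from_nat_into S i = x"
    using from_nat_into_surj_on assms by metis
  then have "to_vec S f $ i \<noteq> 0\<^sub>v (card S) $ i" using assms by (simp add: to_vec_def)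
  then show ?thesis
    using to_mat_eigenfunction[OF assms(1,2)] to_vec_carrier[of S f] i
    by (auto simp: eigenvector_def to_mat_def)
qed

text \<open>A real eigenvalue stays an eigenvalue of the complexified matrix and is at most its own
  modulus. The point \<open>x\<close> also shows that the matrix is not empty.\<close>

lemma spectral_radius_on_ge:
  assumes "finite S" "eigenfunction_on S A a f" "x \<in> S" "f x \<noteq> 0"
  shows "a \<le> spectral_radius_on S A"
proof -
  let ?A = "map_mat complex_of_real (to_mat S A)"
  have "eigenvalue (to_mat S A) a"
    using to_mat_eigenvector[OF assms] by (auto simp: eigenvalue_def)
  then have "eigenvalue ?A (complex_of_real a)"
    by (rule of_real_hom.eigenvalue_hom[OF to_mat_carrier])
  then have "norm (complex_of_real a) \<in> norm ` spectrum ?A"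
    by (intro imageI) (simp add: spectrum_def)
  moreover have "card S > 0" using assms by (auto simp: card_gt_0_iff)
  ultimately have "norm (complex_of_real a) \<le> spectral_radius ?A"
    by (intro spectral_radius_mem_max(2)[of _ "card S"]) (auto simp: to_mat_def)
  then show ?thesis by (simp add: spectral_radius_on_def)
qed

text \<open>In a decreasing list only the head can exceed the entry at index 1. Counting with
  multiplicity, a and b cannot both do so; the multiset inclusion covers a = b.\<close>

lemma min_le_nth_1:
  fixes a b :: "'a::linorder"
  assumes "{#a, b#} \<subseteq># mset xs" "sorted_wrt (\<ge>) xs"
  shows "length xs \<ge> 2 \<and> min a b \<le> xs ! 1"
proof -
  have "length xs \<ge> 2" using size_mset_mono[OF assms(1)] by simp
  then obtain p q r where xs: "xs = p # q # r"
    by (metis Suc_le_length_iff numeral_2_eq_2)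
  have "min a b \<le> q"
  proof (rule ccontr)
    assume "\<not> ?thesis"
    then have *: "q < a" "q < b" by (auto simp: min_def split: if_splits)
    have "{#a, b#} = filter_mset (\<lambda>z. q < z) {#a, b#}" using * by simp
    also have "\<dots> \<subseteq># filter_mset (\<lambda>z. q < z) (mset xs)"
      using assms(1) by (rule multiset_filter_mono)
    also have "\<dots> = filter_mset (\<lambda>z. q < z) {#p#}"
      using assms(2) by (auto simp: xs filter_mset_eq_mempty_iff not_less)
    also have "\<dots> \<subseteq># {#p#}" by simp
    finally show False using size_mset_mono by fastforce
  qed
  then show ?thesis using xs by simp
qed

context
  fixes S :: "'a set" and A a b f g x y
  assumes fin: "finite S" and f: "eigenfunction_on S A a f" and g: "eigenfunction_on S A b g"
    and xy: "x \<in> S" "y \<in> S" "f x * g y \<noteq> f y * g x"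
begin

text \<open>The inequality in \<open>xy\<close> is linear independence of f and g, seen in a 2x2
  minor. The length bound ensures that the index 1 in \<open>lambda2_on\<close> really hits an
  entry.\<close>

lemma eigenvalues_desc_two_eigenfunctions:
  "length (eigenvalues_desc (to_mat S A)) \<ge> 2 \<and> min a b \<le> lambda2_on S A"
proof -
  obtain i where i: "i < card S" "from_nat_into S i = x"
    using from_nat_into_surj_on fin xy by metis
  obtain j where j: "j < card S" "from_nat_into S j = y"
    using from_nat_into_surj_on fin xy by metis
  let ?p = "char_poly (to_mat S A)"
  have p0: "?p \<noteq> 0"
    using degree_monic_char_poly[OF to_mat_carrier, of S A] by auto
  have "[:- a, 1:] * [:- b, 1:] dvd ?p"
    using i j xy by (intro char_poly_two_eigenvectors[OF to_mat_carrier to_vec_carrier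
        to_mat_eigenfunction[OF fin f] to_vec_carrier to_mat_eigenfunction[OF fin g], of i j])
      (auto simp: to_vec_def)
  then obtain q where q: "?p = [:- a, 1:] * [:- b, 1:] * q" by (auto simp: dvd_def)
  then have "q \<noteq> 0" using p0 by auto
  then have "proots ?p = {#a#} + {#b#} + proots q"
    unfolding q by (subst proots_mult, force, force, subst proots_mult, force, force)
      (simp add: proots_linear_factor)
  then have "{#a, b#} \<subseteq># proots ?p" by simp
  then show ?thesis
    unfolding lambda2_on_def
    by (intro min_le_nth_1) (auto simp: eigenvalues_desc_def sorted_wrt_rev)
qed

text \<open>The eigenfunctions f and g only guarantee two entries in the list of eigenvalues; that
  makes \<open>lambda2_on\<close> a root of the characteristic polynomial. The h obtained is in
  general unrelated to f and g.\<close>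

lemma lambda2_on_eigenfunction:
  obtains h z where "eigenfunction_on S A (lambda2_on S A) h" "z \<in> S" "h z \<noteq> 0"
proof -
  let ?p = "char_poly (to_mat S A)" and ?l = "lambda2_on S A"
  have "?p \<noteq> 0"
    using degree_monic_char_poly[OF to_mat_carrier, of S A] by auto
  moreover have "?l \<in> set (eigenvalues_desc (to_mat S A))"
    using eigenvalues_desc_two_eigenfunctions unfolding lambda2_on_def by auto
  ultimately have "poly ?p ?l = 0" by (simp add: eigenvalues_desc_def)
  then have "eigenvalue (to_mat S A) ?l"
    using eigenvalue_root_char_poly[OF to_mat_carrier] by blast
  then obtain v where v: "v \<in> carrier_vec (card S)" "v \<noteq> 0\<^sub>v (card S)"
      "to_mat S A *\<^sub>v v = ?l \<cdot>\<^sub>v v"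
    by (auto simp: eigenvalue_def eigenvector_def to_mat_def)
  let ?idx = "the_inv_into {..<card S} (from_nat_into S)"
  define h where "h x = v $ ?idx x" for x
  have idx: "?idx (from_nat_into S i) = i" if "i < card S" for i
    using bij_betw_from_nat_into_finite[OF fin] that
    by (intro the_inv_into_f_f) (auto simp: bij_betw_def)
  have vh: "v = to_vec S h"
    using v(1) by (intro eq_vecI) (auto simp: to_vec_def h_def idx)
  have "eigenfunction_on S A ?l h"
    unfolding eigenfunction_on_def
  proof
    fix x assume "x \<in> S"
    then obtain i where i: "i < card S" "from_nat_into S i = x"
      using from_nat_into_surj_on fin by metis
    have "(to_mat S A *\<^sub>v v) $ i = (?l \<cdot>\<^sub>v v) $ i" using v(3) by simp
    then show "(\<Sum>y\<in>S. A x y * h y) = ?l * h x"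
      using i by (simp add: vh to_mat_mult_to_vec[OF fin]) (simp add: to_vec_def)
  qed
  moreover obtain i where "i < card S" "v $ i \<noteq> 0"
    using v(1,2) by (metis carrier_vecD eq_vecI index_zero_vec(1,2))
  ultimately show ?thesis
    using from_nat_into_mem that by (metis h_def idx)
qed

end

subsection \<open>Quadratic forms\<close>


definition qform :: "'a set \<Rightarrow> ('a \<Rightarrow> 'a \<Rightarrow> real) \<Rightarrow> ('a \<Rightarrow> real) \<Rightarrow> real" where
  "qform S A v = (\<Sum>x\<in>S. \<Sum>y\<in>S. v x * A x y * v y)"

lemma loewner_le_iff: "loewner_le S A B \<longleftrightarrow> (\<forall>v. qform S A v \<le> qform S B v)"
proof -
  have "(\<Sum>x\<in>S. \<Sum>y\<in>S. v x * (B x y - A x y) * v y) = qform S B v - qform S A v" for v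
    by (simp add: qform_def algebra_simps sum_subtractf)
  then show ?thesis by (simp add: loewner_le_def)
qed

lemma qform_cong:
  assumes "\<And>x y. x \<in> S \<Longrightarrow> y \<in> S \<Longrightarrow> A x y = B x y" "\<And>x. x \<in> S \<Longrightarrow> v x = u x"
  shows "qform S A v = qform S B u"
  unfolding qform_def using assms by (intro sum.cong refl) auto

lemma qform_sum: "qform S (\<lambda>x y. \<Sum>i\<in>I. A i x y) v = (\<Sum>i\<in>I. qform S (A i) v)"
  unfolding qform_def sum_distrib_left sum_distrib_right
  by (subst sum.swap, rule sum.cong[OF refl], subst sum.swap) simp

lemma qform_scale: "qform S (\<lambda>x y. c * A x y) v = c * qform S A v"
  unfolding qform_def sum_distrib_left by (simp add: algebra_simps)

lemma qform_diff: "qform S (\<lambda>x y. A x y - B x y) v = qform S A v - qform S B v"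
  by (simp add: qform_def algebra_simps sum_subtractf)

lemma qform_diag:
  assumes "finite S"
  shows "qform S (\<lambda>x y. if x = y then w x else 0) v = (\<Sum>x\<in>S. w x * (v x)\<^sup>2)"
proof -
  have "(\<Sum>y\<in>S. v x * (if x = y then w x else 0) * v y) = w x * (v x)\<^sup>2" if "x \<in> S" for x
  proof -
    have "(\<Sum>y\<in>S. v x * (if x = y then w x else 0) * v y)
        = (\<Sum>y\<in>S. if x = y then w x * (v x)\<^sup>2 else 0)"
      by (intro sum.cong) (auto simp: power2_eq_square)
    then show ?thesis using that assms by simp
  qed
  then show ?thesis by (simp add: qform_def)
qed

lemma qform_rank_one: "qform S (\<lambda>x y. a x * a y) v = (\<Sum>x\<in>S. a x * v x)\<^sup>2"
  by (simp add: qform_def power2_eq_square sum_product algebra_simps)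

lemma qform_apply: "qform S A v = (\<Sum>x\<in>S. v x * (\<Sum>y\<in>S. A x y * v y))"
  by (simp add: qform_def sum_distrib_left mult.assoc)

lemma bilinear_sym:
  assumes "symmetric_on S A"
  shows "(\<Sum>x\<in>S. u x * (\<Sum>y\<in>S. A x y * v y)) = (\<Sum>x\<in>S. v x * (\<Sum>y\<in>S. A x y * u y))"
proof -
  have "(\<Sum>x\<in>S. u x * (\<Sum>y\<in>S. A x y * v y)) = (\<Sum>x\<in>S. \<Sum>y\<in>S. u x * A x y * v y)"
    by (simp add: sum_distrib_left mult.assoc)
  also have "\<dots> = (\<Sum>y\<in>S. \<Sum>x\<in>S. u x * A x y * v y)" by (rule sum.swap)
  also have "\<dots> = (\<Sum>x\<in>S. v x * (\<Sum>y\<in>S. A x y * u y))"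
    using assms unfolding sum_distrib_left
    by (intro sum.cong refl) (auto simp: symmetric_on_def mult_ac)
  finally show ?thesis .
qed

lemma qform_add:
  assumes "symmetric_on S A"
  shows "qform S A (\<lambda>x. u x + t * v x)
    = qform S A u + 2 * t * (\<Sum>x\<in>S. v x * (\<Sum>y\<in>S. A x y * u y)) + t\<^sup>2 * qform S A v"
proof -
  have "qform S A (\<lambda>x. u x + t * v x) = qform S A u + t * (\<Sum>x\<in>S. u x * (\<Sum>y\<in>S. A x y * v y))
      + t * (\<Sum>x\<in>S. v x * (\<Sum>y\<in>S. A x y * u y)) + t\<^sup>2 * qform S A v"
    unfolding qform_apply
    by (simp add: algebra_simps sum.distrib sum_distrib_left power2_eq_square)
  then show ?thesis using bilinear_sym[OF assms, of u v] by simp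
qed

text \<open>Near 0 a nonzero linear term cannot be dominated by a quadratic one. This is the
  first-order condition at a maximum, without derivatives.\<close>

lemma linear_coefficient_zero:
  fixes a b :: real
  assumes "\<And>t. a * t \<le> b * t\<^sup>2"
  shows "a = 0"
proof (rule ccontr)
  assume "a \<noteq> 0"
  define s where "s = \<bar>b\<bar> + 1"
  \<comment> \<open>With this t one has s t^2 = a t / 2, so the hypothesis becomes a t \<le> a t /
    2, although a t > 0.\<close>
  define t where "t = a / (2 * s)"
  have "s > 0" "b \<le> s" by (auto simp: s_def)
  have "a * t \<le> b * t\<^sup>2" by (rule assms)
  also have "\<dots> \<le> s * t\<^sup>2" using \<open>b \<le> s\<close> by (intro mult_right_mono) auto
  also have "\<dots> = a * t / 2"
    using \<open>s > 0\<close> by (simp add: t_def power2_eq_square field_simps)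
  finally have "a * t \<le> 0" by simp
  moreover have "a * t > 0"
    using \<open>a \<noteq> 0\<close> \<open>s > 0\<close> by (simp add: t_def power2_eq_square[symmetric])
  ultimately show False by simp
qed

section \<open>Maximisers of Rayleigh quotients\<close>

text \<open>The maximum of the form on the unit sphere of the hyperplane given by c exists by
  compactness; h shows that this sphere is not empty. The last conclusion is the eigenvalue equation
  tested only against directions inside the hyperplane. Taking c = 0 yields a top eigenfunction,
  taking c = w a second one.\<close>

lemma extremal_eigenfunction:
  assumes fin: "finite S" and w: "\<And>x. x \<in> S \<Longrightarrow> w x > 0" and A: "symmetric_on S A"
    and ne: "z \<in> S" "h z \<noteq> 0" "(\<Sum>x\<in>S. c x * h x) = 0"
  obtains f m where "(\<Sum>x\<in>S. c x * f x) = 0" "(\<Sum>x\<in>S. w x * (f x)\<^sup>2) = 1"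
    "\<And>g. (\<Sum>x\<in>S. c x * g x) = 0 \<Longrightarrow> qform S A g \<le> m * (\<Sum>x\<in>S. w x * (g x)\<^sup>2)"
    "\<And>g. (\<Sum>x\<in>S. c x * g x) = 0 \<Longrightarrow>
      (\<Sum>x\<in>S. g x * (\<Sum>y\<in>S. A x y * f y)) = m * (\<Sum>x\<in>S. g x * (w x * f x))"
proof -
  let ?n = "\<lambda>f. \<Sum>x\<in>S. w x * (f x)\<^sup>2" and ?c = "\<lambda>f. \<Sum>x\<in>S. c x * f x"
  \<comment> \<open>Functions are defined on the whole type, so compactness comes from a product of
    compact sets: values outside \<open>S\<close> are pinned to 0, and inside, w x (f x)^2 \<le> 1
    on the sphere gives the interval.\<close>
  define C where "C = PiE UNIV (\<lambda>x. if x \<in> S then {- 1 / sqrt (w x)..1 / sqrt (w x)} else {0})"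
  define K where "K = C \<inter> ({f. ?n f = 1} \<inter> {f. ?c f = 0})"
  have cont: "continuous_on UNIV (\<lambda>f. f x :: real)" for x :: 'a by simp
  have "compactin (product_topology (\<lambda>x::'a. euclidean :: real topology) UNIV) C"
    unfolding C_def compactin_PiE by auto
  then have "compact C" by (simp add: euclidean_product_topology)
  moreover have "closed {f. ?n f = 1}" "closed {f. ?c f = 0}"
    by (intro closed_Collect_eq continuous_intros cont)+
  ultimately have "compact K" unfolding K_def by (intro compact_Int_closed closed_Int)
  have in_K: "\<exists>g'\<in>K. \<forall>x\<in>S. g' x = g x" if "?n g = 1" "?c g = 0" for g
  proof
    have "\<bar>g x\<bar> \<le> 1 / sqrt (w x)" if "x \<in> S" for x
    proof -
      have "w x * (g x)\<^sup>2 \<le> ?n g"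
        using that fin w by (intro member_le_sum) (auto simp: less_imp_le)
      then have "(g x)\<^sup>2 \<le> 1 / w x" using \<open>?n g = 1\<close> w[OF that] by (simp add: field_simps)
      then show ?thesis by (metis real_le_rsqrt real_sqrt_divide real_sqrt_one power2_abs)
    qed
    then show "(\<lambda>x. if x \<in> S then g x else 0) \<in> K"
      using that unfolding K_def C_def by (auto simp: PiE_iff abs_le_iff minus_le_iff)
  qed auto
  have pos: "?n g > 0" if "x \<in> S" "g x \<noteq> 0" for g x
    using that fin w by (intro sum_pos2[of S x]) (auto simp: less_imp_le)
  have scale: "?n (\<lambda>x. g x / sqrt (?n g)) = 1" if "?n g > 0" for g
  proof -
    have "?n (\<lambda>x. g x / sqrt (?n g)) = ?n g / ?n g"
      using that by (simp add: power_divide sum_divide_distrib[symmetric])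
    then show ?thesis using that by simp
  qed
  have "K \<noteq> {}"
  proof -
    have "?c (\<lambda>x. h x / sqrt (?n h)) = ?c h / sqrt (?n h)" by (simp add: sum_divide_distrib)
    then show ?thesis using in_K[OF scale[OF pos[where g = h, OF ne(1,2)]]] ne(3) by auto
  qed
  moreover have "continuous_on K (qform S A)"
    unfolding qform_def
    by (intro continuous_intros continuous_on_subset[OF cont subset_UNIV])
  ultimately obtain f where f: "f \<in> K" and max: "\<And>g. g \<in> K \<Longrightarrow> qform S A g \<le> qform S A f"
    using continuous_attains_sup[OF \<open>compact K\<close>] by metis
  define m where "m = qform S A f"
  have f1: "?n f = 1" "?c f = 0" using f by (auto simp: K_def)
  have le: "qform S A g \<le> m * ?n g" if "?c g = 0" for g
  proof (cases "\<exists>x\<in>S. g x \<noteq> 0")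
    case True
    then have n: "?n g > 0" using pos by blast
    have "?c (\<lambda>x. g x / sqrt (?n g)) = 0"
      using that by (simp flip: sum_divide_distrib)
    then obtain g' where g': "g' \<in> K" "\<And>x. x \<in> S \<Longrightarrow> g' x = g x / sqrt (?n g)"
      using in_K[OF scale[OF n]] by blast
    have "qform S A g' = qform S A (\<lambda>x. g x / sqrt (?n g))"
      using g'(2) by (intro qform_cong) auto
    also have "\<dots> = qform S A g / ?n g"
      using n by (simp add: qform_def sum_divide_distrib)
    finally have "qform S A g = qform S A g' * ?n g" using n by simp
    then show ?thesis using max[OF g'(1)] n by (simp add: m_def mult_right_mono)
  next
    case False
    then have "qform S A g = 0" "?n g = 0" by (auto simp: qform_def intro!: sum.neutral)
    then show ?thesis by simp
  qed
  have crit: "(\<Sum>x\<in>S. g x * (\<Sum>y\<in>S. A x y * f y)) = m * (\<Sum>x\<in>S. g x * (w x * f x))"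
    if g: "?c g = 0" for g
  proof -
    let ?a = "(\<Sum>x\<in>S. g x * (\<Sum>y\<in>S. A x y * f y))" and ?b = "(\<Sum>x\<in>S. g x * (w x * f x))"
    \<comment> \<open>The inequality \<open>le\<close> at f + t g is an equality for t = 0, so the
      constant terms cancel and a linear term bounded by a quadratic one is left.\<close>
    have "(2 * (?a - m * ?b)) * t \<le> (m * ?n g - qform S A g) * t\<^sup>2" for t
    proof -
      have "?c (\<lambda>x. f x + t * g x) = ?c f + t * ?c g"
        by (simp add: algebra_simps sum.distrib sum_distrib_left)
      then have "qform S A (\<lambda>x. f x + t * g x) \<le> m * ?n (\<lambda>x. f x + t * g x)"
        using f1 g by (intro le) simp
      moreover have "?n (\<lambda>x. f x + t * g x) = 1 + 2 * t * ?b + t\<^sup>2 * ?n g"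
      proof -
        have "?n (\<lambda>x. f x + t * g x) = ?n f + 2 * t * ?b + t\<^sup>2 * ?n g"
          by (simp add: algebra_simps power2_eq_square sum.distrib sum_distrib_left)
        then show ?thesis using f1 by simp
      qed
      moreover note qform_add[OF A, of f t g]
      ultimately show ?thesis by (simp add: m_def algebra_simps)
    qed
    then have "2 * (?a - m * ?b) = 0" by (rule linear_coefficient_zero)
    then show ?thesis by simp
  qed
  show ?thesis using that f1(2) f1(1) le crit by blast
qed

text \<open>For the zero constraint every indicator function is an admissible direction, which turns
  the tested eigenvalue equation into a pointwise one.\<close>

lemma extremal_eigenfunction_unconstrained:
  assumes fin: "finite S" and w: "\<And>x. x \<in> S \<Longrightarrow> w x > 0" and A: "symmetric_on S A"
    and ne: "S \<noteq> {}"
  obtains f m where "(\<Sum>x\<in>S. w x * (f x)\<^sup>2) = 1"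
    "\<And>g. qform S A g \<le> m * (\<Sum>x\<in>S. w x * (g x)\<^sup>2)"
    "\<And>x. x \<in> S \<Longrightarrow> (\<Sum>y\<in>S. A x y * f y) = m * (w x * f x)"
proof -
  obtain z where z: "z \<in> S" using ne by auto
  obtain f m where f: "(\<Sum>x\<in>S. w x * (f x)\<^sup>2) = 1"
    and le: "\<And>g. qform S A g \<le> m * (\<Sum>x\<in>S. w x * (g x)\<^sup>2)"
    and crit: "\<And>g. (\<Sum>x\<in>S. g x * (\<Sum>y\<in>S. A x y * f y)) = m * (\<Sum>x\<in>S. g x * (w x * f x))"
    using extremal_eigenfunction[where w = w, OF fin _ A z, of "\<lambda>_. 1::real" "\<lambda>_. 0"] w by auto
  have "(\<Sum>y\<in>S. A x y * f y) = m * (w x * f x)" if "x \<in> S" for x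
  proof -
    have "(\<Sum>u\<in>S. (if u = x then 1 else 0) * F u) = F x" for F :: "'a \<Rightarrow> real"
    proof -
      have "(\<Sum>u\<in>S. (if u = x then 1 else 0) * F u) = (\<Sum>u\<in>S. if u = x then F u else 0)"
        by (intro sum.cong) auto
      then show ?thesis using that fin by simp
    qed
    then show ?thesis using crit[of "\<lambda>u. if u = x then 1 else 0"] by simp
  qed
  then show ?thesis using that f le by blast
qed

text \<open>For an eigenvector \<open>f\<close> of \<open>G - F\<close> with largest eigenvalue \<open>m\<close>,
  \<open>\<parallel>G f\<parallel>\<^sup>2 - \<parallel>F f\<parallel>\<^sup>2 = m \<langle>f, (G + F) f\<rangle>\<close>, which rules out \<open>m > 0\<close>.\<close>
lemma sqrt_loewner_mono:
  assumes fin: "finite S" and w: "\<And>x. x \<in> S \<Longrightarrow> w x > 0"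
    and sym: "symmetric_on S F" "symmetric_on S G"
    and pos: "\<And>v. 0 \<le> qform S F v" "\<And>v. 0 \<le> qform S G v"
    and le: "\<And>v. (\<Sum>x\<in>S. (\<Sum>y\<in>S. G x y * v y)\<^sup>2 / w x) \<le> (\<Sum>x\<in>S. (\<Sum>y\<in>S. F x y * v y)\<^sup>2 / w x)"
  shows "qform S G v \<le> qform S F v"
proof (cases "S = {}")
  case False
  have "symmetric_on S (\<lambda>x y. G x y - F x y)" using sym by (simp add: symmetric_on_def)
  from extremal_eigenfunction_unconstrained[where w = w, OF fin _ this False]
  obtain f m where f: "(\<Sum>x\<in>S. w x * (f x)\<^sup>2) = 1"
    and max: "\<And>g. qform S (\<lambda>x y. G x y - F x y) g \<le> m * (\<Sum>x\<in>S. w x * (g x)\<^sup>2)"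
    and eig: "\<And>x. x \<in> S \<Longrightarrow> (\<Sum>y\<in>S. (G x y - F x y) * f y) = m * (w x * f x)"
    using w by blast
  define Gf where "Gf x = (\<Sum>y\<in>S. G x y * f y)" for x
  define Ff where "Ff x = (\<Sum>y\<in>S. F x y * f y)" for x
  have diff: "Gf x - Ff x = m * (w x * f x)" if "x \<in> S" for x
    using eig[OF that] by (simp add: Gf_def Ff_def left_diff_distrib sum_subtractf)
  have qG: "qform S G f = (\<Sum>x\<in>S. f x * Gf x)" and qF: "qform S F f = (\<Sum>x\<in>S. f x * Ff x)"
    by (simp_all add: qform_apply Gf_def Ff_def)
  \<comment> \<open>The squares are factored pointwise after application to f, where
    \<open>diff\<close> replaces the first factor by a multiple of f; F and G themselves need not
    commute.\<close>
  have "(\<Sum>x\<in>S. (Gf x)\<^sup>2 / w x) - (\<Sum>x\<in>S. (Ff x)\<^sup>2 / w x)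
      = (\<Sum>x\<in>S. (Gf x - Ff x) * (Gf x + Ff x) / w x)"
    by (simp add: sum_subtractf[symmetric] diff_divide_distrib[symmetric] power2_eq_square
        algebra_simps)
  also have "\<dots> = (\<Sum>x\<in>S. m * (f x * Gf x + f x * Ff x))"
  proof (rule sum.cong[OF refl])
    fix x assume x: "x \<in> S"
    show "(Gf x - Ff x) * (Gf x + Ff x) / w x = m * (f x * Gf x + f x * Ff x)"
      unfolding diff[OF x] using w[OF x] by (simp add: field_simps)
  qed
  also have "\<dots> = m * (qform S G f + qform S F f)"
    by (simp add: qG qF sum.distrib sum_distrib_left[symmetric])
  finally have *: "m * (qform S G f + qform S F f) \<le> 0"
    using le[of f] by (simp add: Gf_def Ff_def)
  have "m = m * (\<Sum>x\<in>S. w x * (f x)\<^sup>2)" using f by simp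
  also have "\<dots> = (\<Sum>x\<in>S. f x * (Gf x - Ff x))"
    by (simp add: sum_distrib_left diff power2_eq_square mult_ac)
  also have "\<dots> = qform S G f - qform S F f"
    by (simp add: qG qF algebra_simps sum_subtractf)
  finally have m: "m = qform S G f - qform S F f" .
  have "m \<le> 0"
  \<comment> \<open>If m > 0, the nonnegative values of both forms at f have sum at most 0, so that
    of G vanishes and m equals minus that of F, which is not positive.\<close>
  proof (rule ccontr)
    assume "\<not> m \<le> 0"
    then have "qform S G f + qform S F f \<le> 0" using * by (simp add: mult_le_0_iff)
    then have "qform S G f = 0" using pos[of f] by linarith
    then show False using m pos(1)[of f] \<open>\<not> m \<le> 0\<close> by linarith
  qed
  moreover have "0 \<le> (\<Sum>x\<in>S. w x * (v x)\<^sup>2)" using w by (intro sum_nonneg) (auto simp: less_imp_le)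
  ultimately have "m * (\<Sum>x\<in>S. w x * (v x)\<^sup>2) \<le> 0" by (rule mult_nonpos_nonneg)
  then show ?thesis using max[of v] by (simp add: qform_diff)
qed (simp add: qform_def)

subsection \<open>Trickle-down for a symmetric coupling\<close>


text \<open>\<open>Q\<close> stands for \<open>\<Pi> P\<close>; the marginal condition says that the
  constant 1 is an eigenfunction of P with eigenvalue 1. Weights are only nonnegative here because
  the locale is used both on one link and on all vertices, where the weights vanish off the
  link.\<close>

locale coupling =
  fixes S :: "'a set" and w :: "'a \<Rightarrow> real" and Q :: "'a \<Rightarrow> 'a \<Rightarrow> real"
  assumes finite: "finite S"
    and nonneg: "\<And>x. x \<in> S \<Longrightarrow> 0 \<le> w x"
    and total: "(\<Sum>x\<in>S. w x) = 1"
    and sym: "symmetric_on S Q"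
    and marginal: "\<And>x. x \<in> S \<Longrightarrow> (\<Sum>y\<in>S. Q x y) = w x"
begin

lemma sum_Q_apply: "(\<Sum>x\<in>S. (\<Sum>y\<in>S. Q x y * f y)) = (\<Sum>x\<in>S. w x * f x)"
proof -
  have "(\<Sum>x\<in>S. (\<Sum>y\<in>S. Q x y * f y)) = (\<Sum>x\<in>S. 1 * (\<Sum>y\<in>S. Q x y * f y))" by simp
  also have "\<dots> = (\<Sum>x\<in>S. f x * (\<Sum>y\<in>S. Q x y * 1))" by (rule bilinear_sym[OF sym])
  also have "\<dots> = (\<Sum>x\<in>S. w x * f x)" by (intro sum.cong) (auto simp: marginal)
  finally show ?thesis .
qed

lemma mean_centered: "(\<Sum>x\<in>S. w x * (f x - (\<Sum>x\<in>S. w x * f x))) = 0"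
  by (simp add: right_diff_distrib sum_subtractf sum_distrib_right[symmetric] total)

lemma variance_centered:
  "(\<Sum>x\<in>S. w x * (f x - (\<Sum>x\<in>S. w x * f x))\<^sup>2) = (\<Sum>x\<in>S. w x * (f x)\<^sup>2) - (\<Sum>x\<in>S. w x * f x)\<^sup>2"
proof -
  let ?s = "\<Sum>x\<in>S. w x * f x"
  have "(\<Sum>x\<in>S. w x * (f x - ?s)\<^sup>2)
      = (\<Sum>x\<in>S. w x * (f x)\<^sup>2 - 2 * ?s * (w x * f x) + ?s\<^sup>2 * w x)"
    by (intro sum.cong) (auto simp: power2_eq_square algebra_simps)
  also have "\<dots> = (\<Sum>x\<in>S. w x * (f x)\<^sup>2) - 2 * ?s * ?s + ?s\<^sup>2"
    by (simp only: sum.distrib sum_subtractf sum_distrib_left[symmetric] total mult_1_right)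
  finally show ?thesis by (simp add: power2_eq_square)
qed

text \<open>Constants are an eigenspace of a self-adjoint operator, so splitting f into its mean and
  a centered part leaves no cross term.\<close>

lemma qform_centered:
  "qform S Q f = (\<Sum>x\<in>S. w x * f x)\<^sup>2 + qform S Q (\<lambda>x. f x - (\<Sum>x\<in>S. w x * f x))"
proof -
  let ?s = "\<Sum>x\<in>S. w x * f x"
  have "qform S Q (\<lambda>x. f x + (- ?s) * 1) = qform S Q f + 2 * (- ?s) * ?s + (- ?s)\<^sup>2 * qform S Q (\<lambda>_. 1)"
    unfolding qform_add[OF sym] by (simp add: sum_Q_apply)
  moreover have "qform S Q (\<lambda>_. 1) = 1"
    by (simp add: qform_def marginal total)
  ultimately show ?thesis by (simp add: power2_eq_square)
qed

text \<open>On the centered part of f the deflation term vanishes, whatever \<kappa> is. A bound on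
  the deflated form is thus a bound on the spectrum orthogonal to constants.\<close>

lemma qform_le_if_deflated_le:
  assumes "\<And>v. qform S Q v - \<kappa> * (\<Sum>x\<in>S. w x * v x)\<^sup>2 \<le> \<mu> * (\<Sum>x\<in>S. w x * (v x)\<^sup>2)"
  shows "qform S Q f \<le> (1 - \<mu>) * (\<Sum>x\<in>S. w x * f x)\<^sup>2 + \<mu> * (\<Sum>x\<in>S. w x * (f x)\<^sup>2)"
proof -
  have "qform S Q (\<lambda>x. f x - (\<Sum>x\<in>S. w x * f x))
      \<le> \<mu> * ((\<Sum>x\<in>S. w x * (f x)\<^sup>2) - (\<Sum>x\<in>S. w x * f x)\<^sup>2)"
    using assms[of "\<lambda>x. f x - (\<Sum>x\<in>S. w x * f x)"]
    unfolding mean_centered variance_centered by simp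
  then show ?thesis unfolding qform_centered[of f] by (simp add: left_diff_distrib right_diff_distrib)
qed

lemma second_eigenfunction:
  assumes pos: "\<And>x. x \<in> S \<Longrightarrow> 0 < w x"
    and h: "z \<in> S" "h z \<noteq> 0" "(\<Sum>x\<in>S. w x * h x) = 0"
  obtains f m where "(\<Sum>x\<in>S. w x * f x) = 0" "(\<Sum>x\<in>S. w x * (f x)\<^sup>2) = 1"
    "\<And>g. (\<Sum>x\<in>S. w x * g x) = 0 \<Longrightarrow> qform S Q g \<le> m * (\<Sum>x\<in>S. w x * (g x)\<^sup>2)"
    "\<And>x. x \<in> S \<Longrightarrow> (\<Sum>y\<in>S. Q x y * f y) = m * (w x * f x)"
proof -
  obtain f m where f: "(\<Sum>x\<in>S. w x * f x) = 0" "(\<Sum>x\<in>S. w x * (f x)\<^sup>2) = 1"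
    and max: "\<And>g. (\<Sum>x\<in>S. w x * g x) = 0 \<Longrightarrow> qform S Q g \<le> m * (\<Sum>x\<in>S. w x * (g x)\<^sup>2)"
    and crit: "\<And>g. (\<Sum>x\<in>S. w x * g x) = 0 \<Longrightarrow>
      (\<Sum>x\<in>S. g x * (\<Sum>y\<in>S. Q x y * f y)) = m * (\<Sum>x\<in>S. g x * (w x * f x))"
    using extremal_eigenfunction[where w = w and c = w, OF finite _ sym h] pos by blast
  have "(\<Sum>y\<in>S. Q x y * f y) = m * (w x * f x)" if x: "x \<in> S" for x
  proof -
    \<comment> \<open>The indicator of x is corrected by its mean to become an admissible direction.
      The correction contributes nothing, because both sides of the eigenvalue equation sum to a
      multiple of the mean of f, which is 0.\<close>
    define g where "g u = (if u = x then 1 else 0) - w x" for u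
    have unit: "(\<Sum>u\<in>S. g u * F u) = F x - w x * (\<Sum>u\<in>S. F u)" for F
    proof -
      have "(\<Sum>u\<in>S. g u * F u) = (\<Sum>u\<in>S. (if u = x then F u else 0) - w x * F u)"
        by (intro sum.cong) (auto simp: g_def algebra_simps)
      then show ?thesis using x finite by (simp add: sum_subtractf sum_distrib_left)
    qed
    have "(\<Sum>u\<in>S. w u * g u) = 0" using unit[of w] by (simp add: total mult.commute)
    from crit[OF this] show ?thesis
      by (simp add: unit f sum_Q_apply)
  qed
  then show ?thesis using that f max by blast
qed

text \<open>At a second eigenfunction the local inequality reads m \<le> (1 - \<mu>) m^2 + \<mu>,
  that is, (1 - m) ((1 - \<mu>) m - \<mu>) \<le> 0. Here \<open>gap\<close> makes the first factor
  positive.\<close>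

lemma trickle_down:
  assumes pos: "\<And>x. x \<in> S \<Longrightarrow> 0 < w x"
    and \<mu>: "\<mu> < 1"
    and local: "\<And>f. qform S Q f \<le> (1 - \<mu>) * (\<Sum>x\<in>S. (\<Sum>y\<in>S. Q x y * f y)\<^sup>2 / w x)
        + \<mu> * (\<Sum>x\<in>S. w x * (f x)\<^sup>2)"
    and gap: "\<And>f m. (\<Sum>x\<in>S. w x * f x) = 0 \<Longrightarrow> (\<Sum>x\<in>S. w x * (f x)\<^sup>2) = 1 \<Longrightarrow>
        (\<And>x. x \<in> S \<Longrightarrow> (\<Sum>y\<in>S. Q x y * f y) = m * (w x * f x)) \<Longrightarrow> m < 1"
    and g: "(\<Sum>x\<in>S. w x * g x) = 0"
  shows "qform S Q g \<le> \<mu> / (1 - \<mu>) * (\<Sum>x\<in>S. w x * (g x)\<^sup>2)"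
proof (cases "\<exists>z\<in>S. g z \<noteq> 0")
  case True
  then obtain z where z: "z \<in> S" "g z \<noteq> 0" by blast
  obtain f m where f: "(\<Sum>x\<in>S. w x * f x) = 0" "(\<Sum>x\<in>S. w x * (f x)\<^sup>2) = 1"
    and max: "\<And>g. (\<Sum>x\<in>S. w x * g x) = 0 \<Longrightarrow> qform S Q g \<le> m * (\<Sum>x\<in>S. w x * (g x)\<^sup>2)"
    and eig: "\<And>x. x \<in> S \<Longrightarrow> (\<Sum>y\<in>S. Q x y * f y) = m * (w x * f x)"
    using second_eigenfunction[OF pos z g] by blast
  have "m < 1" using gap f eig by blast
  have "qform S Q f = (\<Sum>x\<in>S. m * (w x * (f x)\<^sup>2))"
    unfolding qform_apply by (intro sum.cong) (auto simp: eig power2_eq_square)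
  then have qf: "qform S Q f = m" by (simp add: sum_distrib_left[symmetric] f)
  have "(\<Sum>x\<in>S. (\<Sum>y\<in>S. Q x y * f y)\<^sup>2 / w x) = (\<Sum>x\<in>S. m\<^sup>2 * (w x * (f x)\<^sup>2))"
    using pos by (intro sum.cong) (auto simp: eig power2_eq_square less_imp_neq[symmetric])
  then have "(\<Sum>x\<in>S. (\<Sum>y\<in>S. Q x y * f y)\<^sup>2 / w x) = m\<^sup>2"
    by (simp add: sum_distrib_left[symmetric] f)
  then have "m \<le> (1 - \<mu>) * m\<^sup>2 + \<mu>" using local[of f] qf f by simp
  then have "(1 - m) * ((1 - \<mu>) * m - \<mu>) \<le> 0"
    by (simp add: algebra_simps power2_eq_square)
  then have "(1 - \<mu>) * m - \<mu> \<le> 0" using \<open>m < 1\<close> by (simp add: mult_le_0_iff)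
  then have "m \<le> \<mu> / (1 - \<mu>)" using \<mu> by (simp add: field_simps)
  moreover have "0 \<le> (\<Sum>x\<in>S. w x * (g x)\<^sup>2)" using nonneg by (intro sum_nonneg) auto
  ultimately show ?thesis using max[OF g] by (meson mult_right_mono order_trans)
next
  case False
  then have "qform S Q g = 0" "(\<Sum>x\<in>S. w x * (g x)\<^sup>2) = 0"
    by (auto simp: qform_def intro!: sum.neutral)
  then show ?thesis by simp
qed

lemma matrix_trickle_down:
  assumes pos: "\<And>x. x \<in> S \<Longrightarrow> 0 < w x"
    and symM: "symmetric_on S M"
    and c: "0 < c" "\<kappa> = 2 - 1 / c" "1 \<le> \<kappa>"
    and gap: "\<And>g. (\<Sum>x\<in>S. w x * g x) = 0 \<Longrightarrow>
        qform S Q g \<le> 1 / (2 * c) * (\<Sum>x\<in>S. w x * (g x)\<^sup>2)"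
    and upper: "\<And>v. qform S M v \<le> 1 / (2 * c) * (\<Sum>x\<in>S. w x * (v x)\<^sup>2)"
    and rec: "\<And>v. qform S Q v - c * (\<Sum>x\<in>S. (\<Sum>y\<in>S. Q x y * v y)\<^sup>2 / w x)
        \<le> qform S M v - c * (\<Sum>x\<in>S. (\<Sum>y\<in>S. M x y * v y)\<^sup>2 / w x)"
  shows "qform S Q v - \<kappa> * (\<Sum>x\<in>S. w x * v x)\<^sup>2 \<le> qform S M v"
proof -
  let ?n = "\<lambda>v. \<Sum>x\<in>S. w x * (v x)\<^sup>2" and ?s = "\<lambda>v. \<Sum>x\<in>S. w x * v x"
  \<comment> \<open>h is the point up to which t - c t^2 increases; completing the square around it
    turns \<open>rec\<close> into a comparison of squares of positive semidefinite forms.\<close>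
  define h where "h = 1 / (2 * c)"
  have ch: "c * h = 1 / 2" "h > 0" using c by (simp_all add: h_def)
  define D where "D x y = (if x = y then w x else 0)" for x y
  define B where "B x y = Q x y - \<kappa> * (w x * w y)" for x y
  define F where "F x y = h * D x y - B x y" for x y
  define G where "G x y = h * D x y - M x y" for x y
  have symD: "symmetric_on S D" and symB: "symmetric_on S B"
    using sym by (auto simp: symmetric_on_def D_def B_def)
  have qD: "qform S D v = ?n v" for v
    unfolding D_def by (rule qform_diag[OF finite])
  have qB: "qform S B v = qform S Q v - \<kappa> * (?s v)\<^sup>2" for v
    unfolding B_def by (simp add: qform_diff qform_scale qform_rank_one)
  have D_apply: "(\<Sum>y\<in>S. D x y * v y) = w x * v x" if "x \<in> S" for x v
  proof -
    have "(\<Sum>y\<in>S. D x y * v y) = (\<Sum>y\<in>S. if x = y then w x * v x else 0)"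
      by (intro sum.cong) (auto simp: D_def)
    then show ?thesis using that finite by simp
  qed
  \<comment> \<open>The leading term does not depend on \<open>A\<close>, so it cancels when the
    identity is used for \<open>B\<close> and for \<open>M\<close>.\<close>
  have square: "c * (\<Sum>x\<in>S. (\<Sum>y\<in>S. (h * D x y - A x y) * v y)\<^sup>2 / w x)
      = c * h\<^sup>2 * ?n v - qform S A v + c * (\<Sum>x\<in>S. (\<Sum>y\<in>S. A x y * v y)\<^sup>2 / w x)" for A v
  proof -
    have "(\<Sum>y\<in>S. (h * D x y - A x y) * v y)\<^sup>2 / w x
        = h\<^sup>2 * (w x * (v x)\<^sup>2) - 2 * h * (v x * (\<Sum>y\<in>S. A x y * v y)) + (\<Sum>y\<in>S. A x y * v y)\<^sup>2 / w x"
      if x: "x \<in> S" for x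
    proof -
      let ?lhs = "\<Sum>y\<in>S. (h * D x y - A x y) * v y"
        and ?rhs = "h * (w x * v x) - (\<Sum>y\<in>S. A x y * v y)"
      have "?lhs = (\<Sum>y\<in>S. h * (D x y * v y)) - (\<Sum>y\<in>S. A x y * v y)"
        by (simp add: algebra_simps sum_subtractf)
      also have "\<dots> = h * (w x * v x) - (\<Sum>y\<in>S. A x y * v y)"
        by (simp add: sum_distrib_left[symmetric] D_apply[OF x])
      finally have eq: "?lhs = ?rhs" .
      show ?thesis
        unfolding eq power2_diff using pos[OF x] by (simp add: power2_eq_square field_simps)
    qed
    then have "(\<Sum>x\<in>S. (\<Sum>y\<in>S. (h * D x y - A x y) * v y)\<^sup>2 / w x)
        = h\<^sup>2 * ?n v - 2 * h * qform S A v + (\<Sum>x\<in>S. (\<Sum>y\<in>S. A x y * v y)\<^sup>2 / w x)"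
      by (simp add: sum.distrib sum_subtractf sum_distrib_left[symmetric] qform_apply cong: sum.cong)
    then have "c * (\<Sum>x\<in>S. (\<Sum>y\<in>S. (h * D x y - A x y) * v y)\<^sup>2 / w x)
        = c * (h\<^sup>2 * ?n v - 2 * h * qform S A v + (\<Sum>x\<in>S. (\<Sum>y\<in>S. A x y * v y)\<^sup>2 / w x))"
      by simp
    also have "\<dots> = c * h\<^sup>2 * ?n v - 2 * (c * h) * qform S A v + c * (\<Sum>x\<in>S. (\<Sum>y\<in>S. A x y * v y)\<^sup>2 / w x)"
      by (simp only: right_diff_distrib distrib_left mult_ac)
    finally show ?thesis by (simp add: ch)
  qed
  \<comment> \<open>Deflating \<open>Q\<close> changes its square only by a rank-one term: the
    entries of Q v sum to the mean of v, and the weights sum to 1.\<close>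
  have B_square: "(\<Sum>x\<in>S. (\<Sum>y\<in>S. B x y * v y)\<^sup>2 / w x)
      = (\<Sum>x\<in>S. (\<Sum>y\<in>S. Q x y * v y)\<^sup>2 / w x) - (2 * \<kappa> - \<kappa>\<^sup>2) * (?s v)\<^sup>2" for v
  proof -
    have "(\<Sum>y\<in>S. B x y * v y)\<^sup>2 / w x = (\<Sum>y\<in>S. Q x y * v y)\<^sup>2 / w x
        - 2 * \<kappa> * ?s v * (\<Sum>y\<in>S. Q x y * v y) + (\<kappa> * ?s v)\<^sup>2 * w x" if x: "x \<in> S" for x
    proof -
      let ?lhs = "\<Sum>y\<in>S. B x y * v y" and ?rhs = "(\<Sum>y\<in>S. Q x y * v y) - \<kappa> * w x * ?s v"
      have "?lhs = (\<Sum>y\<in>S. Q x y * v y) - (\<Sum>y\<in>S. \<kappa> * w x * (w y * v y))"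
        by (simp add: B_def algebra_simps sum_subtractf)
      also have "\<dots> = (\<Sum>y\<in>S. Q x y * v y) - \<kappa> * w x * ?s v"
        by (simp add: sum_distrib_left[symmetric])
      finally have eq: "?lhs = ?rhs" .
      show ?thesis
        unfolding eq power2_diff using pos[OF x] by (simp add: power2_eq_square field_simps)
    qed
    then have "(\<Sum>x\<in>S. (\<Sum>y\<in>S. B x y * v y)\<^sup>2 / w x)
        = (\<Sum>x\<in>S. (\<Sum>y\<in>S. Q x y * v y)\<^sup>2 / w x
          - 2 * \<kappa> * ?s v * (\<Sum>y\<in>S. Q x y * v y) + (\<kappa> * ?s v)\<^sup>2 * w x)"
      by (rule sum.cong[OF refl])
    also have "\<dots> = (\<Sum>x\<in>S. (\<Sum>y\<in>S. Q x y * v y)\<^sup>2 / w x) - 2 * \<kappa> * ?s v * ?s v + (\<kappa> * ?s v)\<^sup>2"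
      unfolding sum.distrib sum_subtractf sum_distrib_left[symmetric] sum_Q_apply total by simp
    finally show ?thesis
      by (simp only: power2_eq_square left_diff_distrib right_diff_distrib mult_ac)
  qed
  \<comment> \<open>This is where the value of \<kappa> matters: the rank-one terms of
    \<open>B\<close> and of its square cancel, so \<open>rec\<close>, which speaks of
    \<open>Q\<close>, also holds for \<open>B\<close>.\<close>
  have ck: "c * (2 * \<kappa> - \<kappa>\<^sup>2) = \<kappa>"
  proof -
    have "2 * \<kappa> - \<kappa>\<^sup>2 = \<kappa> * (2 - \<kappa>)" by (simp add: power2_eq_square right_diff_distrib)
    then show ?thesis using c(1,2) by simp
  qed
  \<comment> \<open>On constants \<open>B\<close> has eigenvalue 1 - \<kappa> \<le> 0, and on
    centered functions it agrees with \<open>Q\<close>, where \<open>gap\<close> applies.\<close>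
  have B_le: "qform S B v \<le> h * ?n v" for v
  proof -
    let ?g = "\<lambda>x. v x - ?s v"
    have "qform S B v = (1 - \<kappa>) * (?s v)\<^sup>2 + qform S Q ?g"
      unfolding qB by (subst qform_centered) (simp add: algebra_simps)
    also have "\<dots> \<le> 0 + h * ?n ?g"
      using c(3) gap[OF mean_centered, of v] by (intro add_mono mult_nonpos_nonneg) (auto simp: h_def)
    also have "\<dots> \<le> h * ?n v"
      using ch by (simp add: variance_centered mult_left_mono)
    finally show ?thesis .
  qed
  have qF: "qform S F v = h * ?n v - qform S B v" for v
    unfolding F_def[abs_def] qform_diff qform_scale qD ..
  have qG: "qform S G v = h * ?n v - qform S M v" for v
    unfolding G_def[abs_def] qform_diff qform_scale qD ..
  have "qform S G v \<le> qform S F v"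
  proof (rule sqrt_loewner_mono[where w = w, OF finite])
    show "0 \<le> qform S F v" "0 \<le> qform S G v" for v
      using B_le[of v] upper[of v] by (simp_all add: qF qG h_def)
    fix v
    have "qform S B v - c * (\<Sum>x\<in>S. (\<Sum>y\<in>S. B x y * v y)\<^sup>2 / w x)
        = qform S Q v - c * (\<Sum>x\<in>S. (\<Sum>y\<in>S. Q x y * v y)\<^sup>2 / w x)
          + (c * (2 * \<kappa> - \<kappa>\<^sup>2) - \<kappa>) * (?s v)\<^sup>2"
      unfolding qB B_square by (simp add: algebra_simps)
    then have "c * (\<Sum>x\<in>S. (\<Sum>y\<in>S. G x y * v y)\<^sup>2 / w x) \<le> c * (\<Sum>x\<in>S. (\<Sum>y\<in>S. F x y * v y)\<^sup>2 / w x)"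
      unfolding F_def G_def square[of B] square[of M] using rec[of v] by (simp add: ck)
    then show "(\<Sum>x\<in>S. (\<Sum>y\<in>S. G x y * v y)\<^sup>2 / w x) \<le> (\<Sum>x\<in>S. (\<Sum>y\<in>S. F x y * v y)\<^sup>2 / w x)"
      using c(1) by simp
  qed (use pos symM symD symB in \<open>auto simp: symmetric_on_def F_def G_def\<close>)
  then show ?thesis by (simp add: qF qG qB)
qed

end

subsection \<open>Link distributions\<close>


locale weighted =
  fixes d :: nat and X :: "'a set set" and \<pi> :: "'a set pmf"
  assumes weighted: "weighted_complex d X \<pi>"
begin

text \<open>All weights of all links are quotients of values of this one function. It vanishes off
  \<open>X\<close>, so sums over link vertices can be extended to all vertices.\<close>

definition up :: "'a set \<Rightarrow> real" where
  "up A = measure_pmf.prob \<pi> {\<sigma>. A \<subseteq> \<sigma>}"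

abbreviation V :: "'a set" where "V \<equiv> vertices X"

abbreviation S :: "'a set \<Rightarrow> 'a set" where "S \<tau> \<equiv> vertices (link X \<tau>)"

abbreviation cod :: "'a set \<Rightarrow> real" where "cod \<tau> \<equiv> real_of_int (codim d \<tau>)"

abbreviation wt :: "'a set \<Rightarrow> 'a \<Rightarrow> real" where "wt \<equiv> vertex_weight d X \<pi>"

text \<open>The law of a uniformly random ordered pair of distinct elements of \<sigma> - \<tau>,
  for \<sigma> drawn conditionally on containing \<tau>. It is symmetric although the walk itself
  need not be.\<close>

definition joint :: "'a set \<Rightarrow> 'a \<Rightarrow> 'a \<Rightarrow> real" where
  "joint \<tau> x y = wt \<tau> x * local_walk d X \<pi> \<tau> x y"

lemma finite_X: "finite X" and down_closed: "\<sigma> \<in> X \<Longrightarrow> \<tau> \<subseteq> \<sigma> \<Longrightarrow> \<tau> \<in> X"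
  and set_pmf: "set_pmf \<pi> = facets X"
  and facet_card: "\<sigma> \<in> facets X \<Longrightarrow> card \<sigma> = Suc d"
  and finite_face: "\<sigma> \<in> X \<Longrightarrow> finite \<sigma>"
proof -
  obtain U where U: "finite U" "X \<subseteq> Pow U"
    using weighted by (auto simp: weighted_complex_def abstract_complex_def)
  then show "finite X" "\<sigma> \<in> X \<Longrightarrow> finite \<sigma>"
    by (auto intro: finite_subset)
  show "\<sigma> \<in> X \<Longrightarrow> \<tau> \<subseteq> \<sigma> \<Longrightarrow> \<tau> \<in> X" "set_pmf \<pi> = facets X"
    "\<sigma> \<in> facets X \<Longrightarrow> card \<sigma> = Suc d"
    using weighted
    by (auto simp: weighted_complex_def abstract_complex_def pure_complex_def face_dim_def)
qed

lemma finite_facets: "finite (facets X)"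
  using finite_X by (auto simp: facets_def)

lemma facet_mem: "\<sigma> \<in> facets X \<Longrightarrow> \<sigma> \<in> X"
  by (simp add: facets_def)

lemma mem_V: "\<sigma> \<in> X \<Longrightarrow> x \<in> \<sigma> \<Longrightarrow> x \<in> V"
  by (auto simp: vertices_def intro: down_closed)

lemma finite_V: "finite V"
proof -
  have "V \<subseteq> \<Union>X" by (auto simp: vertices_def)
  then show ?thesis using finite_X finite_face by (auto intro: finite_subset)
qed

lemma facet_above:
  assumes "\<tau> \<in> X"
  obtains \<sigma> where "\<sigma> \<in> facets X" "\<tau> \<subseteq> \<sigma>"
proof -
  have "\<exists>\<sigma>\<in>X. \<tau> \<subseteq> \<sigma> \<and> (\<forall>\<sigma>'\<in>X. \<sigma> \<subseteq> \<sigma>' \<longrightarrow> \<sigma> = \<sigma>')"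
    by (rule finite_has_maximal2[OF finite_X assms])
  then obtain \<sigma> where \<sigma>: "\<sigma> \<in> X" "\<tau> \<subseteq> \<sigma>" "\<And>\<sigma>'. \<sigma>' \<in> X \<Longrightarrow> \<sigma> \<subseteq> \<sigma>' \<Longrightarrow> \<sigma> = \<sigma>'"
    by blast
  have "\<sigma> \<in> facets X" unfolding facets_def using \<sigma>(1,3) by blast
  then show ?thesis using \<sigma>(2) by (rule that)
qed

lemma up_eq: "up A = (\<Sum>\<sigma>\<in>facets X. if A \<subseteq> \<sigma> then pmf \<pi> \<sigma> else 0)"
proof -
  have "up A = measure_pmf.prob \<pi> ({\<sigma>. A \<subseteq> \<sigma>} \<inter> set_pmf \<pi>)"
    unfolding up_def by (rule measure_Int_set_pmf[symmetric])
  also have "\<dots> = (\<Sum>\<sigma>\<in>{\<sigma>. A \<subseteq> \<sigma>} \<inter> set_pmf \<pi>. pmf \<pi> \<sigma>)"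
    using finite_facets by (intro measure_measure_pmf_finite) (simp add: set_pmf)
  also have "{\<sigma>. A \<subseteq> \<sigma>} \<inter> set_pmf \<pi> = facets X \<inter> {\<sigma>. A \<subseteq> \<sigma>}" by (auto simp: set_pmf)
  finally show ?thesis using finite_facets by (simp add: sum.inter_restrict)
qed

lemma up_pos: "0 < up A \<longleftrightarrow> A \<in> X"
proof
  assume "0 < up A"
  have "\<exists>\<sigma>\<in>facets X. A \<subseteq> \<sigma>"
  proof (rule ccontr)
    assume "\<not> ?thesis"
    then have "up A = 0" unfolding up_eq by (intro sum.neutral) auto
    then show False using \<open>0 < up A\<close> by simp
  qed
  then show "A \<in> X" using facet_mem down_closed by blast
next
  assume "A \<in> X"
  then obtain \<sigma> where "\<sigma> \<in> facets X" "A \<subseteq> \<sigma>" by (rule facet_above)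
  then show "0 < up A"
    unfolding up_eq using finite_facets
    by (intro sum_pos2[of _ \<sigma>]) (auto simp: pmf_positive_iff set_pmf)
qed

lemma up_nonneg: "0 \<le> up A"
  by (simp add: up_def)

lemma up_eq_0: "A \<notin> X \<Longrightarrow> up A = 0"
  using up_pos[of A] up_nonneg[of A] by linarith

lemma cod_eq: "cod \<tau> = real (Suc d) - real (card \<tau>)"
  by (simp add: codim_def face_dim_def)

text \<open>Double counting: every facet above A has exactly codim A further vertices. The
  normalisation of the weights and the averaging of \<open>joint\<close> over links both rest on
  this identity.\<close>

lemma sum_up_insert: "(\<Sum>x\<in>V - A. up (insert x A)) = cod A * up A"
proof -
  have "(\<Sum>x\<in>V - A. up (insert x A))
      = (\<Sum>\<sigma>\<in>facets X. \<Sum>x\<in>V - A. if insert x A \<subseteq> \<sigma> then pmf \<pi> \<sigma> else 0)"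
    unfolding up_eq by (rule sum.swap)
  also have "\<dots> = (\<Sum>\<sigma>\<in>facets X. cod A * (if A \<subseteq> \<sigma> then pmf \<pi> \<sigma> else 0))"
  proof (rule sum.cong[OF refl])
    fix \<sigma> assume \<sigma>: "\<sigma> \<in> facets X"
    show "(\<Sum>x\<in>V - A. if insert x A \<subseteq> \<sigma> then pmf \<pi> \<sigma> else 0) = cod A * (if A \<subseteq> \<sigma> then pmf \<pi> \<sigma> else 0)"
    proof (cases "A \<subseteq> \<sigma>")
      case True
      have "finite \<sigma>" using \<sigma> facet_mem finite_face by blast
      have "(\<Sum>x\<in>V - A. if insert x A \<subseteq> \<sigma> then pmf \<pi> \<sigma> else 0) = (\<Sum>x\<in>(V - A) \<inter> \<sigma>. pmf \<pi> \<sigma>)"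
        using True finite_V by (subst sum.inter_restrict) auto
      also have "(V - A) \<inter> \<sigma> = \<sigma> - A" using mem_V[OF facet_mem[OF \<sigma>]] by auto
      finally have "(\<Sum>x\<in>V - A. if insert x A \<subseteq> \<sigma> then pmf \<pi> \<sigma> else 0)
          = real (card (\<sigma> - A)) * pmf \<pi> \<sigma>" by simp
      moreover have "real (card (\<sigma> - A)) = cod A"
        using facet_card[OF \<sigma>] card_mono[OF \<open>finite \<sigma>\<close> True]
          card_Diff_subset[OF finite_subset[OF True \<open>finite \<sigma>\<close>] True]
        by (simp add: cod_eq of_nat_diff)
      ultimately show ?thesis using True by simp
    qed simp
  qed
  finally show ?thesis by (simp add: up_eq sum_distrib_left)
qed

lemma cond_prob_up: "\<P>(\<sigma> in measure_pmf \<pi>. B \<subseteq> \<sigma> \<bar> A \<subseteq> \<sigma>) = up (A \<union> B) / up A"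
  by (simp add: cond_prob_def up_def conj_commute)

lemma cond_prob_mem: "\<P>(\<sigma> in measure_pmf \<pi>. y \<in> \<sigma> \<bar> A \<subseteq> \<sigma>) = up (insert y A) / up A"
  using cond_prob_up[of "{y}" A] by simp

lemma mem_S: "x \<in> S \<tau> \<longleftrightarrow> x \<notin> \<tau> \<and> insert x \<tau> \<in> X"
proof
  assume "x \<in> S \<tau>"
  then obtain \<sigma> where \<sigma>: "{x} = \<sigma> - \<tau>" "\<sigma> \<in> X" "\<tau> \<subseteq> \<sigma>"
    by (auto simp: vertices_def link_def)
  then have "insert x \<tau> = \<sigma>" "x \<notin> \<tau>" by auto
  then show "x \<notin> \<tau> \<and> insert x \<tau> \<in> X" using \<sigma> by simp
next
  assume "x \<notin> \<tau> \<and> insert x \<tau> \<in> X"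
  then show "x \<in> S \<tau>"
    unfolding vertices_def link_def by (auto intro!: exI[of _ "insert x \<tau>"])
qed

lemma S_subset_V: "S \<tau> \<subseteq> V"
  using mem_V by (auto simp: mem_S)

lemma finite_S: "finite (S \<tau>)"
  using finite_subset[OF S_subset_V finite_V] .

lemma cod_insert: "\<tau> \<in> X \<Longrightarrow> x \<notin> \<tau> \<Longrightarrow> cod (insert x \<tau>) = cod \<tau> - 1"
  using finite_face by (simp add: cod_eq)

lemma wt_eq:
  assumes "\<tau> \<in> X" "1 \<le> cod \<tau>"
  shows "wt \<tau> x = (if x \<notin> \<tau> then up (insert x \<tau>) / (cod \<tau> * up \<tau>) else 0)"
proof -
  have "{x} \<in> faces (link X \<tau>) 0 \<longleftrightarrow> x \<in> S \<tau>"
    by (simp add: faces_def face_dim_def vertices_def)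
  moreover have "\<P>(\<sigma> in measure_pmf \<pi>. \<tau> \<union> {x} \<subseteq> \<sigma> \<bar> \<tau> \<subseteq> \<sigma>) = up (insert x \<tau>) / up \<tau>"
    unfolding cond_prob_up by simp
  ultimately show ?thesis
    using assms up_eq_0[of "insert x \<tau>"]
    by (simp add: vertex_weight_def link_weight_def mem_S del: insert_subset)
qed

lemma joint_eq:
  assumes "\<tau> \<in> X" "2 \<le> cod \<tau>"
  shows "joint \<tau> x y = (if x \<noteq> y \<and> x \<notin> \<tau> \<and> y \<notin> \<tau>
    then up (insert x (insert y \<tau>)) / (cod \<tau> * (cod \<tau> - 1) * up \<tau>) else 0)"
proof (cases "x \<in> S \<tau> \<and> y \<in> S \<tau>")
  case True
  then have "up (insert x \<tau>) \<noteq> 0" using up_pos[of "insert x \<tau>"] by (auto simp: mem_S)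
  moreover have "\<P>(\<sigma> in measure_pmf \<pi>. y \<in> \<sigma> \<bar> \<tau> \<union> {x} \<subseteq> \<sigma>)
      = up (insert x (insert y \<tau>)) / up (insert x \<tau>)"
    unfolding cond_prob_mem by (simp add: insert_commute)
  ultimately show ?thesis
    using assms True
    by (auto simp: joint_def wt_eq local_walk_def mem_S simp del: insert_subset)
next
  case False
  then have "insert x (insert y \<tau>) \<notin> X" if "x \<notin> \<tau>" "y \<notin> \<tau>"
    using that down_closed[of "insert x (insert y \<tau>)" "insert x \<tau>"]
      down_closed[of "insert x (insert y \<tau>)" "insert y \<tau>"] by (auto simp: mem_S)
  then have "up (insert x (insert y \<tau>)) = 0" if "x \<notin> \<tau>" "y \<notin> \<tau>"
    using that up_eq_0 by blast
  then show ?thesis using False by (auto simp: joint_def local_walk_def)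
qed

lemma wt_nonneg: "\<tau> \<in> X \<Longrightarrow> 1 \<le> cod \<tau> \<Longrightarrow> 0 \<le> wt \<tau> x"
  using up_nonneg by (simp add: wt_eq)

lemma wt_pos: "\<tau> \<in> X \<Longrightarrow> 1 \<le> cod \<tau> \<Longrightarrow> 0 < wt \<tau> x \<longleftrightarrow> x \<in> S \<tau>"
  using up_pos[of \<tau>] up_pos[of "insert x \<tau>"] up_nonneg[of "insert x \<tau>"]
  by (simp add: wt_eq mem_S zero_less_divide_iff)

lemma wt_zero: "\<tau> \<in> X \<Longrightarrow> 1 \<le> cod \<tau> \<Longrightarrow> x \<notin> S \<tau> \<Longrightarrow> wt \<tau> x = 0"
  using wt_nonneg[of \<tau> x] wt_pos[of \<tau> x] by linarith

lemma sum_wt: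
  assumes "\<tau> \<in> X" "1 \<le> cod \<tau>"
  shows "(\<Sum>x\<in>V. wt \<tau> x) = 1"
proof -
  have "(\<Sum>x\<in>V. wt \<tau> x) = (\<Sum>x\<in>V - \<tau>. up (insert x \<tau>) / (cod \<tau> * up \<tau>))"
    using finite_V assms by (intro sum.mono_neutral_cong_right) (auto simp: wt_eq)
  also have "\<dots> = 1"
    using up_pos[of \<tau>] assms by (simp add: sum_divide_distrib[symmetric] sum_up_insert)
  finally show ?thesis .
qed

lemma joint_commute: "\<tau> \<in> X \<Longrightarrow> 2 \<le> cod \<tau> \<Longrightarrow> joint \<tau> x y = joint \<tau> y x"
  by (auto simp: joint_eq insert_commute)

lemma joint_zero: "x \<notin> S \<tau> \<or> y \<notin> S \<tau> \<Longrightarrow> joint \<tau> x y = 0"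
  by (auto simp: joint_def local_walk_def)

text \<open>Chain rule: a vertex of the link followed by a vertex of its own link is a random
  ordered pair.\<close>

lemma wt_mult_wt_insert:
  assumes "\<tau> \<in> X" "2 \<le> cod \<tau>" "x \<in> S \<tau>"
  shows "wt \<tau> x * wt (insert x \<tau>) y = joint \<tau> x y"
  using assms up_pos[of "insert x \<tau>"]
  by (auto simp: wt_eq joint_eq mem_S cod_insert insert_commute)

lemma joint_marginal:
  assumes "\<tau> \<in> X" "2 \<le> cod \<tau>"
  shows "(\<Sum>y\<in>V. joint \<tau> x y) = wt \<tau> x"
proof (cases "x \<in> S \<tau>")
  case True
  then have "(\<Sum>y\<in>V. joint \<tau> x y) = wt \<tau> x * (\<Sum>y\<in>V. wt (insert x \<tau>) y)"
    using assms by (simp add: wt_mult_wt_insert sum_distrib_left)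
  then show ?thesis
    using True assms by (simp add: mem_S sum_wt cod_insert)
next
  case False
  then show ?thesis using assms by (simp add: joint_zero wt_zero)
qed

text \<open>Law of total probability for a random ordered triple (x, y, z) when x is
  forgotten.\<close>

lemma wt_mult_joint_insert:
  assumes "\<tau> \<in> X" "3 \<le> cod \<tau>"
  shows "(\<Sum>x\<in>S \<tau>. wt \<tau> x * joint (insert x \<tau>) y z) = joint \<tau> y z"
proof -
  let ?C = "cod \<tau> * (cod \<tau> - 1) * (cod \<tau> - 2) * up \<tau>"
  have ins: "insert x \<tau> \<in> X" "x \<notin> \<tau>" "cod (insert x \<tau>) = cod \<tau> - 1" "up (insert x \<tau>) \<noteq> 0"
    if "x \<in> S \<tau>" for x
    using that assms up_pos[of "insert x \<tau>"] by (auto simp: mem_S cod_insert)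
  have summand: "wt \<tau> x * joint (insert x \<tau>) y z
      = (if y \<noteq> z \<and> y \<notin> \<tau> \<and> z \<notin> \<tau> then (if x \<in> {y, z} then 0 else up (insert x (insert y (insert z \<tau>))) / ?C) else 0)"
    if x: "x \<in> S \<tau>" for x
    using ins[OF x] assms by (auto simp: wt_eq joint_eq insert_commute)
  show ?thesis
  proof (cases "y \<noteq> z \<and> y \<notin> \<tau> \<and> z \<notin> \<tau>")
    case True
    let ?B = "insert y (insert z \<tau>)"
    have "(\<Sum>x\<in>S \<tau>. wt \<tau> x * joint (insert x \<tau>) y z)
        = (\<Sum>x\<in>S \<tau>. if x \<in> {y, z} then 0 else up (insert x ?B) / ?C)"
      using True by (intro sum.cong) (simp_all add: summand)
    also have "\<dots> = (\<Sum>x\<in>V - ?B. up (insert x ?B) / ?C)"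
    proof (rule sum.mono_neutral_cong)
      fix x assume x: "x \<in> V - ?B - S \<tau>"
      then have "insert x ?B \<notin> X"
        using down_closed[of "insert x ?B" "insert x \<tau>"] by (auto simp: mem_S)
      then show "up (insert x ?B) / ?C = 0" by (simp add: up_eq_0)
    qed (use finite_S finite_V in \<open>auto simp: mem_S intro: mem_V[OF _ insertI1]\<close>)
    also have "\<dots> = cod ?B * up ?B / ?C"
      by (simp only: sum_divide_distrib[symmetric] sum_up_insert)
    also have "cod ?B = cod \<tau> - 2"
      using True finite_face[OF assms(1)] by (simp add: cod_eq)
    finally show ?thesis using True assms by (simp add: joint_eq)
  next
    case False
    then have "joint \<tau> y z = 0" using assms by (auto simp: joint_eq)
    moreover have "(\<Sum>x\<in>S \<tau>. wt \<tau> x * joint (insert x \<tau>) y z) = 0"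
    proof (intro sum.neutral ballI)
      fix x assume x: "x \<in> S \<tau>"
      show "wt \<tau> x * joint (insert x \<tau>) y z = 0" unfolding summand[OF x] using False by auto
    qed
    ultimately show ?thesis by simp
  qed
qed

lemma sum_V_eq_sum_S:
  assumes "\<And>x. x \<in> V \<Longrightarrow> x \<notin> S \<tau> \<Longrightarrow> F x = 0"
  shows "(\<Sum>x\<in>V. F x) = (\<Sum>x\<in>S \<tau>. F x)"
  using assms finite_V S_subset_V by (intro sum.mono_neutral_right) auto

lemma coupling_V:
  assumes "\<tau> \<in> X" "2 \<le> cod \<tau>"
  shows "coupling V (wt \<tau>) (joint \<tau>)"
  using assms finite_V
  by unfold_locales (auto simp: wt_nonneg sum_wt joint_marginal symmetric_on_def joint_commute)

lemma coupling_S: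
  assumes "\<tau> \<in> X" "2 \<le> cod \<tau>"
  shows "coupling (S \<tau>) (wt \<tau>) (joint \<tau>)"
proof
  show "(\<Sum>x\<in>S \<tau>. wt \<tau> x) = 1"
    using sum_V_eq_sum_S[of \<tau> "wt \<tau>"] assms by (simp add: sum_wt wt_zero)
  show "(\<Sum>y\<in>S \<tau>. joint \<tau> x y) = wt \<tau> x" for x
    using sum_V_eq_sum_S[of \<tau> "joint \<tau> x"] assms by (simp add: joint_marginal joint_zero)
qed (use assms finite_S in \<open>auto simp: wt_nonneg symmetric_on_def joint_commute\<close>)

lemma mat_mult_Pi_walk:
  "x \<in> V \<Longrightarrow> mat_mult_on V (Pi_mat d X \<pi> \<tau>) (local_walk d X \<pi> \<tau>) x y = joint \<tau> x y"
proof -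
  assume x: "x \<in> V"
  have "mat_mult_on V (Pi_mat d X \<pi> \<tau>) (local_walk d X \<pi> \<tau>) x y
      = (\<Sum>z\<in>V. if x = z then joint \<tau> x y else 0)"
    unfolding mat_mult_on_def by (intro sum.cong) (auto simp: Pi_mat_def joint_def)
  then show ?thesis using x finite_V by simp
qed

lemma qform_Pi: "qform V (Pi_mat d X \<pi> \<tau>) v = (\<Sum>x\<in>V. wt \<tau> x * (v x)\<^sup>2)"
  unfolding Pi_mat_def by (rule qform_diag[OF finite_V])

text \<open>With two vertices in the link there is a nonzero function of mean zero, and hence a
  second eigenvalue to speak of.\<close>

lemma two_link_vertices:
  assumes "\<tau> \<in> X" "2 \<le> cod \<tau>"
  obtains x y where "x \<in> S \<tau>" "y \<in> S \<tau>" "x \<noteq> y"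
proof -
  obtain \<sigma> where \<sigma>: "\<sigma> \<in> facets X" "\<tau> \<subseteq> \<sigma>" using facet_above assms by blast
  have "finite \<sigma>" using \<sigma> facet_mem finite_face by blast
  then have "2 \<le> card (\<sigma> - \<tau>)"
    using assms(2) facet_card[OF \<sigma>(1)] card_Diff_subset[OF finite_subset[OF \<sigma>(2)] \<sigma>(2)]
    by (simp add: cod_eq)
  then obtain x y where "x \<in> \<sigma> - \<tau>" "y \<in> \<sigma> - \<tau>" "x \<noteq> y"
    by (auto simp: numeral_2_eq_2 card_le_Suc_iff)
  moreover have "z \<in> S \<tau>" if "z \<in> \<sigma> - \<tau>" for z
    using that \<sigma> facet_mem down_closed[of \<sigma> "insert z \<tau>"] by (auto simp: mem_S)
  ultimately show ?thesis using that by blast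
qed

end

subsection \<open>The second eigenvalue of the local walk\<close>


lemma sum_restrict:
  assumes "finite V" "S \<subseteq> V" "\<And>x. F x 0 = 0"
  shows "(\<Sum>x\<in>V. F x (if x \<in> S then v x else (0::real))) = (\<Sum>x\<in>S. F x (v x) :: real)"
  using assms by (intro sum.mono_neutral_cong_right) auto

lemma qform_restrict:
  assumes "finite V" "S \<subseteq> V"
  shows "qform V A (\<lambda>x. if x \<in> S then v x else 0) = qform S A v"
  unfolding qform_apply
  using assms sum_restrict[OF assms, of "\<lambda>y r. A x y * r" v for x]
  by (subst sum_restrict[OF assms, of "\<lambda>x r. r * (\<Sum>y\<in>V. A x y * (if y \<in> S then v y else 0))"]) simp_all

context weighted
begin

text \<open>The induction invariant, with both bounds on all of \<open>V\<close> so that those for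
  the links of different vertices can be averaged.\<close>

definition local_bounds :: "('a set \<Rightarrow> 'a \<Rightarrow> 'a \<Rightarrow> real) \<Rightarrow> 'a set \<Rightarrow> bool" where
  "local_bounds M \<tau> \<longleftrightarrow>
    (\<forall>v. qform V (joint \<tau>) v - cod \<tau> / (cod \<tau> - 1) * (\<Sum>x\<in>V. wt \<tau> x * v x)\<^sup>2 \<le> qform V (M \<tau>) v) \<and>
    (\<forall>v. qform V (M \<tau>) v \<le> (cod \<tau> - 1) / (3 * cod \<tau> - 1) * (\<Sum>x\<in>V. wt \<tau> x * (v x)\<^sup>2))"

lemma local_walk_eq:
  assumes "\<tau> \<in> X" "2 \<le> cod \<tau>" "x \<in> S \<tau>"
  shows "local_walk d X \<pi> \<tau> x y = joint \<tau> x y / wt \<tau> x"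
  using assms wt_pos[of \<tau> x] by (simp add: joint_def)

lemma eigenfunction_walk:
  assumes "\<tau> \<in> X" "2 \<le> cod \<tau>"
  shows "eigenfunction_on (S \<tau>) (local_walk d X \<pi> \<tau>) m f \<longleftrightarrow>
    (\<forall>x\<in>S \<tau>. (\<Sum>y\<in>S \<tau>. joint \<tau> x y * f y) = m * (wt \<tau> x * f x))"
  unfolding eigenfunction_on_def
proof (intro ball_cong refl)
  fix x assume x: "x \<in> S \<tau>"
  then have "0 < wt \<tau> x" using assms wt_pos[of \<tau> x] by simp
  moreover have "(\<Sum>y\<in>S \<tau>. local_walk d X \<pi> \<tau> x y * f y) = (\<Sum>y\<in>S \<tau>. joint \<tau> x y * f y) / wt \<tau> x"
    using assms x by (simp add: local_walk_eq sum_divide_distrib)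
  ultimately show "((\<Sum>y\<in>S \<tau>. local_walk d X \<pi> \<tau> x y * f y) = m * f x)
      = ((\<Sum>y\<in>S \<tau>. joint \<tau> x y * f y) = m * (wt \<tau> x * f x))"
    by (auto simp: field_simps)
qed

lemma eigenfunction_walk_1:
  assumes "\<tau> \<in> X" "2 \<le> cod \<tau>"
  shows "eigenfunction_on (S \<tau>) (local_walk d X \<pi> \<tau>) 1 (\<lambda>_. 1)"
  using coupling.marginal[OF coupling_S[OF assms]]
  by (simp add: eigenfunction_walk[OF assms])

text \<open>Supplies the nonzero 2x2 minor showing that f is independent of the constant
  eigenfunction.\<close>

lemma centered_nonconstant:
  assumes "\<tau> \<in> X" "2 \<le> cod \<tau>"
    and f: "(\<Sum>x\<in>S \<tau>. wt \<tau> x * f x) = 0" "(\<Sum>x\<in>S \<tau>. wt \<tau> x * (f x)\<^sup>2) = 1"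
  obtains x y where "x \<in> S \<tau>" "y \<in> S \<tau>" "f x \<noteq> f y"
proof -
  interpret coupling "S \<tau>" "wt \<tau>" "joint \<tau>" by (rule coupling_S[OF assms(1,2)])
  have "\<exists>x\<in>S \<tau>. \<exists>y\<in>S \<tau>. f x \<noteq> f y"
  proof (rule ccontr)
    assume c: "\<not> ?thesis"
    obtain z where z: "z \<in> S \<tau>" using two_link_vertices[OF assms(1,2)] by blast
    have "f x = f z" if "x \<in> S \<tau>" for x using c z that by blast
    then have "(\<Sum>x\<in>S \<tau>. wt \<tau> x * f x) = f z" "(\<Sum>x\<in>S \<tau>. wt \<tau> x * (f x)\<^sup>2) = (f z)\<^sup>2"
      using total by (simp_all flip: sum_distrib_right cong: sum.cong)
    then show False using f by simp
  qed
  then show ?thesis using that by blast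
qed

text \<open>Together with the constants f gives two independent eigenfunctions, for 1 and m. Hence
  the smaller of 1 and m is at most the second eigenvalue, which is below 1.\<close>

lemma walk_eigenvalue_less_1:
  assumes "\<tau> \<in> X" "2 \<le> cod \<tau>" "lambda2_walk d X \<pi> \<tau> < 1"
    and f: "(\<Sum>x\<in>S \<tau>. wt \<tau> x * f x) = 0" "(\<Sum>x\<in>S \<tau>. wt \<tau> x * (f x)\<^sup>2) = 1"
    and eig: "\<And>x. x \<in> S \<tau> \<Longrightarrow> (\<Sum>y\<in>S \<tau>. joint \<tau> x y * f y) = m * (wt \<tau> x * f x)"
  shows "m < 1"
proof -
  obtain x y where xy: "x \<in> S \<tau>" "y \<in> S \<tau>" "f x \<noteq> f y"
    using centered_nonconstant[OF assms(1,2) f] .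
  have "eigenfunction_on (S \<tau>) (local_walk d X \<pi> \<tau>) m f"
    using eig by (simp add: eigenfunction_walk[OF assms(1,2)])
  then have "min 1 m \<le> lambda2_walk d X \<pi> \<tau>"
    using eigenvalues_desc_two_eigenfunctions[OF finite_S eigenfunction_walk_1[OF assms(1,2)], of m f x y]
      xy by (simp add: lambda2_walk_def)
  then show ?thesis using assms(3) by simp
qed

lemma lambda2_walk_eigenfunction:
  assumes "\<tau> \<in> X" "2 \<le> cod \<tau>" "lambda2_walk d X \<pi> \<tau> < 1"
  obtains h z where "z \<in> S \<tau>" "h z \<noteq> 0" "(\<Sum>x\<in>S \<tau>. wt \<tau> x * h x) = 0"
    "\<And>x. x \<in> S \<tau> \<Longrightarrow> (\<Sum>y\<in>S \<tau>. joint \<tau> x y * h y) = lambda2_walk d X \<pi> \<tau> * (wt \<tau> x * h x)"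
proof -
  interpret coupling "S \<tau>" "wt \<tau>" "joint \<tau>" by (rule coupling_S[OF assms(1,2)])
  have pos: "0 < wt \<tau> x" if "x \<in> S \<tau>" for x using that assms wt_pos by simp
  obtain x y where xy: "x \<in> S \<tau>" "y \<in> S \<tau>" "x \<noteq> y" using two_link_vertices[OF assms(1,2)] .
  \<comment> \<open>Any nonzero function of mean zero would do. It starts the construction of an
    eigenfunction f independent of the constants, which certifies that the second entry of the list
    of eigenvalues exists.\<close>
  define g where "g u = (if u = x then 1 / wt \<tau> x else 0) - (if u = y then 1 / wt \<tau> y else 0)" for u
  have "(\<Sum>u\<in>S \<tau>. wt \<tau> u * g u) = (\<Sum>u\<in>S \<tau>. (if u = x then 1 else 0) - (if u = y then 1 else 0))"
    using pos by (intro sum.cong) (auto simp: g_def less_imp_neq[symmetric])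
  then have g0: "(\<Sum>u\<in>S \<tau>. wt \<tau> u * g u) = 0" using xy finite by (simp add: sum_subtractf)
  have gx: "g x \<noteq> 0" using xy pos[of x] by (simp add: g_def)
  obtain f m where f: "(\<Sum>x\<in>S \<tau>. wt \<tau> x * f x) = 0" "(\<Sum>x\<in>S \<tau>. wt \<tau> x * (f x)\<^sup>2) = 1"
    and eig: "\<And>x. x \<in> S \<tau> \<Longrightarrow> (\<Sum>y\<in>S \<tau>. joint \<tau> x y * f y) = m * (wt \<tau> x * f x)"
    using pos xy(1) gx g0 by (rule second_eigenfunction) blast+
  obtain a b where ab: "a \<in> S \<tau>" "b \<in> S \<tau>" "f a \<noteq> f b"
    using centered_nonconstant[OF assms(1,2) f] .
  have "eigenfunction_on (S \<tau>) (local_walk d X \<pi> \<tau>) m f"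
    using eig by (simp add: eigenfunction_walk[OF assms(1,2)])
  moreover have "1 * f b \<noteq> 1 * f a" using ab by simp
  ultimately obtain h z where h: "eigenfunction_on (S \<tau>) (local_walk d X \<pi> \<tau>) (lambda2_walk d X \<pi> \<tau>) h"
    and z: "z \<in> S \<tau>" "h z \<noteq> 0"
    unfolding lambda2_walk_def
    by (rule lambda2_on_eigenfunction[OF finite_S eigenfunction_walk_1[OF assms(1,2)] _ ab(1,2)])
  have heig: "(\<Sum>y\<in>S \<tau>. joint \<tau> x y * h y) = lambda2_walk d X \<pi> \<tau> * (wt \<tau> x * h x)"
    if "x \<in> S \<tau>" for x
    using h that by (simp add: eigenfunction_walk[OF assms(1,2)])
  \<comment> \<open>Summing the eigenvalue equation shows that the mean of h is fixed under
    multiplication by the second eigenvalue; as that is not 1, the mean is 0.\<close>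
  have "(\<Sum>x\<in>S \<tau>. wt \<tau> x * h x) = lambda2_walk d X \<pi> \<tau> * (\<Sum>x\<in>S \<tau>. wt \<tau> x * h x)"
  proof -
    have "(\<Sum>x\<in>S \<tau>. wt \<tau> x * h x) = (\<Sum>x\<in>S \<tau>. \<Sum>y\<in>S \<tau>. joint \<tau> x y * h y)"
      by (rule sum_Q_apply[symmetric])
    also have "\<dots> = (\<Sum>x\<in>S \<tau>. lambda2_walk d X \<pi> \<tau> * (wt \<tau> x * h x))"
      by (intro sum.cong refl heig)
    also have "\<dots> = lambda2_walk d X \<pi> \<tau> * (\<Sum>x\<in>S \<tau>. wt \<tau> x * h x)"
      by (rule sum_distrib_left[symmetric])
    finally show ?thesis .
  qed
  then have "(\<Sum>x\<in>S \<tau>. wt \<tau> x * h x) = 0" using assms(3) by auto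
  then show ?thesis using that z heig by blast
qed

text \<open>The eigenfunction h has mean zero, so the deflation term disappears and the Rayleigh
  quotient of h passes from \<open>joint\<close> to \<open>M\<close>. There it is at most the top
  eigenvalue m, which is an eigenvalue of the matrix on the right.\<close>

lemma lambda2_walk_le_spectral_radius:
  assumes "\<tau> \<in> X" "2 \<le> cod \<tau>" "lambda2_walk d X \<pi> \<tau> < 1"
    and symM: "symmetric_on V (M \<tau>)" and bounds: "local_bounds M \<tau>"
  shows "lambda2_walk d X \<pi> \<tau> \<le> spectral_radius_on V (mat_mult_on V (Pi_inv d X \<pi> \<tau>) (M \<tau>))"
proof -
  let ?l = "lambda2_walk d X \<pi> \<tau>"
  have pos: "0 < wt \<tau> x" if "x \<in> S \<tau>" for x using that assms wt_pos by simp
  obtain h z where z: "z \<in> S \<tau>" "h z \<noteq> 0" and h0: "(\<Sum>x\<in>S \<tau>. wt \<tau> x * h x) = 0"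
    and heig: "\<And>x. x \<in> S \<tau> \<Longrightarrow> (\<Sum>y\<in>S \<tau>. joint \<tau> x y * h y) = ?l * (wt \<tau> x * h x)"
    using lambda2_walk_eigenfunction[OF assms(1-3)] by blast
  have symS: "symmetric_on (S \<tau>) (M \<tau>)" and "S \<tau> \<noteq> {}"
    using symM S_subset_V[of \<tau>] z by (auto simp: symmetric_on_def)
  obtain f m where f: "(\<Sum>x\<in>S \<tau>. wt \<tau> x * (f x)\<^sup>2) = 1"
    and max: "\<And>g. qform (S \<tau>) (M \<tau>) g \<le> m * (\<Sum>x\<in>S \<tau>. wt \<tau> x * (g x)\<^sup>2)"
    and eig: "\<And>x. x \<in> S \<tau> \<Longrightarrow> (\<Sum>y\<in>S \<tau>. M \<tau> x y * f y) = m * (wt \<tau> x * f x)"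
    using finite_S pos symS \<open>S \<tau> \<noteq> {}\<close> by (rule extremal_eigenfunction_unconstrained) blast+
  have "qform (S \<tau>) (joint \<tau>) h = (\<Sum>x\<in>S \<tau>. ?l * (wt \<tau> x * (h x)\<^sup>2))"
    unfolding qform_apply by (intro sum.cong) (auto simp: heig power2_eq_square)
  then have "?l * (\<Sum>x\<in>S \<tau>. wt \<tau> x * (h x)\<^sup>2) = qform (S \<tau>) (joint \<tau>) h"
    by (simp only: sum_distrib_left)
  also have "\<dots> \<le> qform (S \<tau>) (M \<tau>) h"
  proof -
    let ?h = "\<lambda>x. if x \<in> S \<tau> then h x else 0"
    have "(\<Sum>x\<in>V. wt \<tau> x * ?h x) = (\<Sum>x\<in>S \<tau>. wt \<tau> x * h x)"
      using finite_V S_subset_V by (rule sum_restrict) simp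
    then have "(\<Sum>x\<in>V. wt \<tau> x * ?h x) = 0" using h0 by simp
    then show ?thesis
      using bounds qform_restrict[OF finite_V S_subset_V, of _ \<tau> h] unfolding local_bounds_def
      by (metis diff_zero mult_zero_right zero_power2)
  qed
  also have "\<dots> \<le> m * (\<Sum>x\<in>S \<tau>. wt \<tau> x * (h x)\<^sup>2)" by (rule max)
  finally have "?l \<le> m"
    using z pos finite_S
    by (subst (asm) mult_le_cancel_right_pos) (auto intro!: sum_pos2[of _ z] simp: less_imp_le)
  also have "m \<le> spectral_radius_on V (mat_mult_on V (Pi_inv d X \<pi> \<tau>) (M \<tau>))"
  proof -
    \<comment> \<open>The zero extension remains an eigenfunction on all of \<open>V\<close> since
      \<open>Pi_inv\<close> annihilates the rows outside the link.\<close>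
    let ?f = "\<lambda>x. if x \<in> S \<tau> then f x else 0"
    have PiM: "mat_mult_on V (Pi_inv d X \<pi> \<tau>) (M \<tau>) x y = (if x \<in> S \<tau> then M \<tau> x y / wt \<tau> x else 0)"
      if "x \<in> V" for x y
    proof -
      have "mat_mult_on V (Pi_inv d X \<pi> \<tau>) (M \<tau>) x y
          = (\<Sum>z\<in>V. if x = z then (if x \<in> S \<tau> then M \<tau> x y / wt \<tau> x else 0) else 0)"
        unfolding mat_mult_on_def by (intro sum.cong) (auto simp: Pi_inv_def)
      then show ?thesis using that finite_V by simp
    qed
    have "\<exists>x\<in>S \<tau>. f x \<noteq> 0"
    proof (rule ccontr)
      assume "\<not> ?thesis"
      then have "(\<Sum>x\<in>S \<tau>. wt \<tau> x * (f x)\<^sup>2) = 0" by (intro sum.neutral) auto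
      then show False using f by simp
    qed
    then obtain u where u: "u \<in> S \<tau>" "f u \<noteq> 0" by blast
    have "eigenfunction_on V (mat_mult_on V (Pi_inv d X \<pi> \<tau>) (M \<tau>)) m ?f"
      unfolding eigenfunction_on_def
    proof
      fix x assume x: "x \<in> V"
      show "(\<Sum>y\<in>V. mat_mult_on V (Pi_inv d X \<pi> \<tau>) (M \<tau>) x y * ?f y) = m * ?f x"
      proof (cases "x \<in> S \<tau>")
        case True
        have "(\<Sum>y\<in>V. mat_mult_on V (Pi_inv d X \<pi> \<tau>) (M \<tau>) x y * ?f y)
            = (\<Sum>y\<in>S \<tau>. mat_mult_on V (Pi_inv d X \<pi> \<tau>) (M \<tau>) x y * f y)"
          using finite_V S_subset_V by (rule sum_restrict) simp
        also have "\<dots> = (\<Sum>y\<in>S \<tau>. M \<tau> x y * f y) / wt \<tau> x"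
          using True by (simp add: PiM[OF x] sum_divide_distrib)
        finally show ?thesis using True pos[OF True] by (simp add: eig)
      next
        case False
        then show ?thesis by (simp add: PiM[OF x])
      qed
    qed
    then show ?thesis
      using u S_subset_V[of \<tau>] by (intro spectral_radius_on_ge[OF finite_V, where f = ?f and x = u]) auto
  qed
  finally show ?thesis .
qed

end

subsection \<open>The recursive step\<close>


context weighted
begin

text \<open>By symmetry of \<open>M\<close>, the product is a sum of rank-one matrices built from
  its rows, one for each vertex of the link.\<close>

lemma mat_mult_Pi_inv:
  assumes symM: "symmetric_on V M"
  shows "qform V (mat_mult_on V (mat_mult_on V M (Pi_inv d X \<pi> \<tau>)) M) v
    = (\<Sum>z\<in>S \<tau>. (\<Sum>y\<in>V. M z y * v y)\<^sup>2 / wt \<tau> z)"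
proof -
  have inner: "mat_mult_on V M (Pi_inv d X \<pi> \<tau>) x z = (if z \<in> S \<tau> then M x z / wt \<tau> z else 0)"
    if "z \<in> V" for x z
  proof -
    have "mat_mult_on V M (Pi_inv d X \<pi> \<tau>) x z
        = (\<Sum>u\<in>V. if u = z then (if z \<in> S \<tau> then M x z / wt \<tau> z else 0) else 0)"
      unfolding mat_mult_on_def by (intro sum.cong) (auto simp: Pi_inv_def)
    then show ?thesis using that finite_V by simp
  qed
  have entry: "mat_mult_on V (mat_mult_on V M (Pi_inv d X \<pi> \<tau>)) M x y = (\<Sum>z\<in>S \<tau>. 1 / wt \<tau> z * (M z x * M z y))"
    if "x \<in> V" "y \<in> V" for x y
  proof -
    have "mat_mult_on V (mat_mult_on V M (Pi_inv d X \<pi> \<tau>)) M x y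
        = (\<Sum>z\<in>V. if z \<in> S \<tau> then M x z / wt \<tau> z * M z y else 0)"
      unfolding mat_mult_on_def[of V "mat_mult_on V M (Pi_inv d X \<pi> \<tau>)"]
      by (intro sum.cong) (auto simp: inner)
    also have "\<dots> = (\<Sum>z\<in>S \<tau>. M x z / wt \<tau> z * M z y)"
      using sum_V_eq_sum_S[of \<tau> "\<lambda>z. if z \<in> S \<tau> then M x z / wt \<tau> z * M z y else 0"] by simp
    also have "\<dots> = (\<Sum>z\<in>S \<tau>. 1 / wt \<tau> z * (M z x * M z y))"
      using symM that S_subset_V[of \<tau>] by (intro sum.cong) (auto simp: symmetric_on_def subset_iff)
    finally show ?thesis .
  qed
  have "qform V (mat_mult_on V (mat_mult_on V M (Pi_inv d X \<pi> \<tau>)) M) v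
      = qform V (\<lambda>x y. \<Sum>z\<in>S \<tau>. 1 / wt \<tau> z * (M z x * M z y)) v"
    by (intro qform_cong entry) auto
  then show ?thesis by (simp only: qform_sum qform_scale qform_rank_one) simp
qed

lemma qform_link_expectation:
  "qform V (link_expectation d X \<pi> \<tau> F) v = (\<Sum>x\<in>S \<tau>. wt \<tau> x * qform V (F x) v)"
  unfolding link_expectation_def[abs_def] by (simp only: qform_sum qform_scale)

lemma qform_joint_V_S: "qform V (joint \<tau>) v = qform (S \<tau>) (joint \<tau>) v"
proof -
  have "(\<Sum>y\<in>V. joint \<tau> x y * v y) = (\<Sum>y\<in>S \<tau>. joint \<tau> x y * v y)" for x
    by (rule sum_V_eq_sum_S) (simp add: joint_zero)
  then show ?thesis
    unfolding qform_apply using sum_V_eq_sum_S[of \<tau> "\<lambda>x. v x * (\<Sum>y\<in>S \<tau>. joint \<tau> x y * v y)"]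
    by (simp add: joint_zero)
qed

section \<open>Averaging over the links of the vertices of one face\<close>

context
  fixes \<tau> and M :: "'a set \<Rightarrow> 'a \<Rightarrow> 'a \<Rightarrow> real"
  assumes \<tau>: "\<tau> \<in> X" and cod3: "3 \<le> cod \<tau>"
begin

interpretation S: coupling "S \<tau>" "wt \<tau>" "joint \<tau>"
  using \<tau> cod3 by (intro coupling_S) auto

lemma insert_link:
  assumes "x \<in> S \<tau>"
  shows "insert x \<tau> \<in> X" "cod (insert x \<tau>) = cod \<tau> - 1" "2 \<le> cod (insert x \<tau>)"
  using assms \<tau> cod3 by (auto simp: mem_S cod_insert)

lemma wt_S_pos: "x \<in> S \<tau> \<Longrightarrow> 0 < wt \<tau> x"
  using wt_pos[of \<tau> x] \<tau> cod3 by simp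

lemma average_joint:
  "(\<Sum>x\<in>S \<tau>. wt \<tau> x * qform V (joint (insert x \<tau>)) v) = qform V (joint \<tau>) v"
  by (simp only: qform_scale[symmetric] qform_sum[symmetric] wt_mult_joint_insert[OF \<tau> cod3])

text \<open>The mean of v in the link of x is the value of P v at x, so averaging its square yields
  the squared norm of P v.\<close>

lemma average_mean_square:
  "(\<Sum>x\<in>S \<tau>. wt \<tau> x * (\<Sum>y\<in>V. wt (insert x \<tau>) y * v y)\<^sup>2)
    = (\<Sum>x\<in>S \<tau>. (\<Sum>y\<in>V. joint \<tau> x y * v y)\<^sup>2 / wt \<tau> x)"
proof (rule sum.cong[OF refl])
  fix x assume x: "x \<in> S \<tau>"
  have "(\<Sum>y\<in>V. joint \<tau> x y * v y) = (\<Sum>y\<in>V. wt \<tau> x * (wt (insert x \<tau>) y * v y))"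
    using wt_mult_wt_insert[OF \<tau> _ x] cod3 by (intro sum.cong) auto
  then have "(\<Sum>y\<in>V. joint \<tau> x y * v y) = wt \<tau> x * (\<Sum>y\<in>V. wt (insert x \<tau>) y * v y)"
    by (simp only: sum_distrib_left)
  then show "wt \<tau> x * (\<Sum>y\<in>V. wt (insert x \<tau>) y * v y)\<^sup>2
      = (\<Sum>y\<in>V. joint \<tau> x y * v y)\<^sup>2 / wt \<tau> x"
    using wt_S_pos[OF x] by (simp add: power2_eq_square)
qed

lemma average_square:
  "(\<Sum>x\<in>S \<tau>. wt \<tau> x * (\<Sum>y\<in>V. wt (insert x \<tau>) y * F y)) = (\<Sum>y\<in>V. wt \<tau> y * F y)"
proof -
  have "(\<Sum>x\<in>S \<tau>. wt \<tau> x * (\<Sum>y\<in>V. wt (insert x \<tau>) y * F y))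
      = (\<Sum>x\<in>S \<tau>. \<Sum>y\<in>V. joint \<tau> y x * F y)"
    unfolding sum_distrib_left
    using wt_mult_wt_insert[OF \<tau>] joint_commute[OF \<tau>] cod3
    by (intro sum.cong) (simp_all add: mult.assoc[symmetric])
  also have "\<dots> = (\<Sum>y\<in>V. (\<Sum>x\<in>S \<tau>. joint \<tau> y x) * F y)"
    by (subst sum.swap) (simp only: sum_distrib_right)
  also have "\<dots> = (\<Sum>y\<in>V. wt \<tau> y * F y)"
  proof (rule sum.cong[OF refl])
    fix y
    have "(\<Sum>x\<in>S \<tau>. joint \<tau> y x) = wt \<tau> y"
      using sum_V_eq_sum_S[of \<tau> "joint \<tau> y"] joint_marginal[OF \<tau>, of y] cod3
      by (simp add: joint_zero)
    then show "(\<Sum>x\<in>S \<tau>. joint \<tau> y x) * F y = wt \<tau> y * F y" by simp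
  qed
  finally show ?thesis .
qed

context
  assumes IH: "\<And>x. x \<in> S \<tau> \<Longrightarrow> local_bounds M (insert x \<tau>)"
    and gap1: "lambda2_walk d X \<pi> \<tau> < 1"
begin

text \<open>In each vertex link the deflated form lies below \<open>M\<close>, which lies below
  \<mu> times the weights. This is the local spectral bound that trickle-down needs.\<close>

lemma link_second_eigenvalue:
  assumes "(\<Sum>x\<in>S \<tau>. wt \<tau> x * g x) = 0"
  shows "qform (S \<tau>) (joint \<tau>) g
    \<le> (cod \<tau> - 2) / (2 * (cod \<tau> - 1)) * (\<Sum>x\<in>S \<tau>. wt \<tau> x * (g x)\<^sup>2)"
proof -
  \<comment> \<open>The upper constant of \<open>local_bounds\<close> for codimension one
    less.\<close>
  define \<mu> where "\<mu> = (cod \<tau> - 2) / (3 * cod \<tau> - 4)"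
  have "\<mu> < 1" using cod3 by (simp add: \<mu>_def field_simps)
  have local: "qform (S \<tau>) (joint \<tau>) f
      \<le> (1 - \<mu>) * (\<Sum>x\<in>S \<tau>. (\<Sum>y\<in>S \<tau>. joint \<tau> x y * f y)\<^sup>2 / wt \<tau> x)
        + \<mu> * (\<Sum>x\<in>S \<tau>. wt \<tau> x * (f x)\<^sup>2)" for f
  proof -
    have "qform (S \<tau>) (joint \<tau>) f = (\<Sum>x\<in>S \<tau>. wt \<tau> x * qform V (joint (insert x \<tau>)) f)"
      unfolding average_joint by (rule qform_joint_V_S[symmetric])
    also have "\<dots> \<le> (\<Sum>x\<in>S \<tau>. wt \<tau> x * ((1 - \<mu>) * (\<Sum>y\<in>V. wt (insert x \<tau>) y * f y)\<^sup>2
        + \<mu> * (\<Sum>y\<in>V. wt (insert x \<tau>) y * (f y)\<^sup>2)))"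
    proof (intro sum_mono mult_left_mono)
      fix x assume x: "x \<in> S \<tau>"
      show "0 \<le> wt \<tau> x" using wt_S_pos[OF x] by simp
      interpret x: coupling V "wt (insert x \<tau>)" "joint (insert x \<tau>)"
        using insert_link[OF x] by (intro coupling_V)
      have "qform V (joint (insert x \<tau>)) v
          - cod (insert x \<tau>) / (cod (insert x \<tau>) - 1) * (\<Sum>y\<in>V. wt (insert x \<tau>) y * v y)\<^sup>2
          \<le> \<mu> * (\<Sum>y\<in>V. wt (insert x \<tau>) y * (v y)\<^sup>2)" for v
      proof -
        have "\<mu> = (cod (insert x \<tau>) - 1) / (3 * cod (insert x \<tau>) - 1)"
          unfolding insert_link(2)[OF x] \<mu>_def by (simp add: algebra_simps)
        then show ?thesis using IH[OF x] unfolding local_bounds_def by (meson order_trans)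
      qed
      then show "qform V (joint (insert x \<tau>)) f \<le> (1 - \<mu>) * (\<Sum>y\<in>V. wt (insert x \<tau>) y * f y)\<^sup>2
          + \<mu> * (\<Sum>y\<in>V. wt (insert x \<tau>) y * (f y)\<^sup>2)"
        by (rule x.qform_le_if_deflated_le)
    qed
    also have "\<dots> = (1 - \<mu>) * (\<Sum>x\<in>S \<tau>. wt \<tau> x * (\<Sum>y\<in>V. wt (insert x \<tau>) y * f y)\<^sup>2)
        + \<mu> * (\<Sum>x\<in>S \<tau>. wt \<tau> x * (\<Sum>y\<in>V. wt (insert x \<tau>) y * (f y)\<^sup>2))"
      by (simp only: distrib_left sum.distrib sum_distrib_left mult.left_commute)
    also have "\<dots> = (1 - \<mu>) * (\<Sum>x\<in>S \<tau>. (\<Sum>y\<in>V. joint \<tau> x y * f y)\<^sup>2 / wt \<tau> x)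
        + \<mu> * (\<Sum>y\<in>V. wt \<tau> y * (f y)\<^sup>2)"
      unfolding average_mean_square average_square ..
    also have "(\<lambda>x. \<Sum>y\<in>V. joint \<tau> x y * f y) = (\<lambda>x. \<Sum>y\<in>S \<tau>. joint \<tau> x y * f y)"
      by (intro ext sum_V_eq_sum_S) (simp add: joint_zero)
    also have "(\<Sum>y\<in>V. wt \<tau> y * (f y)\<^sup>2) = (\<Sum>y\<in>S \<tau>. wt \<tau> y * (f y)\<^sup>2)"
      using \<tau> cod3 by (intro sum_V_eq_sum_S) (simp add: wt_zero)
    finally show ?thesis .
  qed
  have "qform (S \<tau>) (joint \<tau>) g \<le> \<mu> / (1 - \<mu>) * (\<Sum>x\<in>S \<tau>. wt \<tau> x * (g x)\<^sup>2)"
    using wt_S_pos \<open>\<mu> < 1\<close> local _ assms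
  proof (rule S.trickle_down)
    show "m < 1" if "(\<Sum>x\<in>S \<tau>. wt \<tau> x * f x) = 0" "(\<Sum>x\<in>S \<tau>. wt \<tau> x * (f x)\<^sup>2) = 1"
      "\<And>x. x \<in> S \<tau> \<Longrightarrow> (\<Sum>y\<in>S \<tau>. joint \<tau> x y * f y) = m * (wt \<tau> x * f x)" for f m
      using walk_eigenvalue_less_1[OF \<tau> _ gap1 that] cod3 by simp
  qed
  also have "\<mu> / (1 - \<mu>) = (cod \<tau> - 2) / (2 * (cod \<tau> - 1))"
  proof -
    have "1 - \<mu> = (2 * (cod \<tau> - 1)) / (3 * cod \<tau> - 4)"
      using cod3 by (simp add: \<mu>_def field_simps)
    then show ?thesis using cod3 by (simp add: \<mu>_def)
  qed
  finally show ?thesis .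
qed

lemma local_bounds_step:
  assumes symM: "symmetric_on V (M \<tau>)"
    and upper: "\<And>v. qform V (M \<tau>) v \<le> (cod \<tau> - 1) / (3 * cod \<tau> - 1) * (\<Sum>x\<in>V. wt \<tau> x * (v x)\<^sup>2)"
    and rec: "\<And>v. (\<Sum>x\<in>S \<tau>. wt \<tau> x * qform V (M (insert x \<tau>)) v)
      \<le> qform V (M \<tau>) v - (cod \<tau> - 1) / (cod \<tau> - 2) * (\<Sum>z\<in>S \<tau>. (\<Sum>y\<in>V. M \<tau> z y * v y)\<^sup>2 / wt \<tau> z)"
  shows "local_bounds M \<tau>"
proof -
  \<comment> \<open>c is at once the factor in the recursive condition and the deflation constant of
    \<open>local_bounds\<close> in the vertex links; therefore the averaged lower bounds fit the
    recursive condition.\<close>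
  define c where "c = (cod \<tau> - 1) / (cod \<tau> - 2)"
  define \<kappa> where "\<kappa> = cod \<tau> / (cod \<tau> - 1)"
  have c: "0 < c" "\<kappa> = 2 - 1 / c" "1 \<le> \<kappa>" "1 / (2 * c) = (cod \<tau> - 2) / (2 * (cod \<tau> - 1))"
    using cod3 by (simp_all add: c_def \<kappa>_def field_simps)
  have main: "qform V (joint \<tau>) v - c * (\<Sum>x\<in>S \<tau>. (\<Sum>y\<in>V. joint \<tau> x y * v y)\<^sup>2 / wt \<tau> x)
      \<le> qform V (M \<tau>) v - c * (\<Sum>x\<in>S \<tau>. (\<Sum>y\<in>V. M \<tau> x y * v y)\<^sup>2 / wt \<tau> x)" for v
  proof -
    have "qform V (joint \<tau>) v - c * (\<Sum>x\<in>S \<tau>. (\<Sum>y\<in>V. joint \<tau> x y * v y)\<^sup>2 / wt \<tau> x)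
        = (\<Sum>x\<in>S \<tau>. wt \<tau> x * (qform V (joint (insert x \<tau>)) v
          - c * (\<Sum>y\<in>V. wt (insert x \<tau>) y * v y)\<^sup>2))"
      unfolding average_joint[symmetric] average_mean_square[symmetric]
      by (simp only: right_diff_distrib sum_subtractf sum_distrib_left mult.left_commute)
    also have "\<dots> \<le> (\<Sum>x\<in>S \<tau>. wt \<tau> x * qform V (M (insert x \<tau>)) v)"
    proof (intro sum_mono mult_left_mono)
      fix x assume x: "x \<in> S \<tau>"
      show "0 \<le> wt \<tau> x" using wt_S_pos[OF x] by simp
      have "c = cod (insert x \<tau>) / (cod (insert x \<tau>) - 1)"
        by (simp add: insert_link(2)[OF x] c_def)
      then show "qform V (joint (insert x \<tau>)) v - c * (\<Sum>y\<in>V. wt (insert x \<tau>) y * v y)\<^sup>2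
          \<le> qform V (M (insert x \<tau>)) v"
        using IH[OF x] unfolding local_bounds_def by simp
    qed
    also note rec[of v]
    finally show ?thesis by (simp only: c_def)
  qed
  have upper_S: "qform (S \<tau>) (M \<tau>) v \<le> 1 / (2 * c) * (\<Sum>x\<in>S \<tau>. wt \<tau> x * (v x)\<^sup>2)" for v
  proof -
    let ?v = "\<lambda>x. if x \<in> S \<tau> then v x else 0"
    have "qform (S \<tau>) (M \<tau>) v = qform V (M \<tau>) ?v"
      by (rule qform_restrict[OF finite_V S_subset_V, symmetric])
    also have "\<dots> \<le> (cod \<tau> - 1) / (3 * cod \<tau> - 1) * (\<Sum>x\<in>V. wt \<tau> x * (?v x)\<^sup>2)" by (rule upper)
    also have "(\<Sum>x\<in>V. wt \<tau> x * (?v x)\<^sup>2) = (\<Sum>x\<in>S \<tau>. wt \<tau> x * (v x)\<^sup>2)"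
      using finite_V S_subset_V by (rule sum_restrict) simp
    also have "(cod \<tau> - 1) / (3 * cod \<tau> - 1) * (\<Sum>x\<in>S \<tau>. wt \<tau> x * (v x)\<^sup>2)
        \<le> 1 / (2 * c) * (\<Sum>x\<in>S \<tau>. wt \<tau> x * (v x)\<^sup>2)"
    proof (rule mult_right_mono)
      \<comment> \<open>The assumed upper constant stays below the threshold 1/(2c), with equality
        exactly at k = 3.\<close>
      have "(k - 2) / (2 * (k - 1)) - (k - 1) / (3 * k - 1) = k * (k - 3) / (2 * (k - 1) * (3 * k - 1))"
        if "3 \<le> k" for k :: real using that by (simp add: field_simps)
      moreover have "0 \<le> cod \<tau> * (cod \<tau> - 3) / (2 * (cod \<tau> - 1) * (3 * cod \<tau> - 1))"
        using cod3 by (intro divide_nonneg_nonneg mult_nonneg_nonneg) auto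
      ultimately show "(cod \<tau> - 1) / (3 * cod \<tau> - 1) \<le> 1 / (2 * c)"
        unfolding c(4) using cod3 by (smt (verit))
      show "0 \<le> (\<Sum>x\<in>S \<tau>. wt \<tau> x * (v x)\<^sup>2)" using S.nonneg by (intro sum_nonneg) auto
    qed
    finally show ?thesis .
  qed
  have lower_S: "qform (S \<tau>) (joint \<tau>) v - \<kappa> * (\<Sum>x\<in>S \<tau>. wt \<tau> x * v x)\<^sup>2 \<le> qform (S \<tau>) (M \<tau>) v" for v
  proof (rule S.matrix_trickle_down[OF wt_S_pos _ c(1-3) _ upper_S])
    show "symmetric_on (S \<tau>) (M \<tau>)"
      using symM S_subset_V[of \<tau>] by (auto simp: symmetric_on_def)
    show "qform (S \<tau>) (joint \<tau>) g \<le> 1 / (2 * c) * (\<Sum>x\<in>S \<tau>. wt \<tau> x * (g x)\<^sup>2)"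
      if "(\<Sum>x\<in>S \<tau>. wt \<tau> x * g x) = 0" for g
      unfolding c(4) by (rule link_second_eigenvalue[OF that])
    fix v :: "'a \<Rightarrow> real"
    let ?v = "\<lambda>x. if x \<in> S \<tau> then v x else 0"
    have "(\<Sum>y\<in>V. A x y * ?v y) = (\<Sum>y\<in>S \<tau>. A x y * v y)" for A :: "'a \<Rightarrow> 'a \<Rightarrow> real" and x
      using finite_V S_subset_V by (rule sum_restrict) simp
    then show "qform (S \<tau>) (joint \<tau>) v - c * (\<Sum>x\<in>S \<tau>. (\<Sum>y\<in>S \<tau>. joint \<tau> x y * v y)\<^sup>2 / wt \<tau> x)
        \<le> qform (S \<tau>) (M \<tau>) v - c * (\<Sum>x\<in>S \<tau>. (\<Sum>y\<in>S \<tau>. M \<tau> x y * v y)\<^sup>2 / wt \<tau> x)"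
      using main[of ?v] by (simp only: qform_restrict[OF finite_V S_subset_V])
  qed
  have "qform V (joint \<tau>) v - \<kappa> * (\<Sum>x\<in>V. wt \<tau> x * v x)\<^sup>2 \<le> qform V (M \<tau>) v" for v
  proof -
    \<comment> \<open>At a vector supported off the link the recursive condition and the upper bound force \<open>M \<tau>\<close> to vanish.\<close>
    define v0 where "v0 x = (if x \<in> S \<tau> then 0 else v x)" for x
    let ?v = "\<lambda>x. if x \<in> S \<tau> then v x else 0"
    have 2: "(\<Sum>y\<in>V. joint \<tau> x y * v0 y) = 0" for x
      by (intro sum.neutral) (auto simp: v0_def joint_zero)
    have 1: "qform V (joint \<tau>) v0 = 0" by (simp add: qform_apply 2)
    have "(\<Sum>x\<in>V. wt \<tau> x * (v0 x)\<^sup>2) = 0"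
      using \<tau> cod3 by (intro sum.neutral) (auto simp: v0_def wt_zero)
    then have 3: "qform V (M \<tau>) v0 \<le> 0" using upper[of v0] by simp
    let ?sq = "\<Sum>x\<in>S \<tau>. (\<Sum>y\<in>V. M \<tau> x y * v0 y)\<^sup>2 / wt \<tau> x"
    have nn: "0 \<le> (\<Sum>y\<in>V. M \<tau> x y * v0 y)\<^sup>2 / wt \<tau> x" if "x \<in> S \<tau>" for x
      using wt_S_pos[OF that] by simp
    then have "0 \<le> ?sq" by (rule sum_nonneg)
    \<comment> \<open>The value of \<open>M \<tau>\<close> at \<open>v0\<close> is squeezed between
      c times a sum of squares and 0. So both vanish, and the vanishing squares remove the cross
      terms between \<open>v0\<close> and functions on the link.\<close>
    have "c * ?sq \<le> qform V (M \<tau>) v0" using main[of v0] by (simp add: 1 2)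
    moreover have "0 \<le> c * ?sq" using \<open>0 \<le> ?sq\<close> c(1) by simp
    ultimately have "qform V (M \<tau>) v0 = 0" "c * ?sq = 0" using 3 by linarith+
    then have "?sq = 0" using c(1) by simp
    then have sq0: "\<forall>x\<in>S \<tau>. (\<Sum>y\<in>V. M \<tau> x y * v0 y)\<^sup>2 / wt \<tau> x = 0"
      by (subst (asm) sum_nonneg_eq_0_iff) (use finite_S nn in auto)
    have M0: "(\<Sum>y\<in>V. M \<tau> x y * v0 y) = 0" if "x \<in> S \<tau>" for x
      using sq0 that wt_S_pos[OF that] by fastforce
    have "qform V (M \<tau>) v = qform V (M \<tau>) (\<lambda>x. v0 x + 1 * ?v x)"
      by (intro qform_cong) (auto simp: v0_def)
    also have "\<dots> = qform V (M \<tau>) v0 + 2 * 1 * (\<Sum>x\<in>V. ?v x * (\<Sum>y\<in>V. M \<tau> x y * v0 y))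
        + 1\<^sup>2 * qform V (M \<tau>) ?v" by (rule qform_add[OF symM])
    also have "(\<Sum>x\<in>V. ?v x * (\<Sum>y\<in>V. M \<tau> x y * v0 y)) = 0"
      by (intro sum.neutral) (auto simp: M0)
    also have "qform V (M \<tau>) ?v = qform (S \<tau>) (M \<tau>) v"
      by (rule qform_restrict[OF finite_V S_subset_V])
    finally have "qform V (M \<tau>) v = qform (S \<tau>) (M \<tau>) v"
      using \<open>qform V (M \<tau>) v0 = 0\<close> by simp
    moreover have "(\<Sum>x\<in>V. wt \<tau> x * v x) = (\<Sum>x\<in>S \<tau>. wt \<tau> x * v x)"
      using \<tau> cod3 by (intro sum_V_eq_sum_S) (simp add: wt_zero)
    ultimately show ?thesis using lower_S[of v] by (simp only: qform_joint_V_S)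
  qed
  then show ?thesis using upper by (simp add: local_bounds_def \<kappa>_def)
qed

end

end

end

subsection \<open>Product links\<close>


lemma qform_block:
  assumes "finite V" "W \<subseteq> V"
  shows "qform V (\<lambda>x y. if x \<in> W \<and> y \<in> W then A x y else 0) v = qform W A v"
proof -
  have "qform V (\<lambda>x y. if x \<in> W \<and> y \<in> W then A x y else 0) v
      = qform V A (\<lambda>x. if x \<in> W then v x else 0)"
    unfolding qform_def by (intro sum.cong refl) auto
  then show ?thesis using qform_restrict[OF assms] by simp
qed

context weighted
begin

lemma up_empty: "up {} = 1"
  by (simp add: up_def)

lemma up_facet: "\<sigma> \<in> facets X \<Longrightarrow> up \<sigma> = pmf \<pi> \<sigma>"
proof -
  assume \<sigma>: "\<sigma> \<in> facets X"
  have "up \<sigma> = (\<Sum>\<sigma>'\<in>facets X. if \<sigma>' = \<sigma> then pmf \<pi> \<sigma> else 0)"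
    unfolding up_eq using \<sigma> by (intro sum.cong) (auto simp: facets_def)
  then show ?thesis using \<sigma> finite_facets by simp
qed

lemma Union_eq_V: "\<Union>X = V"
  using mem_V by (auto simp: vertices_def)

lemma mem_link: "\<eta> \<in> link X \<tau> \<longleftrightarrow> \<eta> \<inter> \<tau> = {} \<and> \<tau> \<union> \<eta> \<in> X"
proof
  assume "\<eta> \<in> link X \<tau>"
  then obtain \<sigma> where "\<eta> = \<sigma> - \<tau>" "\<sigma> \<in> X" "\<tau> \<subseteq> \<sigma>" by (auto simp: link_def)
  moreover from this have "\<tau> \<union> \<eta> = \<sigma>" by auto
  ultimately show "\<eta> \<inter> \<tau> = {} \<and> \<tau> \<union> \<eta> \<in> X" by auto
next
  assume "\<eta> \<inter> \<tau> = {} \<and> \<tau> \<union> \<eta> \<in> X"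
  then show "\<eta> \<in> link X \<tau>"
    unfolding link_def by (auto intro!: exI[of _ "\<tau> \<union> \<eta>"])
qed

lemma mem_facets_link: "\<eta> \<in> facets (link X \<tau>) \<longleftrightarrow> \<eta> \<inter> \<tau> = {} \<and> \<tau> \<union> \<eta> \<in> facets X"
proof
  assume \<eta>: "\<eta> \<in> facets (link X \<tau>)"
  then have 1: "\<eta> \<inter> \<tau> = {}" "\<tau> \<union> \<eta> \<in> X" by (auto simp: facets_def mem_link)
  have "\<sigma> = \<tau> \<union> \<eta>" if \<sigma>: "\<sigma> \<in> X" "\<tau> \<union> \<eta> \<subseteq> \<sigma>" for \<sigma>
  proof -
    have "\<tau> \<union> (\<sigma> - \<tau>) = \<sigma>" using \<sigma> by auto
    then have "\<sigma> - \<tau> \<in> link X \<tau>" using \<sigma> by (auto simp: mem_link)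
    moreover have "\<eta> \<subseteq> \<sigma> - \<tau>" using \<sigma> 1 by auto
    ultimately have "\<sigma> - \<tau> = \<eta>" using \<eta> unfolding facets_def by blast
    then show ?thesis using \<sigma> by auto
  qed
  then show "\<eta> \<inter> \<tau> = {} \<and> \<tau> \<union> \<eta> \<in> facets X" using 1 unfolding facets_def by blast
next
  assume \<eta>: "\<eta> \<inter> \<tau> = {} \<and> \<tau> \<union> \<eta> \<in> facets X"
  have "\<eta>' = \<eta>" if "\<eta>' \<in> link X \<tau>" "\<eta> \<subseteq> \<eta>'" for \<eta>'
  proof -
    have "\<tau> \<union> \<eta>' \<in> X" "\<eta>' \<inter> \<tau> = {}" using that by (auto simp: mem_link)
    moreover have "\<tau> \<union> \<eta> \<subseteq> \<tau> \<union> \<eta>'" using that by auto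
    ultimately have "\<tau> \<union> \<eta>' = \<tau> \<union> \<eta>" using \<eta> unfolding facets_def by blast
    then show ?thesis using \<eta> \<open>\<eta>' \<inter> \<tau> = {}\<close> by blast
  qed
  moreover have "\<eta> \<in> link X \<tau>" using \<eta> by (simp add: mem_link facets_def)
  ultimately show "\<eta> \<in> facets (link X \<tau>)" unfolding facets_def by blast
qed

end

section \<open>A link that is a product\<close>

locale product_link = weighted d X \<pi>
  for d :: nat and X :: "'a set set" and \<pi> :: "'a set pmf" +
  fixes \<tau> :: "'a set" and k t :: nat and e :: "nat \<Rightarrow> nat" and Y :: "nat \<Rightarrow> 'a set set"
    and \<mu> :: "nat \<Rightarrow> 'a set pmf"
  assumes \<tau>: "\<tau> \<in> X" and cod: "codim d \<tau> = int k" and k3: "3 \<le> k"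
    and prod: "is_product (link X \<tau>) (link_weight d X \<pi> \<tau> (int k - 1)) t e Y \<mu>"
begin

abbreviation W :: "nat \<Rightarrow> 'a set" where "W i \<equiv> vertices (Y i)"

abbreviation p :: "nat \<Rightarrow> 'a set \<Rightarrow> real" where "p i \<equiv> weighted.up (\<mu> i)"

lemma factor: "i \<in> {1..t} \<Longrightarrow> weighted (e i) (Y i) (\<mu> i)"
  using prod by (auto simp: is_product_def weighted_def)

lemma W_disjoint:
  assumes "i \<in> {1..t}" "j \<in> {1..t}" "i \<noteq> j"
  shows "W i \<inter> W j = {}"
proof -
  have "disjoint_family_on (\<lambda>i. \<Union>(Y i)) {1..t}" using prod by (simp add: is_product_def)
  then have "\<Union>(Y i) \<inter> \<Union>(Y j) = {}" using assms by (rule disjoint_family_onD)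
  then show ?thesis
    unfolding weighted.Union_eq_V[OF factor[OF assms(1)]] weighted.Union_eq_V[OF factor[OF assms(2)]] .
qed

lemma factor_facet_subset:
  assumes "i \<in> {1..t}" "F \<in> facets (Y i)"
  shows "F \<subseteq> W i"
proof -
  have "F \<in> Y i" using assms(2) by (simp add: facets_def)
  then show ?thesis using weighted.mem_V[OF factor[OF assms(1)]] by blast
qed

text \<open>Extensional choice functions make the union map injective, so sums over facets become
  sums over a product of finite sets.\<close>

lemma facets_link_product:
  "facets (link X \<tau>) = (\<lambda>F. \<Union>i\<in>{1..t}. F i) ` (\<Pi>\<^sub>E i\<in>{1..t}. facets (Y i))"
proof -
  have "facets (link X \<tau>) = {\<Union>i\<in>{1..t}. F i | F. \<forall>i\<in>{1..t}. F i \<in> facets (Y i)}"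
    using prod by (simp add: is_product_def)
  also have "\<dots> = (\<lambda>F. \<Union>i\<in>{1..t}. F i) ` (\<Pi>\<^sub>E i\<in>{1..t}. facets (Y i))"
  proof (intro equalityI subsetI)
    fix \<eta> assume "\<eta> \<in> {\<Union>i\<in>{1..t}. F i | F. \<forall>i\<in>{1..t}. F i \<in> facets (Y i)}"
    then obtain F where F: "\<eta> = (\<Union>i\<in>{1..t}. F i)" "\<forall>i\<in>{1..t}. F i \<in> facets (Y i)" by auto
    then have "\<eta> = (\<Union>i\<in>{1..t}. restrict F {1..t} i)" by simp
    moreover have "restrict F {1..t} \<in> (\<Pi>\<^sub>E i\<in>{1..t}. facets (Y i))" using F by auto
    ultimately show "\<eta> \<in> (\<lambda>F. \<Union>i\<in>{1..t}. F i) ` (\<Pi>\<^sub>E i\<in>{1..t}. facets (Y i))"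
      by (rule image_eqI)
  qed (auto simp: PiE_iff)
  finally show ?thesis .
qed

lemma Union_Int_W:
  assumes "\<And>i. i \<in> {1..t} \<Longrightarrow> F i \<subseteq> W i" "i \<in> {1..t}"
  shows "(\<Union>i\<in>{1..t}. F i) \<inter> W i = F i"
proof (intro equalityI subsetI)
  fix x assume "x \<in> (\<Union>i\<in>{1..t}. F i) \<inter> W i"
  then obtain j where j: "j \<in> {1..t}" "x \<in> F j" "x \<in> W i" by auto
  then have "x \<in> W j" using assms by blast
  then show "x \<in> F i" using W_disjoint[OF j(1) assms(2)] j by (cases "i = j") auto
qed (use assms in auto)

lemma ex_facets:
  obtains F where "F \<in> (\<Pi>\<^sub>E i\<in>{1..t}. facets (Y i))"
proof -
  have "facets (Y i) \<noteq> {}" if "i \<in> {1..t}" for i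
    using set_pmf_not_empty[of "\<mu> i"] unfolding weighted.set_pmf[OF factor[OF that]] .
  then have "(\<Pi>\<^sub>E i\<in>{1..t}. facets (Y i)) \<noteq> {}" by (simp add: PiE_eq_empty_iff)
  then obtain F where "F \<in> (\<Pi>\<^sub>E i\<in>{1..t}. facets (Y i))" by blast
  then show ?thesis by (rule that)
qed

lemma link_facet:
  assumes "F \<in> (\<Pi>\<^sub>E i\<in>{1..t}. facets (Y i))"
  shows "\<tau> \<union> (\<Union>i\<in>{1..t}. F i) \<in> facets X" "(\<Union>i\<in>{1..t}. F i) \<inter> \<tau> = {}"
    "(\<Union>i\<in>{1..t}. F i) \<in> faces (link X \<tau>) (int k - 1)"
proof -
  let ?\<eta> = "\<Union>i\<in>{1..t}. F i"
  have "?\<eta> \<in> facets (link X \<tau>)" using assms unfolding facets_link_product by auto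
  then show \<eta>: "\<tau> \<union> ?\<eta> \<in> facets X" "?\<eta> \<inter> \<tau> = {}" by (simp_all only: mem_facets_link)
  then have "finite (\<tau> \<union> ?\<eta>)" using facet_mem finite_face by blast
  then have "card (\<tau> \<union> ?\<eta>) = card \<tau> + card ?\<eta>"
    using \<eta>(2) by (intro card_Un_disjoint) auto
  then have "int (card ?\<eta>) = int k"
    using facet_card[OF \<eta>(1)] cod by (simp add: codim_def face_dim_def)
  then show "?\<eta> \<in> faces (link X \<tau>) (int k - 1)"
    using \<eta> facet_mem by (simp only: faces_def face_dim_def mem_link mem_Collect_eq)
qed

lemma pmf_link_facet:
  assumes "F \<in> (\<Pi>\<^sub>E i\<in>{1..t}. facets (Y i))"
  shows "pmf \<pi> (\<tau> \<union> (\<Union>i\<in>{1..t}. F i)) = up \<tau> * (\<Prod>i\<in>{1..t}. pmf (\<mu> i) (F i))"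
proof -
  let ?\<eta> = "\<Union>i\<in>{1..t}. F i"
  \<comment> \<open>In top dimension k-1 the binomial coefficient is 1, leaving the plain
    conditional probability of the facet.\<close>
  have "link_weight d X \<pi> \<tau> (int k - 1) ?\<eta> = up (\<tau> \<union> (\<tau> \<union> ?\<eta>)) / up \<tau>"
    using link_facet(3)[OF assms] cod unfolding link_weight_def cond_prob_up by simp
  also have "up (\<tau> \<union> (\<tau> \<union> ?\<eta>)) = pmf \<pi> (\<tau> \<union> ?\<eta>)"
    using up_facet[OF link_facet(1)[OF assms]] by (simp add: Un_assoc[symmetric])
  finally have "pmf \<pi> (\<tau> \<union> ?\<eta>) = up \<tau> * link_weight d X \<pi> \<tau> (int k - 1) ?\<eta>"
    using up_pos[of \<tau>] \<tau> by simp
  also have "link_weight d X \<pi> \<tau> (int k - 1) ?\<eta> = (\<Prod>i\<in>{1..t}. pmf (\<mu> i) (F i))"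
    using prod assms by (auto simp: is_product_def PiE_iff)
  finally show ?thesis .
qed

text \<open>Facets of the link avoid \<tau>, and x lies in one: exchange the i-th component of any
  facet for a facet of \<open>Y i\<close> containing x.\<close>

lemma W_not_in:
  assumes i: "i \<in> {1..t}" "x \<in> W i"
  shows "x \<notin> \<tau>"
proof -
  obtain F where F: "F \<in> (\<Pi>\<^sub>E i\<in>{1..t}. facets (Y i))" by (rule ex_facets)
  obtain G where G: "G \<in> facets (Y i)" "x \<in> G"
    using weighted.facet_above[OF factor[OF i(1)], of "{x}"] i(2) by (auto simp: vertices_def)
  have "F(i := G) \<in> (\<Pi>\<^sub>E i\<in>{1..t}. facets (Y i))"
    using F G i by (auto simp: PiE_iff extensional_def)
  then have "(\<Union>j\<in>{1..t}. (F(i := G)) j) \<inter> \<tau> = {}" by (rule link_facet(2))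
  moreover have "x \<in> (\<Union>j\<in>{1..t}. (F(i := G)) j)" using G i by force
  ultimately show ?thesis by blast
qed

text \<open>Independence of the factors. The sum over facets above \<tau> runs over choice functions
  with a summand that factorises, so it is a product of sums.\<close>

lemma up_product:
  assumes Z: "\<And>i. i \<in> {1..t} \<Longrightarrow> Z i \<subseteq> W i"
  shows "up (\<tau> \<union> (\<Union>i\<in>{1..t}. Z i)) = up \<tau> * (\<Prod>i\<in>{1..t}. p i (Z i))"
proof -
  let ?P = "\<Pi>\<^sub>E i\<in>{1..t}. facets (Y i)" and ?U = "\<lambda>F. \<Union>i\<in>{1..t}. F i"
  have sub: "F i \<subseteq> W i" if "F \<in> ?P" "i \<in> {1..t}" for F i
    using that factor_facet_subset by blast
  have inj: "inj_on (\<lambda>F. \<tau> \<union> ?U F) ?P"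
  proof (rule inj_onI)
    fix F G assume FG: "F \<in> ?P" "G \<in> ?P" "\<tau> \<union> ?U F = \<tau> \<union> ?U G"
    have cancel: "A = B" if "A \<inter> \<tau> = {}" "B \<inter> \<tau> = {}" "\<tau> \<union> A = \<tau> \<union> B" for A B
      using that by blast
    have UFG: "?U F = ?U G"
      by (rule cancel[OF link_facet(2)[OF FG(1)] link_facet(2)[OF FG(2)] FG(3)])
    show "F = G"
    proof (rule PiE_ext[OF FG(1,2)])
      fix i assume i: "i \<in> {1..t}"
      have "?U F \<inter> W i = F i" using FG(1) i by (intro Union_Int_W sub)
      moreover have "?U G \<inter> W i = G i" using FG(2) i by (intro Union_Int_W sub)
      ultimately show "F i = G i" using UFG by simp
    qed
  qed
  have range: "(\<lambda>F. \<tau> \<union> ?U F) ` ?P = {\<sigma> \<in> facets X. \<tau> \<subseteq> \<sigma>}"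
  proof (intro equalityI subsetI)
    fix \<sigma> assume "\<sigma> \<in> (\<lambda>F. \<tau> \<union> ?U F) ` ?P"
    then obtain \<eta> where "\<eta> \<in> facets (link X \<tau>)" "\<sigma> = \<tau> \<union> \<eta>"
      unfolding facets_link_product by auto
    then show "\<sigma> \<in> {\<sigma> \<in> facets X. \<tau> \<subseteq> \<sigma>}" by (simp add: mem_facets_link)
  next
    fix \<sigma> assume \<sigma>: "\<sigma> \<in> {\<sigma> \<in> facets X. \<tau> \<subseteq> \<sigma>}"
    then have "\<tau> \<union> (\<sigma> - \<tau>) = \<sigma>" by auto
    then have "\<sigma> - \<tau> \<in> facets (link X \<tau>)" using \<sigma> by (auto simp: mem_facets_link)
    then obtain F where "F \<in> ?P" "\<sigma> - \<tau> = ?U F" unfolding facets_link_product by auto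
    then show "\<sigma> \<in> (\<lambda>F. \<tau> \<union> ?U F) ` ?P"
      using \<open>\<tau> \<union> (\<sigma> - \<tau>) = \<sigma>\<close> by (metis image_eqI)
  qed
  have "up (\<tau> \<union> ?U Z) = (\<Sum>\<sigma>\<in>{\<sigma> \<in> facets X. \<tau> \<subseteq> \<sigma>}. if ?U Z \<subseteq> \<sigma> then pmf \<pi> \<sigma> else 0)"
    unfolding up_eq using finite_facets by (intro sum.mono_neutral_cong_right) auto
  also have "\<dots> = (\<Sum>F\<in>?P. if ?U Z \<subseteq> \<tau> \<union> ?U F then pmf \<pi> (\<tau> \<union> ?U F) else 0)"
    unfolding range[symmetric] by (simp only: sum.reindex[OF inj] comp_def)
  also have "\<dots> = (\<Sum>F\<in>?P. up \<tau> * (\<Prod>i\<in>{1..t}. if Z i \<subseteq> F i then pmf (\<mu> i) (F i) else 0))"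
  proof (rule sum.cong[OF refl])
    fix F assume F: "F \<in> ?P"
    show "(if ?U Z \<subseteq> \<tau> \<union> ?U F then pmf \<pi> (\<tau> \<union> ?U F) else 0)
        = up \<tau> * (\<Prod>i\<in>{1..t}. if Z i \<subseteq> F i then pmf (\<mu> i) (F i) else 0)"
    proof (cases "\<forall>i\<in>{1..t}. Z i \<subseteq> F i")
      case True
      then have "?U Z \<subseteq> \<tau> \<union> ?U F" by (intro le_supI2 UN_mono) auto
      moreover have "(\<Prod>i\<in>{1..t}. if Z i \<subseteq> F i then pmf (\<mu> i) (F i) else 0)
          = (\<Prod>i\<in>{1..t}. pmf (\<mu> i) (F i))"
        using True by (intro prod.cong) auto
      ultimately show ?thesis using pmf_link_facet[OF F] by simp
    next
      \<comment> \<open>A vertex of \<open>Z i\<close> missing from \<open>F i\<close> lies neither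
        in \<tau> nor in another component, so both sides are 0.\<close>
      case False
      then obtain i where i: "i \<in> {1..t}" "\<not> Z i \<subseteq> F i" by blast
      then obtain x where x: "x \<in> Z i" "x \<notin> F i" by blast
      have "x \<in> W i" using x Z i by blast
      then have "x \<notin> \<tau>" by (rule W_not_in[OF i(1)])
      moreover have "?U F \<inter> W i = F i" using F i(1) by (intro Union_Int_W sub)
      then have "x \<notin> ?U F" using x \<open>x \<in> W i\<close> by blast
      moreover have "x \<in> ?U Z" using x(1) i(1) by (rule UN_I[rotated])
      ultimately have "\<not> ?U Z \<subseteq> \<tau> \<union> ?U F" by blast
      moreover have "(\<Prod>i\<in>{1..t}. if Z i \<subseteq> F i then pmf (\<mu> i) (F i) else 0) = 0"
        using i by (intro prod_zero) auto
      ultimately show ?thesis by simp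
    qed
  qed
  also have "\<dots> = up \<tau> * (\<Prod>i\<in>{1..t}. \<Sum>F\<in>facets (Y i). if Z i \<subseteq> F then pmf (\<mu> i) F else 0)"
    unfolding sum_distrib_left[symmetric]
    using weighted.finite_facets[OF factor] by (subst prod_sum_PiE) auto
  also have "\<dots> = up \<tau> * (\<Prod>i\<in>{1..t}. p i (Z i))"
    using weighted.up_eq[OF factor] by (intro arg_cong2[where f = "(*)"] prod.cong refl) auto
  finally show ?thesis .
qed

lemma p_empty: "i \<in> {1..t} \<Longrightarrow> p i {} = 1"
  by (rule weighted.up_empty[OF factor])

lemma prod_other:
  assumes "i \<in> {1..t}" "\<And>j. j \<in> {1..t} \<Longrightarrow> j \<noteq> i \<Longrightarrow> Z j = 1"
  shows "(\<Prod>j\<in>{1..t}. Z j) = (Z i :: real)"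
  using assms prod.remove[of "{1..t}" i Z] by simp

lemma up_same:
  assumes i: "i \<in> {1..t}" and A: "A \<subseteq> W i"
  shows "up (\<tau> \<union> A) = up \<tau> * p i A"
proof -
  let ?Z = "\<lambda>j. if j = i then A else {}"
  have "(\<Union>j\<in>{1..t}. ?Z j) = A" using i by auto
  then have "up (\<tau> \<union> A) = up \<tau> * (\<Prod>j\<in>{1..t}. p j (?Z j))"
    using up_product[of ?Z] A by auto
  also have "(\<Prod>j\<in>{1..t}. p j (?Z j)) = p i A"
    using prod_other[OF i, of "\<lambda>j. p j (?Z j)"] by (simp add: p_empty)
  finally show ?thesis .
qed

lemma up_different:
  assumes ij: "i \<in> {1..t}" "j \<in> {1..t}" "i \<noteq> j" and xy: "x \<in> W i" "y \<in> W j"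
  shows "up (\<tau> \<union> {x, y}) = up \<tau> * (p i {x} * p j {y})"
proof -
  let ?Z = "\<lambda>l. if l = i then {x} else if l = j then {y} else {}"
  have "(\<Union>l\<in>{1..t}. ?Z l) = {x, y}" using ij by auto
  then have "up (\<tau> \<union> {x, y}) = up \<tau> * (\<Prod>l\<in>{1..t}. p l (?Z l))"
    using up_product[of ?Z] xy by auto
  also have "(\<Prod>l\<in>{1..t}. p l (?Z l)) = (\<Prod>l\<in>{i, j}. p l (?Z l))"
    using ij by (intro prod.mono_neutral_right) (auto simp: p_empty)
  finally show ?thesis using ij(3) by auto
qed

lemma S_covered:
  assumes "x \<in> S \<tau>"
  obtains i where "i \<in> {1..t}" "x \<in> W i"
proof -
  have "insert x \<tau> \<in> X" "x \<notin> \<tau>" using assms by (auto simp: mem_S)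
  then obtain \<sigma> where \<sigma>: "\<sigma> \<in> facets X" "insert x \<tau> \<subseteq> \<sigma>" using facet_above by blast
  then have "\<tau> \<union> (\<sigma> - \<tau>) = \<sigma>" by auto
  then have "\<sigma> - \<tau> \<in> facets (link X \<tau>)" using \<sigma> by (auto simp: mem_facets_link)
  then obtain F where F: "F \<in> (\<Pi>\<^sub>E i\<in>{1..t}. facets (Y i))" "\<sigma> - \<tau> = (\<Union>i\<in>{1..t}. F i)"
    unfolding facets_link_product by auto
  then obtain i where "i \<in> {1..t}" "x \<in> F i" using \<sigma> \<open>x \<notin> \<tau>\<close> by blast
  then show ?thesis using that F factor_facet_subset by blast
qed

lemma W_subset_V:
  assumes "i \<in> {1..t}"
  shows "W i \<subseteq> V"
proof
  fix x assume x: "x \<in> W i"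
  have "0 < p i {x}"
    using weighted.up_pos[OF factor[OF assms]] x by (simp add: vertices_def)
  then have "0 < up (insert x \<tau>)"
    using up_same[OF assms, of "{x}"] x up_pos[of \<tau>] \<tau> by simp
  then show "x \<in> V" using up_pos mem_V by blast
qed

end

subsection \<open>The product step\<close>


context product_link
begin

abbreviation "coef \<equiv> real k * (real k - 1)"

text \<open>The covariance matrix of the vertex indicators of factor i, minus the diagonal matrix of
  their means. It is the deflated walk form of the factor up to a scalar, and so links the blocks at
  \<tau> with those at \<open>\<sigma> i\<close>.\<close>

definition cov :: "nat \<Rightarrow> 'a \<Rightarrow> 'a \<Rightarrow> real" where
  "cov i x y = (if x = y then 0 else p i {x, y}) - p i {x} * p i {y}"

lemma cod_real: "cod \<tau> = real k"
  by (simp add: cod)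

lemma wt_link:
  assumes "i \<in> {1..t}" "x \<in> W i"
  shows "wt \<tau> x = p i {x} / real k"
  using assms up_same[OF assms(1), of "{x}"] up_pos[of \<tau>] \<tau> k3 W_not_in[OF assms]
  by (simp add: wt_eq cod_real)

lemma wt_uncovered:
  assumes "\<And>i. i \<in> {1..t} \<Longrightarrow> x \<notin> W i"
  shows "x \<notin> S \<tau>" "wt \<tau> x = 0"
proof -
  show "x \<notin> S \<tau>" using assms S_covered by metis
  then show "wt \<tau> x = 0" using \<tau> k3 by (simp add: wt_zero cod_real)
qed

lemma deflated_joint_same:
  assumes "i \<in> {1..t}" "x \<in> W i" "y \<in> W i"
  shows "joint \<tau> x y - cod \<tau> / (cod \<tau> - 1) * (wt \<tau> x * wt \<tau> y) = 1 / coef * cov i x y"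
proof -
  have "joint \<tau> x y = (if x = y then 0 else p i {x, y}) / coef"
    using assms up_same[OF assms(1), of "{x, y}"] up_pos[of \<tau>] \<tau> k3 W_not_in[OF assms(1)]
    by (simp add: joint_eq cod_real)
  then show ?thesis
    using k3 by (simp add: cov_def wt_link[OF assms(1,2)] wt_link[OF assms(1,3)] cod_real field_simps)
qed

text \<open>Independence makes \<open>joint\<close> a product of probabilities, and k/(k-1) is the
  factor that gives the product of the weights the same denominator k (k-1).\<close>

lemma deflated_joint_different:
  assumes "i \<in> {1..t}" "j \<in> {1..t}" "i \<noteq> j" "x \<in> W i" "y \<in> W j"
  shows "joint \<tau> x y - cod \<tau> / (cod \<tau> - 1) * (wt \<tau> x * wt \<tau> y) = 0"
proof -
  have "x \<noteq> y" using W_disjoint[OF assms(1-3)] assms by auto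
  then have "joint \<tau> x y = p i {x} * p j {y} / coef"
    using assms up_different[OF assms] up_pos[of \<tau>] \<tau> k3 W_not_in
    by (simp add: joint_eq cod_real)
  then show ?thesis
    using k3 by (simp add: wt_link[OF assms(1,4)] wt_link[OF assms(2,5)] cod_real field_simps)
qed

lemma block_unique:
  assumes "i \<in> I" "I \<subseteq> {1..t}" "x \<in> W i"
  shows "(\<Sum>j\<in>I. if x \<in> W j \<and> y \<in> W j then A j else 0) = (if y \<in> W i then A i else (0::real))"
proof -
  have "finite I" using assms(2) finite_subset by blast
  have "x \<notin> W j" if "j \<in> I" "j \<noteq> i" for j
  proof -
    have "i \<in> {1..t}" "j \<in> {1..t}" using assms(1,2) that(1) by blast+
    then show ?thesis using W_disjoint[of i j] that(2) assms(3) by blast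
  qed
  then have "(\<Sum>j\<in>I. if x \<in> W j \<and> y \<in> W j then A j else 0)
      = (\<Sum>j\<in>I. if j = i then (if y \<in> W i then A i else 0) else 0)"
    using assms(3) by (intro sum.cong) auto
  then show ?thesis using assms(1) \<open>finite I\<close> by simp
qed

lemma deflated_joint_block:
  "joint \<tau> x y - cod \<tau> / (cod \<tau> - 1) * (wt \<tau> x * wt \<tau> y)
    = (\<Sum>i\<in>{1..t}. if x \<in> W i \<and> y \<in> W i then 1 / coef * cov i x y else 0)"
proof (cases "\<exists>i\<in>{1..t}. x \<in> W i")
  case True
  then obtain i where i: "i \<in> {1..t}" "x \<in> W i" by blast
  have "joint \<tau> x y - cod \<tau> / (cod \<tau> - 1) * (wt \<tau> x * wt \<tau> y)
      = (if y \<in> W i then 1 / coef * cov i x y else 0)"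
  proof (cases "\<exists>j\<in>{1..t}. y \<in> W j")
    case True
    then obtain j where j: "j \<in> {1..t}" "y \<in> W j" by blast
    then show ?thesis
      using deflated_joint_same[OF i] deflated_joint_different[OF i(1) j(1) _ i(2) j(2)]
        W_disjoint[OF i(1) j(1)] by (cases "i = j") auto
  next
    case False
    then show ?thesis using wt_uncovered[of y] i by (auto simp: joint_zero)
  qed
  then show ?thesis using block_unique[OF i(1) subset_refl i(2)] by simp
next
  case False
  then show ?thesis using wt_uncovered[of x] by (auto simp: joint_zero intro!: sum.neutral[symmetric])
qed

lemma qform_deflated_joint:
  "qform V (joint \<tau>) v - cod \<tau> / (cod \<tau> - 1) * (\<Sum>x\<in>V. wt \<tau> x * v x)\<^sup>2
    = (\<Sum>i\<in>{1..t}. 1 / coef * qform (W i) (cov i) v)"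
proof -
  have "qform V (joint \<tau>) v - cod \<tau> / (cod \<tau> - 1) * (\<Sum>x\<in>V. wt \<tau> x * v x)\<^sup>2
      = qform V (\<lambda>x y. joint \<tau> x y - cod \<tau> / (cod \<tau> - 1) * (wt \<tau> x * wt \<tau> y)) v"
    by (simp only: qform_diff qform_scale qform_rank_one)
  also have "\<dots> = (\<Sum>i\<in>{1..t}. qform V (\<lambda>x y. if x \<in> W i \<and> y \<in> W i then 1 / coef * cov i x y else 0) v)"
    unfolding deflated_joint_block by (rule qform_sum)
  also have "\<dots> = (\<Sum>i\<in>{1..t}. 1 / coef * qform (W i) (cov i) v)"
    by (intro sum.cong refl) (simp only: qform_block[OF finite_V W_subset_V] qform_scale)
  finally show ?thesis .
qed

lemma sum_wt_link:
  "(\<Sum>x\<in>V. wt \<tau> x * F x) = (\<Sum>i\<in>{1..t}. \<Sum>x\<in>W i. p i {x} / real k * F x)"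
proof -
  have "(\<Sum>i\<in>{1..t}. \<Sum>x\<in>W i. p i {x} / real k * F x) = (\<Sum>i\<in>{1..t}. \<Sum>x\<in>W i. wt \<tau> x * F x)"
    by (intro sum.cong refl) (simp add: wt_link)
  also have "\<dots> = (\<Sum>x\<in>(\<Union>i\<in>{1..t}. W i). wt \<tau> x * F x)"
    using W_disjoint finite_subset[OF W_subset_V finite_V]
    by (intro sum.UNION_disjoint[symmetric]) auto
  also have "\<dots> = (\<Sum>x\<in>V. wt \<tau> x * F x)"
  proof (rule sum.mono_neutral_left[OF finite_V])
    show "(\<Union>i\<in>{1..t}. W i) \<subseteq> V" using W_subset_V by blast
    show "\<forall>x\<in>V - (\<Union>i\<in>{1..t}. W i). wt \<tau> x * F x = 0"
    proof
      fix x assume "x \<in> V - (\<Union>i\<in>{1..t}. W i)"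
      then have "wt \<tau> x = 0" by (intro wt_uncovered(2)) blast
      then show "wt \<tau> x * F x = 0" by simp
    qed
  qed
  finally show ?thesis by simp
qed

section \<open>Pinning all factors but one\<close>

context
  fixes F :: "nat \<Rightarrow> 'a set"
  assumes F: "F \<in> (\<Pi>\<^sub>E i\<in>{1..t}. facets (Y i))"
begin

abbreviation \<eta> :: "'a set" where "\<eta> \<equiv> (\<Union>i\<in>{1..t}. F i)"

text \<open>Adding the components of all other factors to \<tau> leaves factor i as the remaining
  link; \<open>up_\<sigma>\<close> says this for the probabilities.\<close>

abbreviation \<sigma> :: "nat \<Rightarrow> 'a set" where "\<sigma> i \<equiv> \<tau> \<union> (\<eta> - W i)"

lemma facet_\<eta>: "\<tau> \<union> \<eta> \<in> facets X" "\<eta> \<inter> \<tau> = {}"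
  using link_facet[OF F] by auto

lemma F_subset: "i \<in> {1..t} \<Longrightarrow> F i \<subseteq> W i"
  using F factor_facet_subset by blast

lemma card_F:
  assumes "i \<in> {1..t}"
  shows "card (F i) = Suc (e i)"
  using PiE_mem[OF F assms] by (rule weighted.facet_card[OF factor[OF assms]])

lemma \<sigma>_in_X: "\<sigma> i \<in> X"
  by (rule down_closed[OF facet_mem[OF facet_\<eta>(1)]]) auto

lemma \<sigma>_eq: "i \<in> {1..t} \<Longrightarrow> \<sigma> i = (\<tau> \<union> \<eta>) - F i"
  using Union_Int_W[of F i] F_subset facet_\<eta>(2) W_not_in[of i] by blast

lemma cod_\<sigma>:
  assumes i: "i \<in> {1..t}"
  shows "cod (\<sigma> i) = real (e i) + 1"
proof -
  have fin: "finite (\<tau> \<union> \<eta>)" using facet_\<eta>(1) facet_mem finite_face by blast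
  have sub: "F i \<subseteq> \<tau> \<union> \<eta>" using i by auto
  have "card (\<sigma> i) = card (\<tau> \<union> \<eta>) - card (F i)"
    unfolding \<sigma>_eq[OF i] by (rule card_Diff_subset[OF finite_subset[OF sub fin] sub])
  then show ?thesis
    using card_mono[OF fin sub] facet_card[OF facet_\<eta>(1)] card_F[OF i] by (simp add: cod_eq)
qed

text \<open>A second factor exists and its component is not empty, so pinning it enlarges \<tau>.
  This makes the induction hypothesis available at \<open>\<sigma> i\<close>.\<close>

lemma cod_\<sigma>_less:
  assumes i: "i \<in> {1..t}"
  shows "cod (\<sigma> i) < cod \<tau>"
proof -
  have "2 \<le> t" using prod by (simp add: is_product_def)
  define j where "j = (if i = 1 then 2 else 1 :: nat)"
  have j: "j \<in> {1..t}" "j \<noteq> i" using \<open>2 \<le> t\<close> by (auto simp: j_def)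
  have "F j \<noteq> {}" using card_F[OF j(1)] by auto
  then obtain x where x: "x \<in> F j" by auto
  then have "x \<in> \<eta>" using j by auto
  moreover have "x \<notin> W i" using x F_subset[OF j(1)] W_disjoint[OF j(1) i j(2)] by auto
  moreover have "x \<notin> \<tau>" using \<open>x \<in> \<eta>\<close> facet_\<eta>(2) by auto
  ultimately have "\<tau> \<subset> \<sigma> i" by auto
  then have "card \<tau> < card (\<sigma> i)"
    using finite_face[OF \<sigma>_in_X] by (intro psubset_card_mono) auto
  then show ?thesis by (simp add: cod_eq)
qed

text \<open>By independence the pinned components contribute a factor that does not depend on A; A =
  {} identifies it as \<open>up (\<sigma> i)\<close>.\<close>

lemma up_\<sigma>:
  assumes i: "i \<in> {1..t}" and A: "A \<subseteq> W i"
  shows "up (\<sigma> i \<union> A) = up (\<sigma> i) * p i A"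
proof -
  have *: "up (\<sigma> i \<union> B) = up \<tau> * (p i B * (\<Prod>j\<in>{1..t} - {i}. p j (F j)))" if B: "B \<subseteq> W i" for B
  proof -
    let ?Z = "\<lambda>j. if j = i then B else F j"
    have "(\<Union>j\<in>{1..t}. ?Z j) = (\<eta> - W i) \<union> B"
    proof -
      have "F j \<inter> W i = {}" if "j \<in> {1..t}" "j \<noteq> i" for j
        using F_subset[OF that(1)] W_disjoint[OF that(1) i that(2)] by auto
      then show ?thesis using i F_subset[OF i] by (fastforce split: if_splits)
    qed
    then have "up (\<sigma> i \<union> B) = up \<tau> * (\<Prod>j\<in>{1..t}. p j (?Z j))"
      using up_product[of ?Z] B F_subset by (auto simp: Un_assoc)
    also have "(\<Prod>j\<in>{1..t}. p j (?Z j)) = p i B * (\<Prod>j\<in>{1..t} - {i}. p j (F j))"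
      using i by (subst prod.remove[of _ i]) (auto intro!: prod.cong)
    finally show ?thesis .
  qed
  from *[OF A] *[of "{}"] show ?thesis by (simp add: p_empty[OF i])
qed

lemma W_not_in_\<sigma>: "i \<in> {1..t} \<Longrightarrow> x \<in> W i \<Longrightarrow> x \<notin> \<sigma> i"
  using W_not_in by auto

lemma wt_\<sigma>:
  assumes "i \<in> {1..t}" "x \<in> W i"
  shows "wt (\<sigma> i) x = p i {x} / (real (e i) + 1)"
  using up_\<sigma>[OF assms(1), of "{x}"] assms(2) up_pos[of "\<sigma> i"] \<sigma>_in_X W_not_in_\<sigma>[OF assms]
    cod_\<sigma>[OF assms(1)]
  by (subst wt_eq[OF \<sigma>_in_X]) simp_all

text \<open>The same \<open>cov\<close> as in the block at \<tau>, with e (e+1) in place of k (k-1);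
  the ratio of the two is the coefficient in the product condition.\<close>

lemma deflated_joint_\<sigma>:
  assumes i: "i \<in> {1..t}" "1 \<le> e i" and xy: "x \<in> W i" "y \<in> W i"
  shows "joint (\<sigma> i) x y - cod (\<sigma> i) / (cod (\<sigma> i) - 1) * (wt (\<sigma> i) x * wt (\<sigma> i) y)
    = 1 / (real (e i) * (real (e i) + 1)) * cov i x y"
proof -
  have alg: "(real (e i) + 1) / (real (e i) + 1 - 1) * (q / (real (e i) + 1) * (r / (real (e i) + 1)))
      = q * r / (real (e i) * (real (e i) + 1))" for q r
  proof -
    have "b / (b - 1) * (q / b * (r / b)) = q * r / ((b - 1) * b)" if "b \<noteq> 0" for b :: real
      using that by simp
    from this[of "real (e i) + 1"] show ?thesis by simp
  qed
  have "joint (\<sigma> i) x y = (if x = y then 0 else p i {x, y}) / (real (e i) * (real (e i) + 1))"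
    using up_\<sigma>[OF i(1), of "{x, y}"] xy up_pos[of "\<sigma> i"] \<sigma>_in_X
      W_not_in_\<sigma>[OF i(1)] cod_\<sigma>[OF i(1)] i(2)
    by (subst joint_eq[OF \<sigma>_in_X]) (simp_all add: mult.commute)
  then show ?thesis
    unfolding cov_def wt_\<sigma>[OF i(1) xy(1)] wt_\<sigma>[OF i(1) xy(2)] cod_\<sigma>[OF i(1)] alg
    by (simp add: diff_divide_distrib)
qed

context
  fixes M :: "'a set \<Rightarrow> 'a \<Rightarrow> 'a \<Rightarrow> real"
  assumes M: "\<And>x y. x \<in> V \<Longrightarrow> y \<in> V \<Longrightarrow> M \<tau> x y =
      block_sum {i \<in> {1..t}. 1 \<le> e i} W
        (\<lambda>i u v. real (e i) * (real (e i) + 1) / coef * M (\<sigma> i) u v) x y"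
    and IH: "\<And>\<rho>. \<rho> \<in> X \<Longrightarrow> 2 \<le> cod \<rho> \<Longrightarrow> cod \<rho> < cod \<tau> \<Longrightarrow> local_bounds M \<rho>"
begin

lemma qform_M:
  "qform V (M \<tau>) v = (\<Sum>i\<in>{i\<in>{1..t}. 1 \<le> e i}. real (e i) * (real (e i) + 1) / coef * qform (W i) (M (\<sigma> i)) v)"
proof -
  let ?I = "{i\<in>{1..t}. 1 \<le> e i}"
  have "qform V (M \<tau>) v = qform V (\<lambda>x y. \<Sum>i\<in>?I. if x \<in> W i \<and> y \<in> W i
      then real (e i) * (real (e i) + 1) / coef * M (\<sigma> i) x y else 0) v"
    by (intro qform_cong refl) (simp only: M block_sum_def)
  also have "\<dots> = (\<Sum>i\<in>?I. real (e i) * (real (e i) + 1) / coef * qform (W i) (M (\<sigma> i)) v)"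
    unfolding qform_sum
    by (intro sum.cong refl) (simp only: qform_block[OF finite_V W_subset_V] qform_scale mem_Collect_eq)
  finally show ?thesis .
qed

text \<open>The induction hypothesis at \<open>\<sigma> i\<close>, tested on functions supported on
  the vertices of factor i.\<close>

lemma factor_bounds:
  assumes i: "i \<in> {1..t}" "1 \<le> e i"
  shows "1 / (real (e i) * (real (e i) + 1)) * qform (W i) (cov i) v \<le> qform (W i) (M (\<sigma> i)) v"
    and "qform (W i) (M (\<sigma> i)) v
      \<le> real (e i) / (3 * real (e i) + 2) * (\<Sum>x\<in>W i. p i {x} / (real (e i) + 1) * (v x)\<^sup>2)"
proof -
  let ?v = "\<lambda>x. if x \<in> W i then v x else 0"
  let ?\<kappa> = "cod (\<sigma> i) / (cod (\<sigma> i) - 1)"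
  note to_W = qform_restrict[OF finite_V W_subset_V[OF i(1)]]
  have "2 \<le> cod (\<sigma> i)" unfolding cod_\<sigma>[OF i(1)] using i(2) by simp
  then have b: "local_bounds M (\<sigma> i)" by (rule IH[OF \<sigma>_in_X _ cod_\<sigma>_less[OF i(1)]])
  have lower: "qform V (joint (\<sigma> i)) ?v - ?\<kappa> * (\<Sum>x\<in>V. wt (\<sigma> i) x * ?v x)\<^sup>2 \<le> qform V (M (\<sigma> i)) ?v"
    and upper: "qform V (M (\<sigma> i)) ?v
      \<le> (cod (\<sigma> i) - 1) / (3 * cod (\<sigma> i) - 1) * (\<Sum>x\<in>V. wt (\<sigma> i) x * (?v x)\<^sup>2)"
    using b unfolding local_bounds_def by blast+
  have mean: "(\<Sum>x\<in>V. wt (\<sigma> i) x * ?v x) = (\<Sum>x\<in>W i. wt (\<sigma> i) x * v x)"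
    using finite_V W_subset_V[OF i(1)] by (rule sum_restrict) simp
  have "qform (W i) (\<lambda>x y. 1 / (real (e i) * (real (e i) + 1)) * cov i x y) v
      = qform (W i) (\<lambda>x y. joint (\<sigma> i) x y - ?\<kappa> * (wt (\<sigma> i) x * wt (\<sigma> i) y)) v"
    by (intro qform_cong deflated_joint_\<sigma>[OF i, symmetric] refl)
  also have "\<dots> = qform (W i) (joint (\<sigma> i)) v - ?\<kappa> * (\<Sum>x\<in>W i. wt (\<sigma> i) x * v x)\<^sup>2"
    by (simp only: qform_diff qform_scale qform_rank_one)
  also have "\<dots> \<le> qform (W i) (M (\<sigma> i)) v"
    using lower by (simp only: to_W mean)
  finally show "1 / (real (e i) * (real (e i) + 1)) * qform (W i) (cov i) v \<le> qform (W i) (M (\<sigma> i)) v"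
    by (simp only: qform_scale)
  have "(\<Sum>x\<in>V. wt (\<sigma> i) x * (?v x)\<^sup>2) = (\<Sum>x\<in>W i. wt (\<sigma> i) x * (v x)\<^sup>2)"
    using finite_V W_subset_V[OF i(1)] by (rule sum_restrict) simp
  also have "\<dots> = (\<Sum>x\<in>W i. p i {x} / (real (e i) + 1) * (v x)\<^sup>2)"
    by (intro sum.cong refl) (simp only: wt_\<sigma>[OF i(1)])
  finally have square: "(\<Sum>x\<in>V. wt (\<sigma> i) x * (?v x)\<^sup>2)
      = (\<Sum>x\<in>W i. p i {x} / (real (e i) + 1) * (v x)\<^sup>2)" .
  have ratio: "(cod (\<sigma> i) - 1) / (3 * cod (\<sigma> i) - 1) = real (e i) / (3 * real (e i) + 2)"
    unfolding cod_\<sigma>[OF i(1)] by (simp add: algebra_simps)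
  show "qform (W i) (M (\<sigma> i)) v
      \<le> real (e i) / (3 * real (e i) + 2) * (\<Sum>x\<in>W i. p i {x} / (real (e i) + 1) * (v x)\<^sup>2)"
    using upper by (simp only: to_W square ratio)
qed

lemma local_bounds_product: "local_bounds M \<tau>"
  unfolding local_bounds_def
proof (intro conjI allI)
  fix v
  let ?I = "{i\<in>{1..t}. 1 \<le> e i}"
  have coef: "0 < coef" using k3 by simp
  have "qform V (joint \<tau>) v - cod \<tau> / (cod \<tau> - 1) * (\<Sum>x\<in>V. wt \<tau> x * v x)\<^sup>2
      = (\<Sum>i\<in>{1..t}. 1 / coef * qform (W i) (cov i) v)" by (rule qform_deflated_joint)
  also have "\<dots> \<le> (\<Sum>i\<in>{1..t}. if i \<in> ?I then 1 / coef * qform (W i) (cov i) v else 0)"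
  proof (rule sum_mono)
    fix i assume i: "i \<in> {1..t}"
    show "1 / coef * qform (W i) (cov i) v \<le> (if i \<in> ?I then 1 / coef * qform (W i) (cov i) v else 0)"
    proof (cases "i \<in> ?I")
      case False
      \<comment> \<open>A factor of dimension 0 has no block in \<open>M \<tau>\<close>. Two of its
        vertices never occur together, so \<open>cov\<close> is minus a rank-one square and dropping
        its block can only increase the sum.\<close>
      then have "e i = 0" using i by simp
      interpret w: weighted "e i" "Y i" "\<mu> i" by (rule factor[OF i])
      have "p i {x, y} = 0" if "x \<noteq> y" for x y
      proof (rule w.up_eq_0)
        show "{x, y} \<notin> Y i"
        proof
          assume "{x, y} \<in> Y i"
          then obtain G where G: "G \<in> facets (Y i)" "{x, y} \<subseteq> G" by (rule w.facet_above)
          then have "card {x, y} \<le> card G"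
            using w.finite_face[OF w.facet_mem[OF G(1)]] by (intro card_mono)
          then show False using w.facet_card[OF G(1)] that \<open>e i = 0\<close> by simp
        qed
      qed
      then have "cov i x y = - 1 * (p i {x} * p i {y})" for x y
        by (simp add: cov_def)
      then have "qform (W i) (cov i) v = qform (W i) (\<lambda>x y. - 1 * (p i {x} * p i {y})) v"
        by (intro qform_cong) auto
      then have "qform (W i) (cov i) v = - 1 * (\<Sum>x\<in>W i. p i {x} * v x)\<^sup>2"
        by (simp only: qform_scale qform_rank_one)
      then have "qform (W i) (cov i) v \<le> 0" by simp
      then have "1 / coef * qform (W i) (cov i) v \<le> 0"
        using coef by (intro mult_nonneg_nonpos) auto
      then show ?thesis using False by simp
    qed simp
  qed
  also have "\<dots> = (\<Sum>i\<in>?I. 1 / coef * qform (W i) (cov i) v)"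
    by (intro sum.mono_neutral_cong_right) auto
  also have "\<dots> \<le> (\<Sum>i\<in>?I. real (e i) * (real (e i) + 1) / coef * qform (W i) (M (\<sigma> i)) v)"
  proof (rule sum_mono)
    fix i assume "i \<in> ?I"
    then have i: "i \<in> {1..t}" "1 \<le> e i" by auto
    define c where "c = real (e i) * (real (e i) + 1)"
    have c: "0 < c" using i(2) by (simp add: c_def)
    have "c / coef * (1 / c * qform (W i) (cov i) v) \<le> c / coef * qform (W i) (M (\<sigma> i)) v"
      using factor_bounds(1)[OF i] c coef by (intro mult_left_mono) (auto simp: c_def)
    then show "1 / coef * qform (W i) (cov i) v
        \<le> real (e i) * (real (e i) + 1) / coef * qform (W i) (M (\<sigma> i)) v"
      using c by (simp add: c_def[symmetric])
  qed
  finally show "qform V (joint \<tau>) v - cod \<tau> / (cod \<tau> - 1) * (\<Sum>x\<in>V. wt \<tau> x * v x)\<^sup>2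
      \<le> qform V (M \<tau>) v" by (simp only: qform_M)
  have nn: "0 \<le> (\<Sum>x\<in>W i. p i {x} / real k * (v x)\<^sup>2)" if "i \<in> {1..t}" for i
    using weighted.up_nonneg[OF factor[OF that]] by (intro sum_nonneg) auto
  have "qform V (M \<tau>) v = (\<Sum>i\<in>?I. real (e i) * (real (e i) + 1) / coef * qform (W i) (M (\<sigma> i)) v)"
    by (rule qform_M)
  also have "\<dots> \<le> (\<Sum>i\<in>?I. (cod \<tau> - 1) / (3 * cod \<tau> - 1) * (\<Sum>x\<in>W i. p i {x} / real k * (v x)\<^sup>2))"
  proof (rule sum_mono)
    fix i assume "i \<in> ?I"
    then have i: "i \<in> {1..t}" "1 \<le> e i" by auto
    define a where "a = real (e i)"
    define s where "s = (\<Sum>x\<in>W i. p i {x} * (v x)\<^sup>2)"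
    have a: "1 \<le> a" using i(2) by (simp add: a_def)
    have ak: "a \<le> real k - 1" using cod_\<sigma>[OF i(1)] cod_\<sigma>_less[OF i(1)] cod_real by (simp add: a_def)
    have s: "0 \<le> s"
      unfolding s_def using weighted.up_nonneg[OF factor[OF i(1)]] by (intro sum_nonneg) auto
    have "qform (W i) (M (\<sigma> i)) v \<le> a / (3 * a + 2) * (s / (a + 1))"
      using factor_bounds(2)[OF i, of v] by (simp add: a_def s_def sum_divide_distrib)
    then have "a * (a + 1) / coef * qform (W i) (M (\<sigma> i)) v
        \<le> a * (a + 1) / coef * (a / (3 * a + 2) * (s / (a + 1)))"
      using a coef by (intro mult_left_mono) auto
    \<comment> \<open>Rescaling the weights from p / (a+1) to p / k leaves the factor a / (k-1)
      \<le> 1. The remaining ratio increases in a and equals (k-1) / (3k-1) at a = k-1.\<close>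
    also have "\<dots> = a / (3 * a + 2) * (a / (real k - 1)) * (s / real k)"
      using a by (simp add: divide_simps)
    also have "\<dots> \<le> (real k - 1) / (3 * real k - 1) * 1 * (s / real k)"
    proof (intro mult_mono)
      have "(real k - 1) / (3 * real k - 1) - a / (3 * a + 2)
          = 2 * (real k - 1 - a) / ((3 * real k - 1) * (3 * a + 2))"
        using a k3 by (simp add: field_simps)
      moreover have "0 \<le> 2 * (real k - 1 - a) / ((3 * real k - 1) * (3 * a + 2))"
        using a ak k3 by (intro divide_nonneg_nonneg mult_nonneg_nonneg) auto
      ultimately show "a / (3 * a + 2) \<le> (real k - 1) / (3 * real k - 1)" by linarith
      show "a / (real k - 1) \<le> 1" using ak k3 by (simp add: divide_le_eq)
    qed (use a s k3 in auto)
    also have "s / real k = (\<Sum>x\<in>W i. p i {x} / real k * (v x)\<^sup>2)"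
      by (simp add: s_def sum_divide_distrib)
    finally show "real (e i) * (real (e i) + 1) / coef * qform (W i) (M (\<sigma> i)) v
        \<le> (cod \<tau> - 1) / (3 * cod \<tau> - 1) * (\<Sum>x\<in>W i. p i {x} / real k * (v x)\<^sup>2)"
      by (simp add: a_def cod_real)
  qed
  \<comment> \<open>The factors of dimension 0 return with nonnegative contributions, completing the
    sum over all link vertices.\<close>
  also have "\<dots> \<le> (\<Sum>i\<in>{1..t}. (cod \<tau> - 1) / (3 * cod \<tau> - 1) * (\<Sum>x\<in>W i. p i {x} / real k * (v x)\<^sup>2))"
    using nn k3 by (intro sum_mono2 mult_nonneg_nonneg) (auto simp: cod_real)
  also have "\<dots> = (cod \<tau> - 1) / (3 * cod \<tau> - 1) * (\<Sum>x\<in>V. wt \<tau> x * (v x)\<^sup>2)"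
    by (simp only: sum_wt_link sum_distrib_left)
  finally show "qform V (M \<tau>) v \<le> (cod \<tau> - 1) / (3 * cod \<tau> - 1) * (\<Sum>x\<in>V. wt \<tau> x * (v x)\<^sup>2)" .
qed

end

end

end

theorem theorem3p5:
  fixes X :: "'a set set" and \<pi> :: "'a set pmf" and d :: nat
    and M :: "'a set \<Rightarrow> 'a \<Rightarrow> 'a \<Rightarrow> real"
  assumes X: "weighted_complex d X \<pi>"
    and conn: "totally_connected d X \<pi>"
    and sym: "\<And>\<tau>. \<tau> \<in> faces_upto X (int d - 2) \<Longrightarrow> symmetric_on (vertices X) (M \<tau>)"
    and base: "\<And>\<tau>. \<tau> \<in> X \<Longrightarrow> codim d \<tau> = 2 \<Longrightarrow>
      loewner_le (vertices X)
        (\<lambda>x y. mat_mult_on (vertices X) (Pi_mat d X \<pi> \<tau>) (local_walk d X \<pi> \<tau>) x y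
               - 2 * (vertex_weight d X \<pi> \<tau> x * vertex_weight d X \<pi> \<tau> y))
        (M \<tau>) \<and>
      loewner_le (vertices X) (M \<tau>) (\<lambda>x y. 1 / 5 * Pi_mat d X \<pi> \<tau> x y)"
    and recursive: "\<And>\<tau> k::nat. \<tau> \<in> X \<Longrightarrow> codim d \<tau> = int k \<Longrightarrow> 3 \<le> k \<Longrightarrow>
      (loewner_le (vertices X) (M \<tau>)
         (\<lambda>x y. (real k - 1) / (3 * real k - 1) * Pi_mat d X \<pi> \<tau> x y) \<and>
       loewner_le (vertices X)
         (link_expectation d X \<pi> \<tau> (\<lambda>x. M (\<tau> \<union> {x})))
         (\<lambda>x y. M \<tau> x y - (real k - 1) / (real k - 2) *
            mat_mult_on (vertices X) (mat_mult_on (vertices X) (M \<tau>) (Pi_inv d X \<pi> \<tau>)) (M \<tau>) x y))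
      \<or>
      (\<exists>t e Y \<mu>.
         is_product (link X \<tau>) (link_weight d X \<pi> \<tau> (int k - 1)) t e Y \<mu> \<and>
         (\<forall>\<eta>\<in>faces (link X \<tau>) (int k - 1). \<forall>x\<in>vertices X. \<forall>y\<in>vertices X.
            M \<tau> x y =
              block_sum {i \<in> {1..t}. 1 \<le> e i} (\<lambda>i. vertices (Y i))
                (\<lambda>i u v. real (e i) * (real (e i) + 1) / (real k * (real k - 1))
                   * M (\<tau> \<union> (\<eta> - vertices (Y i))) u v)
                x y))"
  shows "\<forall>\<tau>\<in>faces_upto X (int d - 2).
    lambda2_walk d X \<pi> \<tau>
      \<le> spectral_radius_on (vertices X)
           (mat_mult_on (vertices X) (Pi_inv d X \<pi> \<tau>) (M \<tau>))"
proof -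
  interpret weighted d X \<pi> using X by (rule weighted.intro)
  have upto: "\<tau> \<in> faces_upto X (int d - 2)" if "\<tau> \<in> X" "2 \<le> cod \<tau>" for \<tau>
    using that by (simp add: faces_upto_def codim_def)
  have "local_bounds M \<tau>" if "\<tau> \<in> X" "codim d \<tau> = int k" "2 \<le> k" for \<tau> k
    using that
  \<comment> \<open>Course-of-values induction, because in the product case the codimension may drop
    by more than one.\<close>
  proof (induction k arbitrary: \<tau> rule: less_induct)
    case (less k)
    have IH: "local_bounds M \<rho>" if "\<rho> \<in> X" "2 \<le> cod \<rho>" "cod \<rho> < cod \<tau>" for \<rho>
      using less.IH[of "nat (codim d \<rho>)" \<rho>] that less.prems(2) by simp
    have gap: "lambda2_walk d X \<pi> \<tau> < 1"
      using conn upto less.prems by (auto simp: totally_connected_def)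
    have symM: "symmetric_on V (M \<tau>)" using sym upto less.prems by auto
    consider (two) "k = 2" | (three) "3 \<le> k" using less.prems(3) by linarith
    then show ?case
    proof cases
      case two
      have "qform V (joint \<tau>) v - 2 * (\<Sum>x\<in>V. wt \<tau> x * v x)\<^sup>2 \<le> qform V (M \<tau>) v" for v
      proof -
        have "qform V (joint \<tau>) v - 2 * (\<Sum>x\<in>V. wt \<tau> x * v x)\<^sup>2
            = qform V (\<lambda>x y. joint \<tau> x y - 2 * (wt \<tau> x * wt \<tau> y)) v"
          by (simp only: qform_diff qform_scale qform_rank_one)
        also have "\<dots> = qform V (\<lambda>x y. mat_mult_on V (Pi_mat d X \<pi> \<tau>) (local_walk d X \<pi> \<tau>) x y
            - 2 * (wt \<tau> x * wt \<tau> y)) v"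
          by (intro qform_cong) (simp_all add: mat_mult_Pi_walk)
        also have "\<dots> \<le> qform V (M \<tau>) v"
          using base[of \<tau>] less.prems two by (simp add: loewner_le_iff)
        finally show ?thesis .
      qed
      moreover have "qform V (M \<tau>) v \<le> 1 / 5 * (\<Sum>x\<in>V. wt \<tau> x * (v x)\<^sup>2)" for v
      proof -
        have "qform V (M \<tau>) v \<le> qform V (\<lambda>x y. 1 / 5 * Pi_mat d X \<pi> \<tau> x y) v"
          using base[of \<tau>] less.prems two unfolding loewner_le_iff by auto
        then show ?thesis by (simp only: qform_scale qform_Pi)
      qed
      ultimately show ?thesis using less.prems(2) two by (simp add: local_bounds_def)
    next
      case three
      from recursive[OF less.prems(1,2) three] show ?thesis
      proof
        assume *: "loewner_le V (M \<tau>)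
            (\<lambda>x y. (real k - 1) / (3 * real k - 1) * Pi_mat d X \<pi> \<tau> x y) \<and>
          loewner_le V (link_expectation d X \<pi> \<tau> (\<lambda>x. M (\<tau> \<union> {x})))
            (\<lambda>x y. M \<tau> x y - (real k - 1) / (real k - 2) *
              mat_mult_on V (mat_mult_on V (M \<tau>) (Pi_inv d X \<pi> \<tau>)) (M \<tau>) x y)"
        have k: "cod \<tau> = real k" "3 \<le> cod \<tau>" using less.prems(2) three by simp_all
        show ?thesis
        proof (rule local_bounds_step[where M = M and \<tau> = \<tau>, OF less.prems(1) k(2) _ gap symM])
          fix x assume "x \<in> S \<tau>"
          then show "local_bounds M (insert x \<tau>)"
            using insert_link[OF less.prems(1) k(2)] by (intro IH) auto
        next
          fix v
          have "qform V (M \<tau>) v \<le> qform V (\<lambda>x y. (real k - 1) / (3 * real k - 1) * Pi_mat d X \<pi> \<tau> x y) v"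
            using * unfolding loewner_le_iff by blast
          then show "qform V (M \<tau>) v \<le> (cod \<tau> - 1) / (3 * cod \<tau> - 1) * (\<Sum>x\<in>V. wt \<tau> x * (v x)\<^sup>2)"
            by (simp only: qform_scale qform_Pi k(1))
          have "qform V (link_expectation d X \<pi> \<tau> (\<lambda>x. M (\<tau> \<union> {x}))) v
              \<le> qform V (\<lambda>x y. M \<tau> x y - (real k - 1) / (real k - 2) *
                mat_mult_on V (mat_mult_on V (M \<tau>) (Pi_inv d X \<pi> \<tau>)) (M \<tau>) x y) v"
            using * unfolding loewner_le_iff by blast
          then show "(\<Sum>x\<in>S \<tau>. wt \<tau> x * qform V (M (insert x \<tau>)) v) \<le> qform V (M \<tau>) v
              - (cod \<tau> - 1) / (cod \<tau> - 2) * (\<Sum>z\<in>S \<tau>. (\<Sum>y\<in>V. M \<tau> z y * v y)\<^sup>2 / wt \<tau> z)"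
            unfolding qform_link_expectation qform_diff qform_scale mat_mult_Pi_inv[OF symM] k(1)
            by simp
        qed
      next
        assume "\<exists>t e Y \<mu>.
          is_product (link X \<tau>) (link_weight d X \<pi> \<tau> (int k - 1)) t e Y \<mu> \<and>
          (\<forall>\<eta>\<in>faces (link X \<tau>) (int k - 1). \<forall>x\<in>V. \<forall>y\<in>V.
            M \<tau> x y =
              block_sum {i \<in> {1..t}. 1 \<le> e i} (\<lambda>i. vertices (Y i))
                (\<lambda>i u v. real (e i) * (real (e i) + 1) / (real k * (real k - 1))
                   * M (\<tau> \<union> (\<eta> - vertices (Y i))) u v)
                x y)"
        then obtain t e Y \<mu> where prod: "is_product (link X \<tau>) (link_weight d X \<pi> \<tau> (int k - 1)) t e Y \<mu>"
          and block: "\<And>\<eta> x y. \<eta> \<in> faces (link X \<tau>) (int k - 1) \<Longrightarrow> x \<in> V \<Longrightarrow> y \<in> V \<Longrightarrow> M \<tau> x y =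
              block_sum {i \<in> {1..t}. 1 \<le> e i} (\<lambda>i. vertices (Y i))
                (\<lambda>i u v. real (e i) * (real (e i) + 1) / (real k * (real k - 1))
                   * M (\<tau> \<union> (\<eta> - vertices (Y i))) u v) x y"
          by blast
        interpret product_link d X \<pi> \<tau> k t e Y \<mu>
          using less.prems three prod by unfold_locales auto
        \<comment> \<open>The union of one facet from each factor is a top-dimensional face of the
          link, at which the block formula is instantiated.\<close>
        obtain F where F: "F \<in> (\<Pi>\<^sub>E i\<in>{1..t}. facets (Y i))" using ex_facets .
        show ?thesis
        proof (rule local_bounds_product[where M = M, OF F])
          show "M \<tau> x y = block_sum {i \<in> {1..t}. 1 \<le> e i} W
              (\<lambda>i u v. real (e i) * (real (e i) + 1) / (real k * (real k - 1))
                * M (\<tau> \<union> ((\<Union>i\<in>{1..t}. F i) - W i)) u v) x y" if "x \<in> V" "y \<in> V" for x y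
            using link_facet(3)[OF F] that by (rule block)
          show "local_bounds M \<rho>" if "\<rho> \<in> X" "2 \<le> cod \<rho>" "cod \<rho> < cod \<tau>" for \<rho>
            using that by (rule IH)
        qed
      qed
    qed
  qed
  then have bounds: "local_bounds M \<tau>" if "\<tau> \<in> X" "2 \<le> cod \<tau>" for \<tau>
    using that zero_le_imp_eq_int[of "codim d \<tau>"] by force
  show ?thesis
  proof
    fix \<tau> assume \<tau>: "\<tau> \<in> faces_upto X (int d - 2)"
    then have "\<tau> \<in> X" "2 \<le> cod \<tau>" by (auto simp: faces_upto_def codim_def)
    then show "lambda2_walk d X \<pi> \<tau>
        \<le> spectral_radius_on V (mat_mult_on V (Pi_inv d X \<pi> \<tau>) (M \<tau>))"
      using conn \<tau> sym[OF \<tau>] bounds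
      by (intro lambda2_walk_le_spectral_radius) (auto simp: totally_connected_def)
  qed
qed

end
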